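(* Consider pairs $(\mathbf q,m)$ where $\mathbf q=(\mathbf q_1,\dots,\mathbf q_5)\in(\mathbb R^2)^5$ are the five vertices of an equilateral pentagon having an axis of symmetry, $m=(m_1,\dots,m_5)$ are positive masses normalized by $\sum_{i=1}^5 m_i=1$, and $\mathbf q$ is a central configuration of the planar Newtonian $5$-body problem for the masses $m$. Up to rotations, translations and dilations of the plane and relabeling of the bodies, there are exactly two such pairs: (a) the (convex) regular pentagon with five equal masses, $m_1=\dots=m_5=1/5$; (b) a concave equilateral pentagon, which has a representative with $$\mathbf q_1=(1/2,0),\quad \mathbf q_2=(-1/2,0),\quad \mathbf q_3=(x_3,y_3),\quad \mathbf q_4=(-x_3,y_3),\quad \mathbf q_5=(0,y_5),$$ whose sides are the segments $\mathbf q_1\mathbf q_2$, $\mathbf q_2\mathbf q_4$, $\mathbf q_4\mathbf q_5$, $\mathbf q_5\mathbf q_3$, $\mathbf q_3\mathbf q_1$ (all of length $1$), where $$x_3\approx 0.5402091568,\quad y_3\approx 0.9991912848,\quad y_5\approx 0.1576604970,$$ and whose masses satisfy $$m_1=m_2\approx 0.0922539749,\quad m_3=m_4\approx 0.3860948766,\quad m_5\approx 0.04330242730 .$$ Here $a\approx b$ means $|a-b|<10^{-6}$.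
   Context: Given positive masses $m_1,\dots,m_5$, a configuration $\mathbf q=(\mathbf q_1,\dots,\mathbf q_5)\in(\mathbb R^2)^5$ with $\mathbf q_i\ne\mathbf q_j$ for $i\neq j$ is a central configuration (of the planar Newtonian $5$-body problem, gravitational constant $G=1$) if there exists $\lambda\in\mathbb R$ such that $$\sum_{j\ne i} m_j\frac{\mathbf q_i-\mathbf q_j}{r_{ij}^3}=\lambda(\mathbf q_i-\mathbf c_m),\qquad 1\le i\le 5,$$ where $r_{ij}=|\mathbf q_i-\mathbf q_j|$ and $\mathbf c_m=\big(\sum_i m_i\mathbf q_i\big)/\big(\sum_i m_i\big)$ is the center of mass. This notion is invariant under rotations, translations and dilations, and classes are taken modulo these transformations. A pentagon is a non-self-intersecting, nondegenerate polygon in the plane with five sides and five distinct vertices (no three consecutive vertices collinear). It is equilateral if its five sides have equal length, and regular if moreover its five angles are equal. It has an axis of symmetry if it is invariant under reflection in some line; the symmetry concerns the positions only, and no symmetry of the masses is assumed. A configuration is convex if no body belongs to the convex hull of the other four, and concave otherwise. *)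

theory Defs
  imports "HOL-Analysis.Analysis"
begin

text \<open>
  The five bodies are indexed by the type \<^typ>\<open>5\<close>, whose elements are the residues
  \<open>1, 2, 3, 4, 5 = 0\<close>; in particular \<open>i + 1\<close> is the cyclic successor of \<open>i\<close>.
\<close>

type_synonym config = "real^2^5"
type_synonym masses = "real^5"

subsection \<open>Central configurations\<close>

definition center_of_mass :: "config \<Rightarrow> masses \<Rightarrow> real^2" where
  "center_of_mass q m = (1 / (\<Sum>i\<in>UNIV. m $ i)) *\<^sub>R (\<Sum>i\<in>UNIV. (m $ i) *\<^sub>R (q $ i))"

definition central_configuration :: "config \<Rightarrow> masses \<Rightarrow> bool" where
  "central_configuration q m \<longleftrightarrow>
     (\<forall>i j. i \<noteq> j \<longrightarrow> q $ i \<noteq> q $ j) \<and>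
     (\<exists>l::real. \<forall>i.
        (\<Sum>j\<in>UNIV - {i}. (m $ j / dist (q $ i) (q $ j) ^ 3) *\<^sub>R (q $ i - q $ j))
          = l *\<^sub>R (q $ i - center_of_mass q m))"

definition convex_configuration :: "config \<Rightarrow> bool" where
  "convex_configuration q \<longleftrightarrow>
     (\<forall>i. q $ i \<notin> convex hull ((\<lambda>j. q $ j) ` (UNIV - {i})))"

abbreviation concave_configuration :: "config \<Rightarrow> bool" where
  "concave_configuration q \<equiv> \<not> convex_configuration q"

definition relabel :: "(5 \<Rightarrow> 5) \<Rightarrow> 'a^5 \<Rightarrow> 'a^5" where
  "relabel \<sigma> v = (\<chi> i. v $ \<sigma> i)"

subsection \<open>Pentagons\<close>

text \<open>Here a vector \<open>p\<close> lists the vertices in the cyclic order in which the sides join them.\<close>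

definition side :: "config \<Rightarrow> 5 \<Rightarrow> (real^2) set" where
  "side p i = closed_segment (p $ i) (p $ (i + 1))"

text \<open>
  The second conjunct says that the closed polygonal curve does not intersect itself:
  two distinct sides have at most a common endpoint in common.
\<close>

definition pentagon :: "config \<Rightarrow> bool" where
  "pentagon p \<longleftrightarrow>
     (\<forall>i j. i \<noteq> j \<longrightarrow> p $ i \<noteq> p $ j) \<and>
     (\<forall>i j. i \<noteq> j \<longrightarrow>
        side p i \<inter> side p j \<subseteq> {p $ i, p $ (i + 1)} \<inter> {p $ j, p $ (j + 1)}) \<and>
     (\<forall>i. \<not> collinear {p $ i, p $ (i + 1), p $ (i + 2)})"

definition equilateral_pentagon :: "config \<Rightarrow> bool" where
  "equilateral_pentagon p \<longleftrightarrow> pentagon p \<and>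
     (\<forall>i j. dist (p $ i) (p $ (i + 1)) = dist (p $ j) (p $ (j + 1)))"

definition angle :: "real^2 \<Rightarrow> real^2 \<Rightarrow> real^2 \<Rightarrow> real" where
  "angle a b c = arccos (((a - b) \<bullet> (c - b)) / (norm (a - b) * norm (c - b)))"

text \<open>
  The unoriented angle at a vertex is the interior angle whenever the latter is less than
  \<open>\<pi>\<close>. An equilateral pentagon with all unoriented angles equal has no reflex vertex: the
  interior angles add up to \<open>3\<pi>\<close>, so the only other possibility would be four angles
  \<open>\<pi>/3\<close> and one \<open>5\<pi>/3\<close>, and then vertices coincide.
\<close>

definition regular_pentagon :: "config \<Rightarrow> bool" where
  "regular_pentagon p \<longleftrightarrow> equilateral_pentagon p \<and>
     (\<forall>i j. angle (p $ (i - 1)) (p $ i) (p $ (i + 1))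
          = angle (p $ (j - 1)) (p $ j) (p $ (j + 1)))"

text \<open>Reflection in the line through \<open>a\<close> with unit direction vector \<open>u\<close>.\<close>

definition reflection :: "real^2 \<Rightarrow> real^2 \<Rightarrow> real^2 \<Rightarrow> real^2" where
  "reflection a u x = a + (2 * ((x - a) \<bullet> u)) *\<^sub>R u - (x - a)"

definition has_symmetry_axis :: "config \<Rightarrow> bool" where
  "has_symmetry_axis p \<longleftrightarrow>
     (\<exists>a u. norm u = 1 \<and> reflection a u ` (\<Union>i. side p i) = (\<Union>i. side p i))"

subsection \<open>The pairs of configurations and masses, and their classes\<close>

text \<open>
  The bodies need not be numbered in the cyclic order of the pentagon; \<open>\<sigma>\<close> supplies
  that order.
\<close>

definition sym_equilateral_pentagon_vertices :: "config \<Rightarrow> bool" where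
  "sym_equilateral_pentagon_vertices q \<longleftrightarrow>
     (\<exists>\<sigma>. bij \<sigma> \<and> equilateral_pentagon (relabel \<sigma> q) \<and> has_symmetry_axis (relabel \<sigma> q))"

definition pentagon_pairs :: "(config \<times> masses) set" where
  "pentagon_pairs = {(q, m).
     sym_equilateral_pentagon_vertices q \<and>
     (\<forall>i. 0 < m $ i) \<and> (\<Sum>i\<in>UNIV. m $ i) = 1 \<and>
     central_configuration q m}"

definition same_class :: "((config \<times> masses) \<times> (config \<times> masses)) set" where
  "same_class = {((q, m), (q', m')).
     \<exists>\<sigma> (A :: real^2^2) c t. bij \<sigma> \<and> rotation_matrix A \<and> 0 < c \<and>
       (\<forall>i. q' $ \<sigma> i = c *\<^sub>R (A *v (q $ i)) + t) \<and> (\<forall>i. m' $ \<sigma> i = m $ i)}"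

definition approx :: "real \<Rightarrow> real \<Rightarrow> bool" where
  "approx a b \<longleftrightarrow> \<bar>a - b\<bar> < 1 / 10 ^ 6"

end

theory Submission
  imports Defs
begin

text \<open>
  A symmetry axis permutes the vertices, since these are the points of the closed curve that are not
  midpoints of a segment contained in it; hence it fixes one vertex and the pentagon can be brought
  into a one-parameter normal form in the abscissa \<open>x\<close> of the paper's third body, on two branches.
  The equations of Laura and Andoyer force the masses to be symmetric, and elimination of the masses
  leaves one equation in \<open>x\<close> per branch. On the first branch it factors through
  \<open>4 x\<^sup>2 - 2 x - 1\<close>, which singles out the regular pentagon; the cofactor is negative on the whole
  interval, by bounds on a finite grid. On the second branch the sign conditions and crude estimates
  confine \<open>x\<close> to \<open>(1/2, 14/25)\<close>, where the difference of the two sides is strictly monotone,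
  and the intermediate value theorem locates the solution.
\<close>

text \<open>The convex balance equation does vanish, at the regular pentagon, so numerical bounds
  alone cannot settle it: its factor must be divided out exactly. This is possible because the
  equation splits into three parts, each vanishing when all diagonals agree; every part is a
  difference of radical expressions, and multiplying by the conjugate exposes the common factor. The
  margin left for the cofactor is smallest near x = 0.8, only about 0.06, and this governs the
  spacing of the grid. The concave solution has no such distinguished value. Its uniqueness comes
  from comparing difference quotients: close to x = 1/2 the inverse cube of \<open>2 * x\<close>
  falls so fast that this change outweighs all others, which is why x is first confined. Square
  roots are compared with rationals only through their squares, so each numerical claim becomes an
  inequality between rationals. Classes admit rotations but no mirror images; since the pentagons
  are mirror symmetric, a relabelling takes the place of a reflection.\<close>

section \<open>Indices modulo 5\<close>

lemma exhaust_5: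
  fixes x :: 5
  shows "x = 0 \<or> x = 1 \<or> x = 2 \<or> x = 3 \<or> x = 4"
proof (induct x)
  case (of_int z)
  then have "z = 0 \<or> z = 1 \<or> z = 2 \<or> z = 3 \<or> z = 4" by fastforce
  then show ?case by auto
qed

lemma mod_5:
  "(5::5) = 0" "(6::5) = 1" "(7::5) = 2" "(8::5) = 3" "(9::5) = 4" "(10::5) = 0" "(11::5) = 1"
  "(12::5) = 2" "(13::5) = 3" "(14::5) = 4" "(15::5) = 0" "(16::5) = 1"
  "(-1::5) = 4" "(-2::5) = 3" "(-3::5) = 2" "(-4::5) = 1" "(-5::5) = 0"
  by simp_all

lemma forall_5: "(\<forall>i::5. P i) \<longleftrightarrow> P 0 \<and> P 1 \<and> P 2 \<and> P 3 \<and> P 4"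
  by (metis exhaust_5)

lemma UNIV_5: "UNIV = {0, 1, 2, 3, 4::5}"
  using exhaust_5 by auto

lemma sum_5: "sum f (UNIV::5 set) = f 0 + f 1 + f 2 + f 3 + f 4"
  unfolding UNIV_5 by (simp add: add.assoc)

lemma vector_5 [simp]:
  "(vector [a,b,c,d,e] :: 'a::zero^5) $ 0 = e"
  "(vector [a,b,c,d,e] :: 'a::zero^5) $ 1 = a"
  "(vector [a,b,c,d,e] :: 'a::zero^5) $ 2 = b"
  "(vector [a,b,c,d,e] :: 'a::zero^5) $ 3 = c"
  "(vector [a,b,c,d,e] :: 'a::zero^5) $ 4 = d"
  unfolding vector_def by simp_all

lemma dihedral_5:
  fixes \<tau> :: "5 \<Rightarrow> 5"
  assumes step: "\<And>i. \<tau> (i + 1) = \<tau> i + 1 \<or> \<tau> (i + 1) = \<tau> i - 1"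
    and inj: "inj \<tau>" and inv: "\<And>i. \<tau> (\<tau> i) = i"
  shows "(\<forall>i. \<tau> i = i) \<or> (\<exists>k. \<forall>i. \<tau> (k + i) = k - i)"
proof -
  have s: "\<tau> 1 = \<tau> 0 + 1 \<or> \<tau> 1 = \<tau> 0 - 1" "\<tau> 2 = \<tau> 1 + 1 \<or> \<tau> 2 = \<tau> 1 - 1"
    "\<tau> 3 = \<tau> 2 + 1 \<or> \<tau> 3 = \<tau> 2 - 1" "\<tau> 4 = \<tau> 3 + 1 \<or> \<tau> 4 = \<tau> 3 - 1"
    using step[of 0] step[of 1] step[of 2] step[of 3] by simp_all
  have d: "\<tau> 2 \<noteq> \<tau> 0" "\<tau> 3 \<noteq> \<tau> 1" "\<tau> 4 \<noteq> \<tau> 2"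
    using inj by (simp_all add: inj_eq)
  \<comment> \<open>An injective walk on the 5-cycle by steps of size 1 cannot turn back, so all
    steps have the same sign.\<close>
  have cases: "(\<tau> 1 = \<tau> 0 + 1 \<and> \<tau> 2 = \<tau> 0 + 2 \<and> \<tau> 3 = \<tau> 0 + 3 \<and> \<tau> 4 = \<tau> 0 + 4) \<or>
    (\<tau> 1 = \<tau> 0 - 1 \<and> \<tau> 2 = \<tau> 0 - 2 \<and> \<tau> 3 = \<tau> 0 - 3 \<and> \<tau> 4 = \<tau> 0 - 4)"
    using s d by (elim disjE) (simp_all add: diff_diff_eq add.assoc)
  show ?thesis using cases
  proof
    assume *: "\<tau> 1 = \<tau> 0 + 1 \<and> \<tau> 2 = \<tau> 0 + 2 \<and> \<tau> 3 = \<tau> 0 + 3 \<and> \<tau> 4 = \<tau> 0 + 4"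
    \<comment> \<open>A rotation that is its own inverse is trivial because 5 is odd.\<close>
    have "\<tau> 0 = 0"
      using exhaust_5[of "\<tau> 0"] * inv[of 0] by auto
    with * show ?thesis by (simp add: forall_5)
  next
    assume *: "\<tau> 1 = \<tau> 0 - 1 \<and> \<tau> 2 = \<tau> 0 - 2 \<and> \<tau> 3 = \<tau> 0 - 3 \<and> \<tau> 4 = \<tau> 0 - 4"
    \<comment> \<open>The fixed index \<open>k\<close> solves \<open>2 * k = \<tau> 0\<close>, and 3
      is the inverse of 2 modulo 5.\<close>
    have "\<forall>i. \<tau> (3 * \<tau> 0 + i) = 3 * \<tau> 0 - i"
      using exhaust_5[of "\<tau> 0"] * by (elim disjE) (simp_all add: forall_5 mod_5)
    then show ?thesis by blast
  qed
qed

section \<open>Symmetry axes of equilateral pentagons\<close>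

lemma reflection_reflection:
  assumes "norm u = 1"
  shows "reflection a u (reflection a u x) = x"
proof -
  have "u \<bullet> u = 1" using assms by (simp add: dot_square_norm)
  then show ?thesis
    unfolding reflection_def by (simp add: algebra_simps)
qed

lemma dist_reflection:
  assumes "norm u = 1"
  shows "dist (reflection a u x) (reflection a u y) = dist x y"
proof -
  have u: "u \<bullet> u = 1" using assms by (simp add: dot_square_norm)
  have "reflection a u x - reflection a u y = (2 * ((x - y) \<bullet> u)) *\<^sub>R u - (x - y)"
    unfolding reflection_def by (simp add: algebra_simps)
  moreover have "((2 * (d \<bullet> u)) *\<^sub>R u - d) \<bullet> ((2 * (d \<bullet> u)) *\<^sub>R u - d) = d \<bullet> d" for d
    using u by (simp add: algebra_simps inner_commute)
  ultimately show ?thesis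
    by (simp add: dist_norm norm_eq_sqrt_inner)
qed

lemma reflection_convex_comb:
  "reflection a u ((1 - t) *\<^sub>R x + t *\<^sub>R y) = (1 - t) *\<^sub>R reflection a u x + t *\<^sub>R reflection a u y"
  unfolding reflection_def by (simp add: algebra_simps)

lemma reflection_closed_segment:
  "reflection a u ` closed_segment x y = closed_segment (reflection a u x) (reflection a u y)"
  unfolding closed_segment_image_interval image_image by (simp add: reflection_convex_comb)

locale pentagonal_curve =
  fixes p :: config
  assumes pentagon: "pentagon p"
begin

abbreviation "curve \<equiv> \<Union>i. side p i"

lemma vertex_inj: "p $ i = p $ j \<longleftrightarrow> i = j"
  using pentagon unfolding pentagon_def by blast

lemma side_inter:
  assumes "i \<noteq> j" "x \<in> side p i" "x \<in> side p j"
  shows "x \<in> {p $ i, p $ (i + 1)} \<inter> {p $ j, p $ (j + 1)}"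
  using assms pentagon unfolding pentagon_def by blast

lemma not_collinear: "\<not> collinear {p $ i, p $ (i + 1), p $ (i + 2)}"
  using pentagon unfolding pentagon_def by blast

lemma not_collinear': "\<not> collinear {p $ (i - 1), p $ i, p $ (i + 1)}"
  using not_collinear[of "i - 1"] by (simp add: algebra_simps)

lemma vertex_in_side: "p $ i \<in> side p j \<longleftrightarrow> j = i \<or> j = i - 1"
proof
  assume *: "p $ i \<in> side p j"
  show "j = i \<or> j = i - 1"
  proof (rule ccontr)
    assume n: "\<not> (j = i \<or> j = i - 1)"
    then have "p $ i \<in> {p $ j, p $ (j + 1)}"
      using side_inter[of i j "p $ i"] * by (auto simp: side_def)
    then show False using n by (auto simp: vertex_inj)
  qed
qed (auto simp: side_def)

text \<open>The sides that avoid the vertex form a closed set, hence keep a positive distance from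
  it.\<close>

lemma curve_near_vertex:
  obtains \<epsilon> where "\<epsilon> > 0" "\<And>x. x \<in> curve \<Longrightarrow> dist x (p $ i) < \<epsilon> \<Longrightarrow> x \<in> side p i \<union> side p (i - 1)"
proof -
  let ?F = "\<Union>j\<in>- {i, i - 1}. side p j"
  have "closed ?F"
    by (intro closed_UN) (auto simp: side_def)
  moreover have "p $ i \<notin> ?F" by (auto simp: vertex_in_side)
  ultimately obtain \<epsilon> where "\<epsilon> > 0" "ball (p $ i) \<epsilon> \<subseteq> - ?F"
    by (meson open_Compl open_contains_ball ComplI)
  then have "x \<in> side p i \<union> side p (i - 1)" if "x \<in> curve" "dist x (p $ i) < \<epsilon>" for x
    using that by (auto simp: subset_iff dist_commute)
  with \<open>\<epsilon> > 0\<close> show ?thesis using that by blast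
qed

text \<open>A short initial piece of the segment lies where the curve consists of the two incident
  sides. This fixes the direction of \<open>e\<close> and leaves its length open; lengths are
  matched later by equilaterality.\<close>

lemma segment_from_vertex:
  assumes e: "e \<noteq> 0" and sub: "closed_segment (p $ i) (p $ i + e) \<subseteq> curve"
  obtains t where "t > 0" "e = t *\<^sub>R (p $ (i + 1) - p $ i) \<or> e = t *\<^sub>R (p $ (i - 1) - p $ i)"
proof -
  obtain \<epsilon> where \<epsilon>: "\<epsilon> > 0" "\<And>x. x \<in> curve \<Longrightarrow> dist x (p $ i) < \<epsilon> \<Longrightarrow> x \<in> side p i \<union> side p (i - 1)"
    using curve_near_vertex by blast
  \<comment> \<open>Small enough to stay on the segment (\<open>\<delta> \<le> 1\<close>) and,
    thanks to the 2, strictly within \<open>\<epsilon>\<close> of the vertex.\<close>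
  define \<delta> where "\<delta> = min 1 (\<epsilon> / (2 * norm e))"
  have \<delta>: "0 < \<delta>" "\<delta> \<le> 1" using \<epsilon>(1) e by (auto simp: \<delta>_def)
  have "\<delta> * norm e \<le> \<epsilon> / (2 * norm e) * norm e"
    by (intro mult_right_mono) (auto simp: \<delta>_def)
  then have "\<delta> * norm e < \<epsilon>" using \<epsilon>(1) e by simp
  moreover have "p $ i + \<delta> *\<^sub>R e \<in> closed_segment (p $ i) (p $ i + e)"
    unfolding in_segment using \<delta> by (auto intro!: exI[of _ \<delta>] simp: algebra_simps)
  ultimately have "p $ i + \<delta> *\<^sub>R e \<in> side p i \<union> side p (i - 1)"
    using \<epsilon>(2)[of "p $ i + \<delta> *\<^sub>R e"] sub \<delta> by (auto simp: dist_norm)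
  then obtain r where r: "0 \<le> r" "\<delta> *\<^sub>R e = r *\<^sub>R (p $ (i + 1) - p $ i) \<or> \<delta> *\<^sub>R e = r *\<^sub>R (p $ (i - 1) - p $ i)"
  proof
    assume "p $ i + \<delta> *\<^sub>R e \<in> side p i"
    then obtain u where u: "p $ i + \<delta> *\<^sub>R e = (1 - u) *\<^sub>R p $ i + u *\<^sub>R p $ (i + 1)" "0 \<le> u"
      unfolding side_def in_segment by blast
    have "\<delta> *\<^sub>R e = (p $ i + \<delta> *\<^sub>R e) - p $ i" by simp
    also have "\<dots> = u *\<^sub>R (p $ (i + 1) - p $ i)"
      unfolding u(1) by (simp add: algebra_simps)
    finally show ?thesis using that u(2) by blast
  next
    assume "p $ i + \<delta> *\<^sub>R e \<in> side p (i - 1)"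
    then obtain u where u: "p $ i + \<delta> *\<^sub>R e = (1 - u) *\<^sub>R p $ (i - 1) + u *\<^sub>R p $ i" "u \<le> 1"
      unfolding side_def in_segment by auto
    have "\<delta> *\<^sub>R e = (p $ i + \<delta> *\<^sub>R e) - p $ i" by simp
    also have "\<dots> = (1 - u) *\<^sub>R (p $ (i - 1) - p $ i)"
      unfolding u(1) by (simp add: algebra_simps)
    finally show ?thesis using that[of "1 - u"] u(2) by auto
  qed
  have "r \<noteq> 0" using r(2) e \<delta>(1) by auto
  with r(1) have "0 < r / \<delta>" using \<delta> by simp
  moreover have "e = (r / \<delta>) *\<^sub>R v" if "\<delta> *\<^sub>R e = r *\<^sub>R v" for v
  proof -
    have "e = (1 / \<delta>) *\<^sub>R (\<delta> *\<^sub>R e)" using \<delta> by simp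
    then show ?thesis unfolding that by simp
  qed
  ultimately show ?thesis using that r(2) by blast
qed

text \<open>The right-hand side refers to the curve only as a point set and survives isometries,
  which is what makes a reflection of the curve act on the vertices. At a vertex, the halves of a
  centred segment would run along incident sides in opposite directions, against
  noncollinearity.\<close>

lemma vertex_iff:
  assumes x: "x \<in> curve"
  shows "(\<exists>i. x = p $ i) \<longleftrightarrow> \<not> (\<exists>d. d \<noteq> 0 \<and> closed_segment (x - d) (x + d) \<subseteq> curve)"
proof
  assume "\<exists>i. x = p $ i"
  then obtain i where i: "x = p $ i" ..
  show "\<not> (\<exists>d. d \<noteq> 0 \<and> closed_segment (x - d) (x + d) \<subseteq> curve)"
  proof
    assume "\<exists>d. d \<noteq> 0 \<and> closed_segment (x - d) (x + d) \<subseteq> curve"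
    then obtain d where d: "d \<noteq> 0" "closed_segment (x - d) (x + d) \<subseteq> curve" by blast
    have "x = midpoint (x - d) (x + d)"
      by (simp add: midpoint_def algebra_simps flip: scaleR_2)
    then have xin: "x \<in> closed_segment (x - d) (x + d)"
      by (metis midpoint_in_closed_segment)
    then have "closed_segment (p $ i) (p $ i + d) \<subseteq> curve" "closed_segment (p $ i) (p $ i + (- d)) \<subseteq> curve"
      using d(2) subset_closed_segment[of x "x + d" "x - d" "x + d"]
        subset_closed_segment[of x "x - d" "x - d" "x + d"] unfolding i by auto
    then obtain t t' where t: "t > 0" "d = t *\<^sub>R (p $ (i + 1) - p $ i) \<or> d = t *\<^sub>R (p $ (i - 1) - p $ i)"
      and t': "t' > 0" "- d = t' *\<^sub>R (p $ (i + 1) - p $ i) \<or> - d = t' *\<^sub>R (p $ (i - 1) - p $ i)"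
      using segment_from_vertex d(1) by (metis neg_equal_0_iff_equal)
    have same: False if "d = t *\<^sub>R v" "- d = t' *\<^sub>R v" for v
    proof -
      have "(t + t') *\<^sub>R v = d + - d" unfolding that(2) using that(1) by (simp add: scaleR_add_left)
      then show False using t(1) t'(1) d(1) that by auto
    qed
    have opp: False if "s > 0" "s' > 0" "s *\<^sub>R (p $ (i + 1) - p $ i) = - (s' *\<^sub>R (p $ (i - 1) - p $ i))" for s s'
    proof -
      have "p $ (i + 1) - p $ i = (1 / s) *\<^sub>R (s *\<^sub>R (p $ (i + 1) - p $ i))"
        using that(1) by simp
      also have "\<dots> = (1 / s) *\<^sub>R (- (s' *\<^sub>R (p $ (i - 1) - p $ i)))"
        by (simp only: that(3))
      also have "\<dots> = (- (s' / s)) *\<^sub>R (p $ (i - 1) - p $ i)"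
        by simp
      finally have "\<exists>c. p $ (i + 1) - p $ i = c *\<^sub>R (p $ (i - 1) - p $ i)" ..
      then have "collinear {0, p $ (i - 1) - p $ i, p $ (i + 1) - p $ i}"
        using collinear_lemma by blast
      then have "collinear {p $ (i - 1), p $ i, p $ (i + 1)}"
        by (subst collinear_3) (simp_all add: NO_MATCH_def)
      then show False using not_collinear' by simp
    qed
    show False using t(2) t'(2)
    proof (elim disjE)
      assume "d = t *\<^sub>R (p $ (i + 1) - p $ i)" "- d = t' *\<^sub>R (p $ (i - 1) - p $ i)"
      then show False using opp[OF t(1) t'(1)] by (metis add.inverse_inverse)
    next
      assume "d = t *\<^sub>R (p $ (i - 1) - p $ i)" "- d = t' *\<^sub>R (p $ (i + 1) - p $ i)"
      then show False using opp[OF t'(1) t(1)] by metis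
    next
      assume "d = t *\<^sub>R (p $ (i + 1) - p $ i)" "- d = t' *\<^sub>R (p $ (i + 1) - p $ i)"
      then show False by (rule same)
    next
      assume "d = t *\<^sub>R (p $ (i - 1) - p $ i)" "- d = t' *\<^sub>R (p $ (i - 1) - p $ i)"
      then show False by (rule same)
    qed
  qed
next
  assume nd: "\<not> (\<exists>d. d \<noteq> 0 \<and> closed_segment (x - d) (x + d) \<subseteq> curve)"
  obtain i where i: "x \<in> side p i" using x by blast
  then obtain u where u: "0 \<le> u" "u \<le> 1" "x = (1 - u) *\<^sub>R p $ i + u *\<^sub>R p $ (i + 1)"
    unfolding side_def in_segment by blast
  \<comment> \<open>Half of the longest segment centred at \<open>x\<close> within its side; it
    vanishes only at the endpoints.\<close>
  define d where "d = (min u (1 - u)) *\<^sub>R (p $ (i + 1) - p $ i)"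
  have in_side: "x + r *\<^sub>R (p $ (i + 1) - p $ i) \<in> side p i" if "0 \<le> u + r" "u + r \<le> 1" for r
  proof -
    have "x + r *\<^sub>R (p $ (i + 1) - p $ i) = (1 - (u + r)) *\<^sub>R p $ i + (u + r) *\<^sub>R p $ (i + 1)"
      unfolding u(3) by (simp add: algebra_simps)
    then show ?thesis using that unfolding side_def in_segment by blast
  qed
  have "x - d \<in> side p i" "x + d \<in> side p i"
    using in_side[of "min u (1 - u)"] in_side[of "- min u (1 - u)"] u by (auto simp: d_def)
  then have "closed_segment (x - d) (x + d) \<subseteq> side p i"
    unfolding side_def by (meson closed_segment_subset convex_closed_segment)
  with nd have "d = 0" by blast
  then have "u = 0 \<or> u = 1"
    using u by (auto simp: d_def min_def vertex_inj split: if_splits)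
  then show "\<exists>i. x = p $ i" using u(3) by auto
qed

lemma vertex_in_curve: "p $ i \<in> curve"
  by (auto simp: side_def)

text \<open>Equal lengths make the image of a side a whole side, so the induced permutation
  preserves neighbours and is dihedral. The identity would place all vertices on the axis; what
  remains fixes the vertex \<open>p $ k\<close> and swaps the others in pairs.\<close>

lemma reflection_vertices:
  assumes eq: "\<And>i j. dist (p $ i) (p $ (i + 1)) = dist (p $ j) (p $ (j + 1))"
    and u: "norm u = 1" and sym: "reflection a u ` curve = curve"
  obtains k where "\<And>i. reflection a u (p $ (k + i)) = p $ (k - i)"
proof -
  let ?R = "reflection a u"
  have RR: "?R (?R x) = x" for x using reflection_reflection[OF u] .
  have Rsub: "?R x - ?R y = ?R z - ?R w" if "x - y = z - w" for x y z w
  proof -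
    have R: "?R x - ?R y = (2 * ((x - y) \<bullet> u)) *\<^sub>R u - (x - y)" for x y
      unfolding reflection_def by (simp add: algebra_simps)
    show ?thesis unfolding R that ..
  qed
  have "\<exists>j. ?R (p $ i) = p $ j" for i
  proof (subst vertex_iff)
    show "?R (p $ i) \<in> curve" by (metis imageI sym vertex_in_curve)
    show "\<not> (\<exists>d. d \<noteq> 0 \<and> closed_segment (?R (p $ i) - d) (?R (p $ i) + d) \<subseteq> curve)"
    proof
      assume "\<exists>d. d \<noteq> 0 \<and> closed_segment (?R (p $ i) - d) (?R (p $ i) + d) \<subseteq> curve"
      then obtain d where d: "d \<noteq> 0" "closed_segment (?R (p $ i) - d) (?R (p $ i) + d) \<subseteq> curve" by blast
      define e where "e = ?R (?R (p $ i) + d) - p $ i"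
      have "e = p $ i - ?R (?R (p $ i) - d)"
        using Rsub[of "?R (p $ i) + d" "?R (p $ i)" "?R (p $ i)" "?R (p $ i) - d"] by (simp add: e_def RR)
      then have e: "?R (?R (p $ i) + d) = p $ i + e" "?R (?R (p $ i) - d) = p $ i - e"
        by (auto simp: e_def)
      have "e \<noteq> 0"
      proof
        assume "e = 0"
        then have "?R (?R (p $ i) + d) = p $ i" using e by simp
        then have "?R (p $ i) + d = ?R (p $ i)" using RR[of "?R (p $ i) + d"] by simp
        with d show False by simp
      qed
      moreover have "closed_segment (p $ i - e) (p $ i + e) \<subseteq> curve"
        using image_mono[OF d(2), of ?R] unfolding reflection_closed_segment e sym .
      ultimately show False
        using vertex_iff[OF vertex_in_curve, of i] by blast
    qed
  qed
  then obtain \<tau> where \<tau>: "\<And>i. ?R (p $ i) = p $ \<tau> i" by metis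
  have inv: "\<tau> (\<tau> i) = i" for i
    using RR[of "p $ i"] by (simp add: \<tau> vertex_inj)
  have inj: "inj \<tau>" using inv by (metis injI)
  have step: "\<tau> (i + 1) = \<tau> i + 1 \<or> \<tau> (i + 1) = \<tau> i - 1" for i
  proof -
    let ?e = "p $ \<tau> (i + 1) - p $ \<tau> i"
    have "closed_segment (p $ \<tau> i) (p $ \<tau> i + ?e) = ?R ` side p i"
      by (simp add: side_def reflection_closed_segment \<tau>)
    also have "\<dots> \<subseteq> ?R ` curve" by (intro image_mono) auto
    also have "\<dots> = curve" by (fact sym)
    finally have sub: "closed_segment (p $ \<tau> i) (p $ \<tau> i + ?e) \<subseteq> curve" .
    have "i + 1 \<noteq> i" by simp
    then have "?e \<noteq> 0" using inj by (metis right_minus_eq vertex_inj injD)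
    then obtain t where t: "t > 0"
      "?e = t *\<^sub>R (p $ (\<tau> i + 1) - p $ \<tau> i) \<or> ?e = t *\<^sub>R (p $ (\<tau> i - 1) - p $ \<tau> i)"
      using segment_from_vertex sub by metis
    have "norm ?e = dist (p $ i) (p $ (i + 1))"
      using dist_reflection[OF u, of a "p $ i" "p $ (i + 1)"] by (simp add: \<tau> dist_norm norm_minus_commute)
    then have n: "norm ?e = dist (p $ j) (p $ (j + 1))" for j
      using eq by metis
    have "norm ?e = norm (p $ (\<tau> i + 1) - p $ \<tau> i)" "norm ?e = norm (p $ (\<tau> i - 1) - p $ \<tau> i)"
      using n[of "\<tau> i"] n[of "\<tau> i - 1"] by (simp_all add: dist_norm norm_minus_commute)
    then have "t = 1" using t \<open>?e \<noteq> 0\<close> by auto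
    then show ?thesis using t(2) by (auto simp: vertex_inj)
  qed
  have "\<not> (\<forall>i. \<tau> i = i)"
  proof
    assume "\<forall>i. \<tau> i = i"
    then have "p $ i = a + ((p $ i - a) \<bullet> u) *\<^sub>R u" for i
    proof -
      have "?R (p $ i) = p $ i" using \<tau> \<open>\<forall>i. \<tau> i = i\<close> by simp
      then have "2 *\<^sub>R (p $ i) = 2 *\<^sub>R (a + ((p $ i - a) \<bullet> u) *\<^sub>R u)"
        unfolding reflection_def by (simp add: algebra_simps scaleR_2)
      then show ?thesis by simp
    qed
    then have "\<exists>c. p $ i = a + c *\<^sub>R u" for i by blast
    then have "collinear {p $ 0, p $ (0 + 1), p $ (0 + 2)}"
      unfolding collinear_alt by blast
    then show False using not_collinear by blast
  qed
  then obtain k where "\<And>i. \<tau> (k + i) = k - i"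
    using dihedral_5[OF step inj inv] by blast
  then show ?thesis using that \<tau> by metis
qed

end

section \<open>Similarity classes with relabelling\<close>

lemma refl_same_class: "(x, x) \<in> same_class"
proof -
  obtain q m where x: "x = (q, m)" by (cases x)
  have "\<exists>\<sigma> (A :: real^2^2) c t. bij \<sigma> \<and> rotation_matrix A \<and> 0 < c \<and>
       (\<forall>i. q $ \<sigma> i = c *\<^sub>R (A *v (q $ i)) + t) \<and> (\<forall>i. m $ \<sigma> i = m $ i)"
    by (intro exI[of _ id] exI[of _ "mat 1 :: real^2^2"] exI[of _ "1::real"] exI[of _ 0])
      (auto simp: rotation_matrix_def orthogonal_matrix_id)
  then show ?thesis unfolding x same_class_def by simp
qed

lemma sym_same_class:
  assumes "(x, y) \<in> same_class"
  shows "(y, x) \<in> same_class"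
proof -
  obtain q m q' m' where xy: "x = (q, m)" "y = (q', m')" by (cases x, cases y)
  obtain \<sigma> c t and A :: "real^2^2" where *: "bij \<sigma>" "rotation_matrix A" "0 < c"
    "\<And>i. q' $ \<sigma> i = c *\<^sub>R (A *v (q $ i)) + t" "\<And>i. m' $ \<sigma> i = m $ i"
    using assms unfolding xy same_class_def by blast
  have AA: "transpose A *v (A *v v) = v" for v
    using *(2) by (simp add: matrix_vector_mul_assoc rotation_matrix_def orthogonal_matrix_def)
  have \<sigma>: "\<sigma> (inv \<sigma> i) = i" for i using *(1) by (simp add: bij_is_surj surj_f_inv_f)
  have "q $ inv \<sigma> i = (1 / c) *\<^sub>R (transpose A *v (q' $ i)) + (- (1 / c) *\<^sub>R (transpose A *v t))" for i
  proof -
    have "A *v (q $ inv \<sigma> i) = (1 / c) *\<^sub>R (q' $ i - t)"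
      using *(4)[of "inv \<sigma> i"] *(3) by (simp add: \<sigma>)
    then have "q $ inv \<sigma> i = transpose A *v ((1 / c) *\<^sub>R (q' $ i - t))"
      using AA[of "q $ inv \<sigma> i"] by simp
    then show ?thesis
      by (simp add: matrix_vector_mult_diff_distrib matrix_vector_mult_scaleR scaleR_diff_right)
  qed
  moreover have "m $ inv \<sigma> i = m' $ i" for i using *(5)[of "inv \<sigma> i"] by (simp add: \<sigma>)
  moreover have "bij (inv \<sigma>)" "rotation_matrix (transpose A)" "0 < 1 / c"
    using * by (auto simp: bij_imp_bij_inv rotation_matrix_def orthogonal_matrix_transpose)
  ultimately show ?thesis
    unfolding xy same_class_def by blast
qed

lemma trans_same_class:
  assumes "(x, y) \<in> same_class" "(y, z) \<in> same_class"
  shows "(x, z) \<in> same_class"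
proof -
  obtain q m q' m' q'' m'' where xy: "x = (q, m)" "y = (q', m')" "z = (q'', m'')"
    by (cases x, cases y, cases z)
  obtain \<sigma> c t and A :: "real^2^2" where *: "bij \<sigma>" "rotation_matrix A" "0 < c"
    "\<And>i. q' $ \<sigma> i = c *\<^sub>R (A *v (q $ i)) + t" "\<And>i. m' $ \<sigma> i = m $ i"
    using assms(1) unfolding xy same_class_def by blast
  obtain \<sigma>' c' t' and A' :: "real^2^2" where **: "bij \<sigma>'" "rotation_matrix A'" "0 < c'"
    "\<And>i. q'' $ \<sigma>' i = c' *\<^sub>R (A' *v (q' $ i)) + t'" "\<And>i. m'' $ \<sigma>' i = m' $ i"
    using assms(2) unfolding xy same_class_def by blast
  have "q'' $ (\<sigma>' \<circ> \<sigma>) i = (c' * c) *\<^sub>R ((A' ** A) *v (q $ i)) + (c' *\<^sub>R (A' *v t) + t')" for i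
    by (simp add: *(4) **(4) matrix_vector_right_distrib matrix_vector_mult_scaleR
        scaleR_add_right matrix_vector_mul_assoc)
  moreover have "m'' $ (\<sigma>' \<circ> \<sigma>) i = m $ i" for i by (simp add: *(5) **(5))
  moreover have "bij (\<sigma>' \<circ> \<sigma>)" "rotation_matrix (A' ** A)" "0 < c' * c"
    using * ** by (auto simp: bij_comp rotation_matrix_def orthogonal_matrix_mul det_mul)
  ultimately show ?thesis
    unfolding xy same_class_def by blast
qed

lemma equiv_same_class: "equiv UNIV same_class"
proof (rule equivI)
  show "refl_on UNIV same_class" by (rule refl_onI) (rule refl_same_class)
  show "sym same_class" by (rule symI) (rule sym_same_class)
  show "trans same_class" by (rule transI) (rule trans_same_class)
qed simp

lemma relabel_same_class:
  assumes "bij \<sigma>"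
  shows "((relabel \<sigma> q, relabel \<sigma> m), (q, m)) \<in> same_class"
proof -
  have "\<exists>\<sigma>' (A :: real^2^2) c t. bij \<sigma>' \<and> rotation_matrix A \<and> 0 < c \<and>
       (\<forall>i. q $ \<sigma>' i = c *\<^sub>R (A *v (relabel \<sigma> q $ i)) + t) \<and> (\<forall>i. m $ \<sigma>' i = relabel \<sigma> m $ i)"
    by (intro exI[of _ \<sigma>] exI[of _ "mat 1 :: real^2^2"] exI[of _ "1::real"] exI[of _ 0])
      (auto simp: rotation_matrix_def orthogonal_matrix_id relabel_def assms)
  then show ?thesis unfolding same_class_def by simp
qed

section \<open>Normal form\<close>

text \<open>The components \<open>1, 2, 3, 4, 5 = 0\<close> are the paper's bodies 1, 2, 4, 5, 3, so that the
  vertices are listed in cyclic order.\<close>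

definition house :: "real \<Rightarrow> real \<Rightarrow> real \<Rightarrow> config" where
  "house x y z = vector [vector [1/2, 0], vector [-1/2, 0], vector [-x, y], vector [0, z], vector [x, y]]"

lemma house_nth:
  "house x y z $ 1 $ 1 = 1/2" "house x y z $ 1 $ 2 = 0"
  "house x y z $ 2 $ 1 = -1/2" "house x y z $ 2 $ 2 = 0"
  "house x y z $ 3 $ 1 = -x" "house x y z $ 3 $ 2 = y"
  "house x y z $ 4 $ 1 = 0" "house x y z $ 4 $ 2 = z"
  "house x y z $ 0 $ 1 = x" "house x y z $ 0 $ 2 = y"
  by (simp_all add: house_def)

text \<open>\<open>w\<close> is the height difference between the apex and the bodies at level
  \<open>y\<close>. The equations give roof and walls the length 1 of the base. As \<open>w\<close>
  is positive, the branch is carried separately by \<open>z = y + w\<close> or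
  \<open>z = y - w\<close>.\<close>

definition side_relations :: "real \<Rightarrow> real \<Rightarrow> real \<Rightarrow> bool" where
  "side_relations x y w \<longleftrightarrow> 0 < x \<and> 0 < y \<and> 0 < w \<and> w\<^sup>2 = 1 - x\<^sup>2 \<and> y\<^sup>2 = 1 - (x - 1/2)\<^sup>2"

text \<open>A clockwise quarter turn, so that the matrix with rows \<open>right_normal u\<close> and
  \<open>u\<close> has determinant 1 and turns \<open>u\<close> upright.\<close>

definition right_normal :: "real^2 \<Rightarrow> real^2" where
  "right_normal u = vector [u $ 2, - u $ 1]"

lemma inner_2: "(a::real^2) \<bullet> b = a $ 1 * b $ 1 + a $ 2 * b $ 2"
  by (simp add: inner_vec_def sum_2)

lemma orthonormal_expansion:
  assumes "norm u = 1"
  shows "d = (d \<bullet> right_normal u) *\<^sub>R right_normal u + (d \<bullet> u) *\<^sub>R u"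
    and "(norm d)\<^sup>2 = (d \<bullet> right_normal u)\<^sup>2 + (d \<bullet> u)\<^sup>2"
proof -
  have u: "u $ 1 * u $ 1 + u $ 2 * u $ 2 = 1"
    using assms dot_square_norm[of u] by (simp add: inner_2)
  show "d = (d \<bullet> right_normal u) *\<^sub>R right_normal u + (d \<bullet> u) *\<^sub>R u"
    unfolding vec_eq_iff forall_2 using u
    by (simp add: inner_2 right_normal_def) algebra
  show "(norm d)\<^sup>2 = (d \<bullet> right_normal u)\<^sup>2 + (d \<bullet> u)\<^sup>2"
    unfolding dot_square_norm[symmetric] using u by (simp add: inner_2 right_normal_def) algebra
qed

lemma rotation_to_axis:
  assumes "norm u = 1"
  shows "rotation_matrix (vector [right_normal u, u] :: real^2^2)"
    and "(vector [right_normal u, u] :: real^2^2) *v d = vector [d \<bullet> right_normal u, d \<bullet> u]"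
proof -
  have u: "u $ 1 * u $ 1 + u $ 2 * u $ 2 = 1"
    using assms dot_square_norm[of u] by (simp add: inner_2)
  show "rotation_matrix (vector [right_normal u, u] :: real^2^2)"
    using u unfolding rotation_matrix_def orthogonal_matrix
    by (simp add: det_2 right_normal_def vec_eq_iff forall_2 matrix_matrix_mult_def sum_2
        transpose_def mat_def mult.commute add.commute)
  show "(vector [right_normal u, u] :: real^2^2) *v d = vector [d \<bullet> right_normal u, d \<bullet> u]"
    by (simp add: vec_eq_iff forall_2 matrix_vector_mult_def sum_2 inner_2 mult.commute)
qed

context pentagonal_curve
begin

text \<open>Coordinates \<open>X\<close>, \<open>Y\<close> are taken along
  \<open>right_normal u\<close> and \<open>u\<close>, with origin at the midpoint of the side
  opposite the fixed vertex and the side length \<open>l\<close> as unit.\<close>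

lemma normal_form_aux:
  assumes eq: "\<And>i j. dist (p $ i) (p $ (i + 1)) = dist (p $ j) (p $ (j + 1))"
    and u: "norm u = 1" and R: "\<And>i. reflection a u (p $ (k + i)) = p $ (k - i)"
    and up: "(p $ (k + 1) - p $ (k + 2)) \<bullet> u \<ge> 0"
  shows "\<exists>x y z w \<rho> (A :: real^2^2) c t. bij \<rho> \<and> rotation_matrix A \<and> 0 < c \<and>
    (\<forall>i. house x y z $ i = c *\<^sub>R (A *v (p $ \<rho> i)) + t) \<and> side_relations x y w \<and> (z = y + w \<or> z = y - w)"
proof -
  let ?p = "\<lambda>i. p $ (k + i)"
  define o' where "o' = (1/2) *\<^sub>R (?p 2 + ?p 3)"
  define X where "X q = (q - o') \<bullet> right_normal u" for q
  define Y where "Y q = (q - o') \<bullet> u" for q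
  have uu: "u \<bullet> u = 1" "right_normal u \<bullet> u = 0" using u
    by (simp_all add: dot_square_norm) (simp add: right_normal_def inner_2)
  have XY: "q = o' + X q *\<^sub>R right_normal u + Y q *\<^sub>R u" for q
    using orthonormal_expansion(1)[OF u, of "q - o'"] by (simp add: X_def Y_def algebra_simps)
  have XYeq: "q = q'" if "X q = X q'" "Y q = Y q'" for q q'
    using XY[of q] XY[of q'] that by simp
  have dist2: "(dist q q')\<^sup>2 = (X q - X q')\<^sup>2 + (Y q - Y q')\<^sup>2" for q q'
    using orthonormal_expansion(2)[OF u, of "q - q'"]
    by (simp add: X_def Y_def dist_norm inner_diff_left)
  have Rp: "reflection a u (?p 0) = ?p 0" "reflection a u (?p 1) = ?p 4" "reflection a u (?p 2) = ?p 3"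
    using R[of 0] R[of 1] R[of 2] by (simp_all add: mod_5 diff_conv_add_uminus del: add_uminus_conv_diff)
  define s where "s = (?p 2 - a) \<bullet> u"
  \<comment> \<open>The midpoint of two mirror images lies on the axis; hence the reflection only
    changes the sign of \<open>X\<close>.\<close>
  have o: "o' = a + s *\<^sub>R u"
  proof -
    have "?p 3 = a + (2 * s) *\<^sub>R u - (?p 2 - a)"
      using Rp(3) by (simp add: reflection_def s_def)
    then have "?p 2 + ?p 3 = 2 *\<^sub>R (a + s *\<^sub>R u)"
      by (simp add: scaleR_add_right scaleR_2)
    then show ?thesis by (simp add: o'_def)
  qed
  have XYR: "X (reflection a u q) = - X q" "Y (reflection a u q) = Y q" for q
  proof -
    have E: "reflection a u q - o' = (2 * ((q - o') \<bullet> u)) *\<^sub>R u - (q - o')"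
    proof -
      have ip: "(q - a) \<bullet> u = (q - o') \<bullet> u + s"
        using uu by (simp add: o inner_diff_left inner_add_left)
      have "(2 * (r + s)) *\<^sub>R u = (2 * r) *\<^sub>R u + s *\<^sub>R u + s *\<^sub>R u" for r
        by (simp only: scaleR_add_left[symmetric]) (simp add: algebra_simps)
      then show ?thesis
        unfolding reflection_def ip by (simp add: o)
    qed
    show "X (reflection a u q) = - X q" "Y (reflection a u q) = Y q"
      unfolding X_def Y_def E inner_diff_left[of _ "q - o'"]
      using uu by (simp_all add: inner_commute[of u "right_normal u"])
  qed
  have X: "X (?p 0) = 0" "X (?p 4) = - X (?p 1)" "X (?p 3) = - X (?p 2)"
    using XYR(1)[of "?p 0"] XYR(1)[of "?p 1"] XYR(1)[of "?p 2"] Rp by simp_all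
  have Y: "Y (?p 4) = Y (?p 1)" "Y (?p 3) = Y (?p 2)"
    using XYR(2)[of "?p 1"] XYR(2)[of "?p 2"] Rp by simp_all
  have Y2: "Y (?p 2) = 0"
  proof -
    have "Y (?p 2) + Y (?p 3) = 0"
      unfolding Y_def o'_def by (simp add: algebra_simps inner_diff_left)
    then show ?thesis using Y by simp
  qed
  define h where "h = X (?p 2)"
  define X1 where "X1 = X (?p 1)"
  define Y1 where "Y1 = Y (?p 1)"
  define Y0 where "Y0 = Y (p $ k)"
  have ne: "?p i \<noteq> ?p j" if "i \<noteq> j" for i j using that by (simp add: vertex_inj)
  have h: "h \<noteq> 0" using ne[of 2 3] XYeq[of "?p 2" "?p 3"] X Y by (auto simp: h_def)
  have X1: "X1 \<noteq> 0" using ne[of 1 4] XYeq[of "?p 1" "?p 4"] X Y by (auto simp: X1_def)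
  have "Y1 \<ge> 0" using up Y2 by (simp add: Y1_def Y_def inner_diff_left)
  moreover have "Y1 \<noteq> 0"
  proof
    assume "Y1 = 0"
    then have "\<forall>i\<in>{1, 2, 3}. \<exists>c. ?p i = o' + c *\<^sub>R right_normal u"
      using XY[of "?p 1"] XY[of "?p 2"] XY[of "?p 3"] Y Y2 by (auto simp: Y1_def)
    then have "collinear {?p 1, ?p 2, ?p 3}"
      unfolding collinear_alt by blast
    then show False using not_collinear[of "k + 1"] by (simp add: add.assoc)
  qed
  ultimately have Y1: "Y1 > 0" by simp
  have Y0: "Y0 \<noteq> Y1"
  proof
    assume "Y0 = Y1"
    have level: "\<exists>c. q = (o' + Y1 *\<^sub>R u) + c *\<^sub>R right_normal u" if "Y q = Y1" for q
      using XY[of q] that by (intro exI[of _ "X q"]) (simp add: add_ac)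
    have "Y (?p 4) = Y1" "Y (?p 0) = Y1" "Y (?p 1) = Y1"
      using Y \<open>Y0 = Y1\<close> by (simp_all add: Y1_def Y0_def)
    then have "\<forall>i\<in>{4, 0, 1}. \<exists>c. ?p i = (o' + Y1 *\<^sub>R u) + c *\<^sub>R right_normal u"
      using level by blast
    then have "collinear {?p 4, ?p 0, ?p 1}"
      unfolding collinear_alt by blast
    then show False using not_collinear[of "k + 4"] by (simp add: add.assoc mod_5)
  qed
  define l where "l = 2 * \<bar>h\<bar>"
  have l: "l > 0" using h by (simp add: l_def)
  have sides: "dist (?p i) (?p (i + 1)) = dist (?p 2) (?p 3)" for i
    using eq[of "k + i" "k + 2"] by (simp add: add.assoc)
  have d23: "(dist (?p 2) (?p 3))\<^sup>2 = l\<^sup>2"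
    unfolding dist2 using X Y by (simp add: h_def l_def power2_eq_square)
  have d12: "(X1 - h)\<^sup>2 + Y1\<^sup>2 = l\<^sup>2"
    using sides[of 1] d23 dist2[of "?p 1" "?p 2"] Y2 by (simp add: X1_def Y1_def h_def)
  have d01: "X1\<^sup>2 + (Y0 - Y1)\<^sup>2 = l\<^sup>2"
    using sides[of 0] d23 dist2[of "?p 0" "?p 1"] X by (simp add: X1_def Y1_def Y0_def)
  \<comment> \<open>With opposite signs, the side from \<open>?p 1\<close> to \<open>?p 2\<close>
    would meet its mirror image on the axis; \<open>t\<close> is the parameter of that
    crossing.\<close>
  have cross: "X1 * h > 0"
  proof (rule ccontr)
    assume "\<not> X1 * h > 0"
    then have neg: "X1 * h < 0" using h X1 by (simp add: not_less order_le_less)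
    define t where "t = X1 / (X1 - h)"
    have t: "0 \<le> t" "t \<le> 1" "(1 - t) * X1 + t * h = 0"
      using neg by (auto simp: t_def field_simps mult_less_0_iff)
    define q where "q = (1 - t) *\<^sub>R ?p 1 + t *\<^sub>R ?p 2"
    define q' where "q' = (1 - t) *\<^sub>R ?p 4 + t *\<^sub>R ?p 3"
    have lin: "X ((1 - t) *\<^sub>R v + t *\<^sub>R w) = (1 - t) * X v + t * X w"
      "Y ((1 - t) *\<^sub>R v + t *\<^sub>R w) = (1 - t) * Y v + t * Y w" for v w
      unfolding X_def Y_def by (simp_all add: algebra_simps inner_diff_left)
    have "X q = 0" "X q' = 0" "Y q = Y q'"
      unfolding q_def q'_def lin using t(3) X Y by (simp_all add: X1_def h_def algebra_simps)
    then have "q = q'" using XYeq by simp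
    have "q \<in> side p (k + 1)"
      unfolding side_def in_segment q_def using t by (auto simp: add.assoc)
    moreover have "q \<in> side p (k + 3)"
      unfolding side_def in_segment \<open>q = q'\<close> q'_def using t
      by (auto simp: add.assoc add.commute intro!: exI[of _ "1 - t"])
    ultimately have "q = ?p 1 \<or> q = ?p 2"
      using side_inter[of "k + 1" "k + 3" q] by (auto simp: add.assoc)
    then show False using \<open>X q = 0\<close> X1 h by (auto simp: X1_def h_def)
  qed
  define x where "x = X1 / (2 * h)"
  define y where "y = Y1 / l"
  define z where "z = Y0 / l"
  have x0: "x > 0" using cross by (auto simp: x_def zero_less_divide_iff zero_less_mult_iff)
  have y0: "y > 0" using Y1 l by (simp add: y_def)
  have l2: "l\<^sup>2 = 4 * h\<^sup>2" by (simp add: l_def power_mult_distrib)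
  have "x\<^sup>2 + (z - y)\<^sup>2 = 1"
  proof -
    have "x\<^sup>2 + (z - y)\<^sup>2 = X1\<^sup>2 / l\<^sup>2 + (Y0 - Y1)\<^sup>2 / l\<^sup>2"
      by (simp add: x_def y_def z_def power_divide power_mult_distrib l2 flip: diff_divide_distrib)
    then show ?thesis using d01 l by (simp flip: add_divide_distrib)
  qed
  moreover have "(x - 1/2)\<^sup>2 + y\<^sup>2 = 1"
  proof -
    have "x - 1/2 = (X1 - h) / (2 * h)" using h by (simp add: x_def field_simps)
    then have "(x - 1/2)\<^sup>2 + y\<^sup>2 = (X1 - h)\<^sup>2 / l\<^sup>2 + Y1\<^sup>2 / l\<^sup>2"
      by (simp add: y_def power_divide power_mult_distrib l2)
    then show ?thesis using d12 l by (simp flip: add_divide_distrib)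
  qed
  moreover have "z \<noteq> y" using Y0 l by (simp add: y_def z_def)
  ultimately have rel: "side_relations x y \<bar>z - y\<bar>"
    using x0 y0 by (simp add: side_relations_def)
  define A :: "real^2^2" where "A = vector [right_normal u, u]"
  \<comment> \<open>If \<open>?p 2\<close> lies to the left of the axis, the vertices are read in
    the opposite order, since \<open>same_class\<close> offers no reflection.\<close>
  define \<rho> where "\<rho> i = (if h > 0 then k + 1 + i else k - 1 - i)" for i
  have "bij \<rho>"
  proof (rule bijI)
    show "inj \<rho>" by (auto simp: inj_def \<rho>_def)
    then show "surj \<rho>" by (simp add: finite_UNIV_inj_surj)
  qed
  moreover have "rotation_matrix A"
    unfolding A_def using rotation_to_axis(1)[OF u] .
  moreover have "house x y z $ i = (1 / l) *\<^sub>R (A *v (p $ \<rho> i)) + (- (1 / l) *\<^sub>R (A *v o'))" for i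
  proof -
    have "(1 / l) *\<^sub>R (A *v q) + (- (1 / l) *\<^sub>R (A *v o')) = vector [X q / l, Y q / l]" for q
    proof -
      have "(1 / l) *\<^sub>R (A *v q) + (- (1 / l) *\<^sub>R (A *v o')) = (1 / l) *\<^sub>R (A *v (q - o'))"
        by (simp add: matrix_vector_mult_diff_distrib scaleR_diff_right)
      then show ?thesis
        by (simp add: A_def rotation_to_axis(2)[OF u] vec_eq_iff forall_2 X_def Y_def)
    qed
    moreover have "\<forall>i. house x y z $ i = vector [X (p $ \<rho> i) / l, Y (p $ \<rho> i) / l]"
    proof (cases "h > 0")
      case True
      then have l': "l = 2 * h" by (simp add: l_def)
      show ?thesis
        using True X Y Y2 h l' unfolding forall_5 vec_eq_iff[where 'b=2] forall_2
        by (simp add: \<rho>_def house_nth x_def y_def z_def add.assoc mod_5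
            X1_def[symmetric] Y1_def[symmetric] Y0_def[symmetric] h_def[symmetric])
    next
      case False
      then have l': "l = - 2 * h" "h < 0" using h by (auto simp: l_def)
      have \<rho>: "\<rho> 0 = k + 4" "\<rho> 1 = k + 3" "\<rho> 2 = k + 2" "\<rho> 3 = k + 1" "\<rho> 4 = k"
        using False by (simp_all add: \<rho>_def mod_5 diff_conv_add_uminus add.assoc del: add_uminus_conv_diff)
      show ?thesis
        using X Y Y2 h l' unfolding forall_5 vec_eq_iff[where 'b=2] forall_2
        by (simp add: \<rho> house_nth x_def y_def z_def
            X1_def[symmetric] Y1_def[symmetric] Y0_def[symmetric] h_def[symmetric])
    qed
    ultimately show ?thesis by simp
  qed
  moreover have "1 / l > 0" using l by simp
  moreover have "z = y + \<bar>z - y\<bar> \<or> z = y - \<bar>z - y\<bar>" by auto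
  ultimately show ?thesis using rel by blast
qed

end

lemma normal_form:
  assumes "equilateral_pentagon p" "has_symmetry_axis p"
  obtains x y z w \<rho> c t and A :: "real^2^2" where "bij \<rho>" "rotation_matrix A" "0 < c"
    "\<And>i. house x y z $ i = c *\<^sub>R (A *v (p $ \<rho> i)) + t" "side_relations x y w" "z = y + w \<or> z = y - w"
proof -
  interpret pentagonal_curve p
    using assms(1) by unfold_locales (simp add: equilateral_pentagon_def)
  have eq: "dist (p $ i) (p $ (i + 1)) = dist (p $ j) (p $ (j + 1))" for i j
    using assms(1) unfolding equilateral_pentagon_def by blast
  obtain a u where u: "norm u = 1" "reflection a u ` curve = curve"
    using assms(2) unfolding has_symmetry_axis_def by blast
  obtain k where k: "\<And>i. reflection a u (p $ (k + i)) = p $ (k - i)"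
    using reflection_vertices[OF eq u] by blast
  \<comment> \<open>\<open>u\<close> and \<open>- u\<close> give the same reflection; the choice of
    sign turns the base downwards.\<close>
  have "\<exists>u. norm u = 1 \<and> (\<forall>i. reflection a u (p $ (k + i)) = p $ (k - i)) \<and> (p $ (k + 1) - p $ (k + 2)) \<bullet> u \<ge> 0"
  proof (cases "(p $ (k + 1) - p $ (k + 2)) \<bullet> u \<ge> 0")
    case False
    moreover have "reflection a (- u) = reflection a u"
      by (simp add: reflection_def fun_eq_iff)
    ultimately show ?thesis using u k by (intro exI[of _ "- u"]) auto
  qed (use u k in blast)
  then show ?thesis using normal_form_aux[OF eq] that by metis
qed

section \<open>Central configurations in normal form\<close>

lemma norm_rotation:
  assumes "rotation_matrix (A :: real^2^2)"
  shows "norm (A *v v) = norm v"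
proof -
  have "orthogonal_transformation ((*v) A)"
    using assms by (simp add: orthogonal_transformation_matrix rotation_matrix_def)
  then show ?thesis by (rule orthogonal_transformation_norm)
qed

text \<open>Forces scale like \<open>1 / c\<^sup>2\<close> and displacements like \<open>c\<close>,
  so the multiplier \<open>l\<close> becomes \<open>l / c ^ 3\<close>.\<close>

lemma central_configuration_same_class:
  assumes rel: "((q, m), (q', m')) \<in> same_class" and m: "(\<Sum>i\<in>UNIV. m $ i) = 1"
    and cc: "central_configuration q m"
  shows "central_configuration q' m'"
proof -
  obtain \<sigma> c t and A :: "real^2^2" where \<sigma>: "bij \<sigma>" and A: "rotation_matrix A" and c: "0 < c"
    and q': "\<And>i. q' $ \<sigma> i = c *\<^sub>R (A *v (q $ i)) + t" and m': "\<And>i. m' $ \<sigma> i = m $ i"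
    using rel unfolding same_class_def by blast
  obtain l where ne: "\<And>i j. i \<noteq> j \<Longrightarrow> q $ i \<noteq> q $ j" and l: "\<And>i.
        (\<Sum>j\<in>UNIV - {i}. (m $ j / dist (q $ i) (q $ j) ^ 3) *\<^sub>R (q $ i - q $ j))
          = l *\<^sub>R (q $ i - center_of_mass q m)"
    using cc unfolding central_configuration_def by blast
  have diff: "q' $ \<sigma> i - q' $ \<sigma> j = c *\<^sub>R (A *v (q $ i - q $ j))" for i j
    by (simp add: q' matrix_vector_mult_diff_distrib scaleR_diff_right)
  have d: "dist (q' $ \<sigma> i) (q' $ \<sigma> j) = c * dist (q $ i) (q $ j)" for i j
    using c by (simp only: dist_norm diff) (simp add: norm_rotation[OF A])
  have reidx: "(\<Sum>j\<in>UNIV. f j) = (\<Sum>j\<in>UNIV. f (\<sigma> j))" for f :: "5 \<Rightarrow> 'b::comm_monoid_add"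
    using sum.reindex_bij_betw[OF \<sigma>, of f] by simp
  have "center_of_mass q' m' = (\<Sum>i\<in>UNIV. m $ i *\<^sub>R (c *\<^sub>R (A *v (q $ i)) + t))"
    by (simp add: center_of_mass_def reidx[of "\<lambda>i. m' $ i"] reidx[of "\<lambda>i. m' $ i *\<^sub>R q' $ i"] m' q' m)
  also have "\<dots> = c *\<^sub>R (A *v (\<Sum>i\<in>UNIV. m $ i *\<^sub>R q $ i)) + (\<Sum>i\<in>UNIV. m $ i) *\<^sub>R t"
    by (simp add: sum_5 algebra_simps matrix_vector_right_distrib matrix_vector_mult_scaleR)
  finally have com: "center_of_mass q' m' = c *\<^sub>R (A *v center_of_mass q m) + t"
    by (simp add: center_of_mass_def m)
  have "(\<Sum>j\<in>UNIV - {i}. (m' $ j / dist (q' $ i) (q' $ j) ^ 3) *\<^sub>R (q' $ i - q' $ j))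
          = (l / c ^ 3) *\<^sub>R (q' $ i - center_of_mass q' m')" for i
  proof -
    obtain k where k: "i = \<sigma> k" using \<sigma> by (metis bij_pointE)
    have "bij_betw \<sigma> (UNIV - {k}) (UNIV - {\<sigma> k})"
      using \<sigma> by (auto simp: bij_def bij_betw_def inj_on_def inj_def image_set_diff)
    from sum.reindex_bij_betw[OF this, of "\<lambda>j. (m' $ j / dist (q' $ i) (q' $ j) ^ 3) *\<^sub>R (q' $ i - q' $ j)"]
    have "(\<Sum>j\<in>UNIV - {i}. (m' $ j / dist (q' $ i) (q' $ j) ^ 3) *\<^sub>R (q' $ i - q' $ j))
        = (\<Sum>j\<in>UNIV - {k}. (m $ j / (c * dist (q $ k) (q $ j)) ^ 3) *\<^sub>R (c *\<^sub>R (A *v (q $ k - q $ j))))"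
      unfolding k m' d diff by simp
    also have "\<dots> = (c / c ^ 3) *\<^sub>R (A *v (\<Sum>j\<in>UNIV - {k}. (m $ j / dist (q $ k) (q $ j) ^ 3) *\<^sub>R (q $ k - q $ j)))"
      by (simp add: linear_sum[OF matrix_vector_mul_linear] scaleR_sum_right matrix_vector_mult_scaleR power_mult_distrib
          mult.commute)
    also have "\<dots> = (l / c ^ 3) *\<^sub>R (c *\<^sub>R (A *v (q $ k - center_of_mass q m)))"
      by (simp add: l matrix_vector_mult_scaleR mult.commute)
    also have "c *\<^sub>R (A *v (q $ k - center_of_mass q m)) = q' $ i - center_of_mass q' m'"
      by (simp add: k com q' matrix_vector_mult_diff_distrib scaleR_diff_right)
    finally show ?thesis .
  qed
  moreover have "q' $ i \<noteq> q' $ j" if "i \<noteq> j" for i j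
  proof -
    obtain k k' where k: "i = \<sigma> k" "j = \<sigma> k'" using \<sigma> by (metis bij_pointE)
    then have "dist (q' $ i) (q' $ j) \<noteq> 0" using d ne[of k k'] c that by auto
    then show ?thesis by auto
  qed
  ultimately show ?thesis unfolding central_configuration_def by blast
qed

text \<open>Inverse cubes of the distances other than 1 in \<open>house x y z\<close>:
  \<open>A_cube\<close> for components 0 and 3, \<open>B_cube\<close> for the diagonals 1-3 and 2-0,
  \<open>C_cube\<close> for the apex 4 and either end of the base.\<close>

definition A_cube :: "real \<Rightarrow> real" where "A_cube x = 1 / (2 * x) ^ 3"
definition B_cube :: "real \<Rightarrow> real" where "B_cube x = 1 / sqrt (1 + 2 * x) ^ 3"
definition C_cube :: "real \<Rightarrow> real" where "C_cube z = 1 / sqrt (1 / 4 + z\<^sup>2) ^ 3"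

lemma dist_2: "dist (a :: real^2) b = sqrt ((a $ 1 - b $ 1)\<^sup>2 + (a $ 2 - b $ 2)\<^sup>2)"
  by (simp add: dist_vec_def L2_set_def sum_2 dist_real_def)

lemma dist_house:
  assumes rel: "side_relations x y w" and z: "z = y + w \<or> z = y - w"
  defines "q \<equiv> house x y z"
  shows "dist (q $ 1) (q $ 2) = 1" "dist (q $ 2) (q $ 3) = 1" "dist (q $ 3) (q $ 4) = 1"
    "dist (q $ 4) (q $ 0) = 1" "dist (q $ 0) (q $ 1) = 1" "dist (q $ 3) (q $ 0) = 2 * x"
    "dist (q $ 1) (q $ 3) = sqrt (1 + 2 * x)" "dist (q $ 2) (q $ 0) = sqrt (1 + 2 * x)"
    "dist (q $ 1) (q $ 4) = sqrt (1 / 4 + z\<^sup>2)" "dist (q $ 2) (q $ 4) = sqrt (1 / 4 + z\<^sup>2)"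
proof -
  have x: "x > 0" and y2: "y\<^sup>2 = 1 - (x - 1/2)\<^sup>2" and w2: "w\<^sup>2 = 1 - x\<^sup>2"
    using rel by (auto simp: side_relations_def)
  have zy: "(y - z)\<^sup>2 = 1 - x\<^sup>2" "(z - y)\<^sup>2 = 1 - x\<^sup>2" using z w2 by auto
  have "(1/2 - x)\<^sup>2 + y\<^sup>2 = 1" "(x - 1/2)\<^sup>2 + y\<^sup>2 = 1" "(1/2 + x)\<^sup>2 + y\<^sup>2 = 1 + 2 * x" "(-1/2 - x)\<^sup>2 + y\<^sup>2 = 1 + 2 * x"
    "(- 1 / 2 + x)\<^sup>2 + y\<^sup>2 = 1" "(x + 1/2)\<^sup>2 + y\<^sup>2 = 1 + 2 * x"
    unfolding y2 by (simp_all add: power2_eq_square algebra_simps)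
  moreover have "sqrt ((x + x)\<^sup>2) = 2 * x" "sqrt ((- x - x)\<^sup>2) = 2 * x" using x by (simp_all only: real_sqrt_abs)
  ultimately show "dist (q $ 1) (q $ 2) = 1" "dist (q $ 2) (q $ 3) = 1" "dist (q $ 3) (q $ 4) = 1"
    "dist (q $ 4) (q $ 0) = 1" "dist (q $ 0) (q $ 1) = 1" "dist (q $ 3) (q $ 0) = 2 * x"
    "dist (q $ 1) (q $ 3) = sqrt (1 + 2 * x)" "dist (q $ 2) (q $ 0) = sqrt (1 + 2 * x)"
    "dist (q $ 1) (q $ 4) = sqrt (1 / 4 + z\<^sup>2)" "dist (q $ 2) (q $ 4) = sqrt (1 / 4 + z\<^sup>2)"
    unfolding q_def dist_2 house_nth using zy by (simp_all add: power_divide)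
qed

lemma sum_Diff_5:
  "sum f ((UNIV::5 set) - {0}) = f 1 + f 2 + f 3 + f 4"
  "sum f ((UNIV::5 set) - {1}) = f 2 + f 3 + f 4 + f 0"
  "sum f ((UNIV::5 set) - {2}) = f 1 + f 3 + f 4 + f 0"
  "sum f ((UNIV::5 set) - {3}) = f 1 + f 2 + f 4 + f 0"
  "sum f ((UNIV::5 set) - {4}) = f 1 + f 2 + f 3 + f 0"
  unfolding UNIV_5 by (simp_all add: insert_Diff_if ac_simps)

text \<open>Horizontal and vertical coordinates of the vector equations of components 0, 1, 2, 3, 4
  in turn. The centre of mass stays abstract, so that it can be eliminated together with
  \<open>l\<close>.\<close>

lemma central_configuration_house:
  fixes m :: masses
  assumes rel: "side_relations x y w" and z: "z = y + w \<or> z = y - w"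
  defines "A \<equiv> A_cube x" and "B \<equiv> B_cube x" and "C \<equiv> C_cube z"
  defines "cx \<equiv> center_of_mass (house x y z) m $ 1" and "cy \<equiv> center_of_mass (house x y z) m $ 2"
  shows "central_configuration (house x y z) m \<longleftrightarrow> (\<exists>l.
    m$1 * (x - 1/2) + m$2 * B * (x + 1/2) + m$3 * A * (2 * x) + m$4 * x = l * (x - cx) \<and>
    m$1 * y + m$2 * B * y + m$4 * (y - z) = l * (y - cy) \<and>
    m$2 + m$3 * B * (1/2 + x) + m$4 * C / 2 + m$0 * (1/2 - x) = l * (1/2 - cx) \<and>
    m$3 * B * (- y) + m$4 * C * (- z) + m$0 * (- y) = l * (- cy) \<and>
    - m$1 + m$3 * (x - 1/2) + m$4 * C * (-1/2) + m$0 * B * (- 1/2 - x) = l * (- 1/2 - cx) \<and>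
    m$3 * (- y) + m$4 * C * (- z) + m$0 * B * (- y) = l * (- cy) \<and>
    m$1 * B * (- x - 1/2) + m$2 * (1/2 - x) + m$4 * (- x) + m$0 * A * (- 2 * x) = l * (- x - cx) \<and>
    m$1 * B * y + m$2 * y + m$4 * (y - z) = l * (y - cy) \<and>
    m$1 * C * (- 1/2) + m$2 * C / 2 + m$3 * x + m$0 * (- x) = l * (- cx) \<and>
    m$1 * C * z + m$2 * C * z + m$3 * (z - y) + m$0 * (z - y) = l * (z - cy))"
    (is "_ \<longleftrightarrow> ?thesis_rhs")
proof -
  have x: "x > 0" using rel by (simp add: side_relations_def)
  note d = dist_house[OF rel z]
  note d' = d d[THEN trans[OF dist_commute]]
  have pos: "sqrt (1 + 2 * x) > 0" "sqrt (1 / 4 + z\<^sup>2) > 0"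
    using x by (auto simp: add_pos_nonneg)
  have "\<forall>i j. i \<noteq> j \<longrightarrow> dist (house x y z $ i) (house x y z $ j) \<noteq> 0"
    unfolding forall_5 using pos x by (simp add: d')
  then have ne: "\<forall>i j. i \<noteq> j \<longrightarrow> house x y z $ i \<noteq> house x y z $ j" by auto
  have c: "v / 1 ^ 3 = v" "v / (2 * x) ^ 3 = v * A" "v / sqrt (1 + 2 * x) ^ 3 = v * B"
    "v / sqrt (1 / 4 + z\<^sup>2) ^ 3 = v * C" for v
    by (simp_all add: A_def B_def C_def A_cube_def B_cube_def C_cube_def)
  have "central_configuration (house x y z) m \<longleftrightarrow> (\<exists>l. \<forall>i.
        (\<Sum>j\<in>UNIV - {i}. (m $ j / dist (house x y z $ i) (house x y z $ j) ^ 3) *\<^sub>R (house x y z $ i - house x y z $ j))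
          = l *\<^sub>R (house x y z $ i - center_of_mass (house x y z) m))"
    unfolding central_configuration_def using ne by blast
  also have "\<dots> \<longleftrightarrow> ?thesis_rhs"
    unfolding forall_5 sum_Diff_5 d' c
    by (simp add: vec_eq_iff[where 'b=2] forall_2 house_nth cx_def[symmetric] cy_def[symmetric])
  finally show ?thesis .
qed

text \<open>The equations of Laura and Andoyer \<open>\<Sum>k. m\<^sub>k (r\<^sub>i\<^sub>k\<^sup>-\<^sup>3 - r\<^sub>j\<^sub>k\<^sup>-\<^sup>3) \<Delta>\<^sub>i\<^sub>j\<^sub>k = 0\<close>
  for the paper's pairs 15, 14, 35 and masses \<open>a = m\<^sub>1 = m\<^sub>2\<close>, \<open>b = m\<^sub>3 = m\<^sub>4\<close>, \<open>c = m\<^sub>5\<close>.\<close>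

definition balanced :: "real \<Rightarrow> real \<Rightarrow> real \<Rightarrow> real \<Rightarrow> real \<Rightarrow> real \<Rightarrow> bool" where
  "balanced x y z a b c \<longleftrightarrow>
    a * (1 - C_cube z) * z = b * (1 - B_cube x) * (z * (x + 1/2) - y / 2) \<and>
    b * (1 - A_cube x) * (2 * x * y) = c * (1 - C_cube z) * (z * (x + 1/2) - y / 2) \<and>
    a * (1 - C_cube z) * (z * (x - 1/2) + y / 2) + a * (B_cube x - C_cube z) * (z * (x + 1/2) - y / 2)
      = b * (1 - A_cube x) * (2 * x * (z - y))"

lemma B_cube_less_1: "x > 0 \<Longrightarrow> B_cube x < 1"
  by (simp add: B_cube_def)

lemma central_configuration_imp_balanced:
  fixes m :: masses
  assumes rel: "side_relations x y w" and z: "z = y + w \<or> z = y - w"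
    and cc: "central_configuration (house x y z) m"
  shows "m $ 1 = m $ 2" "m $ 0 = m $ 3" "balanced x y z (m $ 1) (m $ 3) (m $ 4)"
proof -
  have x: "x > 0" and y: "y > 0" using rel by (auto simp: side_relations_def)
  define A B C where "A = A_cube x" and "B = B_cube x" and "C = C_cube z"
  obtain l cx cy where F:
    "m$1 * (x - 1/2) + m$2 * B * (x + 1/2) + m$3 * A * (2 * x) + m$4 * x = l * (x - cx)"
    "m$1 * y + m$2 * B * y + m$4 * (y - z) = l * (y - cy)"
    "m$2 + m$3 * B * (1/2 + x) + m$4 * C / 2 + m$0 * (1/2 - x) = l * (1/2 - cx)"
    "m$3 * B * (- y) + m$4 * C * (- z) + m$0 * (- y) = l * (- cy)"
    "m$3 * (- y) + m$4 * C * (- z) + m$0 * B * (- y) = l * (- cy)"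
    "m$1 * B * (- x - 1/2) + m$2 * (1/2 - x) + m$4 * (- x) + m$0 * A * (- 2 * x) = l * (- x - cx)"
    "m$1 * B * y + m$2 * y + m$4 * (y - z) = l * (y - cy)"
    "m$1 * C * (- 1/2) + m$2 * C / 2 + m$3 * x + m$0 * (- x) = l * (- cx)"
    "m$1 * C * z + m$2 * C * z + m$3 * (z - y) + m$0 * (z - y) = l * (z - cy)"
    using cc unfolding central_configuration_house[OF rel z] A_def B_def C_def by blast
  have B: "B < 1" using B_cube_less_1[OF x] by (simp add: B_def)
  \<comment> \<open>Subtracting the vertical equations of the mirror bodies 1 and 2 isolates
    \<open>1 - B\<close>, which is nonzero because the diagonal is longer than a side. Bodies 0 and
    3 then do the same for \<open>m $ 1\<close> and \<open>m $ 2\<close>.\<close>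
  have "(m$0 - m$3) * ((1 - B) * y) = 0" using F(4,5) by algebra
  then show m03: "m $ 0 = m $ 3" using B y by simp
  have "(m$1 - m$2) * ((1 - B) * y) = 0" using F(2,7) by algebra
  then show m12: "m $ 1 = m $ 2" using B y by simp
  note G = F[unfolded m03 m12[symmetric]]
  \<comment> \<open>The horizontal equation of the apex, where symmetric masses cancel.\<close>
  have cx: "l * cx = 0" using G(8) by simp
  have "m$1 * (1 - C) * z = m$3 * (1 - B) * (z * (x + 1/2) - y / 2)"
    using G(3,4,9) cx by algebra
  moreover have "m$3 * (1 - A) * (2 * x * y) = m$4 * (1 - C) * (z * (x + 1/2) - y / 2)"
    using G(3,4,6,7) cx by algebra
  moreover have "m$1 * (1 - C) * (z * (x - 1/2) + y / 2) + m$1 * (B - C) * (z * (x + 1/2) - y / 2)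
      = m$3 * (1 - A) * (2 * x * (z - y))"
  proof -
    \<comment> \<open>Bodies 0 and 4 differ by the vector \<open>(x, y - z)\<close>. The cross
      product of their subtracted equations with this vector removes \<open>l\<close>.\<close>
    have "(m$1 * (x - 1/2) + m$1 * B * (x + 1/2) + m$3 * A * (2 * x) + m$4 * x) * (y - z) = l * x * (y - z)"
      using G(1) cx by algebra
    moreover have "(m$1 * y + m$1 * B * y + m$4 * (y - z) - (m$1 * C * z + m$1 * C * z + m$3 * (z - y) + m$3 * (z - y))) * x
        = l * x * (y - z)"
      using G(2,9) by algebra
    moreover have "m$1 * (1 - C) * (z * (x - 1/2) + y / 2) + m$1 * (B - C) * (z * (x + 1/2) - y / 2)
          - m$3 * (1 - A) * (2 * x * (z - y))
        = (m$1 * y + m$1 * B * y + m$4 * (y - z) - (m$1 * C * z + m$1 * C * z + m$3 * (z - y) + m$3 * (z - y))) * x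
          - (m$1 * (x - 1/2) + m$1 * B * (x + 1/2) + m$3 * A * (2 * x) + m$4 * x) * (y - z)"
      by (simp add: field_simps)
    ultimately show ?thesis by linarith
  qed
  ultimately show "balanced x y z (m $ 1) (m $ 3) (m $ 4)"
    by (simp add: balanced_def A_def B_def C_def)
qed

lemma balanced_imp_central_configuration:
  assumes rel: "side_relations x y w" and z: "z = y + w \<or> z = y - w"
    and E: "z * (x + 1/2) - y / 2 \<noteq> 0" and m: "2 * a + 2 * b + c = 1" and bal: "balanced x y z a b c"
  shows "central_configuration (house x y z) (vector [a, a, b, c, b])"
proof -
  define A B C where "A = A_cube x" and "B = B_cube x" and "C = C_cube z"
  note f = bal[unfolded balanced_def, folded A_def B_def C_def]
  have cx: "center_of_mass (house x y z) (vector [a, a, b, c, b]) $ 1 = 0"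
    by (simp add: center_of_mass_def sum_5 house_nth)
  have cy: "center_of_mass (house x y z) (vector [a, a, b, c, b]) $ 2 = 2 * b * y + c * z"
    using m by (simp add: center_of_mass_def sum_5 house_nth add_ac)
  define cy where "cy = 2 * b * y + c * z"
  define l where "l = 2 * (a + b * B * (1/2 + x) + c * C / 2 + b * (1/2 - x))"
  text \<open>With \<open>l\<close> read off the first body, the remaining residuals satisfy a linear system
    with determinant \<open>z * (x + 1/2) - y / 2\<close>, closed up by conservation of momentum.\<close>
  define p2 where "p2 = - b * B * y - c * C * z - b * y + l * cy"
  define s1 where "s1 = a * (x - 1/2) + a * B * (x + 1/2) + b * A * (2 * x) + c * x - l * x"
  define s2 where "s2 = a * y + a * B * y + c * (y - z) - l * (y - cy)"
  define t2 where "t2 = 2 * a * C * z + 2 * b * (z - y) - l * (z - cy)"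
  have 1: "t2 = p2"
    using f unfolding t2_def p2_def l_def by algebra
  have 2: "(s2 - p2) * (1/2 + x) = s1 * y"
    using f unfolding s1_def s2_def p2_def l_def by algebra
  have 3: "s1 * (y - z) = (s2 - t2) * x"
  proof -
    have "s1 * (y - z) - (s2 - t2) * x = b * (1 - A) * (2 * x * (z - y))
        - (a * (1 - C) * (z * (x - 1/2) + y / 2) + a * (B - C) * (z * (x + 1/2) - y / 2))"
      unfolding s1_def s2_def t2_def by (simp add: field_simps)
    then show ?thesis using f by simp
  qed
  have "s1 * (z * (x + 1/2) - y / 2) = x * (s1 * y) - (x + 1/2) * (s1 * (y - z))"
    by (simp add: field_simps)
  also have "\<dots> = 0"
    unfolding 2[symmetric] 3 1 by (simp add: field_simps)
  finally have "s1 * (z * (x + 1/2) - y / 2) = 0" .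
  moreover have "(s2 - p2) * (z * (x + 1/2) - y / 2) = z * ((s2 - p2) * (1/2 + x)) - y * ((s2 - p2) * (1/2 + x) - (s2 - p2) * x)"
    by (simp add: field_simps)
  then have "(s2 - p2) * (z * (x + 1/2) - y / 2) = 0"
    unfolding 2 3[symmetric, unfolded 1] by (simp add: field_simps)
  ultimately have "s1 = 0" "s2 = p2" using E by auto
  moreover have "2 * a * p2 + 2 * b * s2 + c * t2 = 0"
    using m unfolding p2_def s2_def t2_def cy_def by algebra
  then have "p2 = 0" using \<open>s2 = p2\<close> 1 m by algebra
  ultimately have "s1 = 0" "s2 = 0" "p2 = 0" "t2 = 0" using 1 by simp_all
  then show ?thesis
    unfolding central_configuration_house[OF rel z] cx cy
    by (intro exI[of _ l]) (simp add: A_def[symmetric] B_def[symmetric] C_def[symmetric]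
        s1_def s2_def p2_def t2_def cy_def[symmetric], simp add: l_def field_simps)
qed

section \<open>Signs, and elimination of the masses\<close>

lemma side_relations_bounds:
  assumes "side_relations x y w"
  shows "0 < x" "x < 1" "0 < y" "0 < w" "w < 1" "w\<^sup>2 = 1 - x\<^sup>2" "y\<^sup>2 = 3/4 + x - x\<^sup>2" "3/4 < y\<^sup>2"
proof -
  show x: "0 < x" and y: "0 < y" and w: "0 < w" and w2: "w\<^sup>2 = 1 - x\<^sup>2"
    using assms by (auto simp: side_relations_def)
  show y2: "y\<^sup>2 = 3/4 + x - x\<^sup>2"
    using assms by (auto simp: side_relations_def power2_eq_square field_simps)
  show x1: "x < 1" using x w w2 by (smt (verit) one_less_power pos2 zero_less_power power_one one_power2 power2_less_imp_less power_mono)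
  show "w < 1" using x w w2 by (smt (verit) zero_less_power power_mono one_power2)
  have "x\<^sup>2 < x" using x x1 by (simp add: power2_eq_square)
  then show "3/4 < y\<^sup>2" using y2 by simp
qed

text \<open>The first relation expresses \<open>a\<close> through \<open>b\<close>; inserted into
  the third, multiplied by \<open>(1 - C) * z\<close>, it leaves an equation between positions in
  which \<open>b\<close> cancels.\<close>

lemma balanced_equation:
  assumes "balanced x y z a b c" "b > 0"
  defines "E \<equiv> z * (x + 1/2) - y / 2"
  shows "(1 - B_cube x) * E * (2 * x * z * (1 - C_cube z) - (1 - B_cube x) * E)
    = (1 - C_cube z) * (1 - A_cube x) * (2 * x * z) * (z - y)"
proof -
  define A B C where "A = A_cube x" and "B = B_cube x" and "C = C_cube z"
  note f = assms(1)[unfolded balanced_def, folded A_def B_def C_def E_def]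
  have D: "z * (x - 1/2) + y / 2 = 2 * x * z - E" by (simp add: E_def field_simps)
  have "b * ((1 - B) * E * (2 * x * z * (1 - C) - (1 - B) * E))
      = (a * (1 - C) * z) * (2 * x * z * (1 - C) - (1 - B) * E)" using f by simp
  also have "\<dots> = (1 - C) * z * (a * (1 - C) * (2 * x * z - E) + a * (B - C) * E)"
    by (simp add: field_simps)
  also have "\<dots> = (1 - C) * z * (b * (1 - A) * (2 * x * (z - y)))"
    using f unfolding D by simp
  also have "\<dots> = b * ((1 - C) * (1 - A) * (2 * x * z) * (z - y))" by simp
  finally show ?thesis using \<open>b > 0\<close> by (simp add: A_def B_def C_def)
qed

lemma cube_less_1_iff: "0 < r \<Longrightarrow> 1 / r ^ 3 < (1::real) \<longleftrightarrow> 1 < r"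
  by (metis less_divide_eq_1_pos one_less_power one_power2 power_less_imp_less_base power_one zero_less_numeral zero_less_power less_imp_le divide_less_eq_1_pos)

lemma C_cube_less_1_iff: "C_cube z < 1 \<longleftrightarrow> 3/4 < z\<^sup>2"
proof -
  have "0 < sqrt (1 / 4 + z\<^sup>2)" by (simp add: add_pos_nonneg)
  then show ?thesis unfolding C_cube_def by (subst cube_less_1_iff) auto
qed

lemma C_cube_greater_1_iff: "1 < C_cube z \<longleftrightarrow> z\<^sup>2 < 3/4"
proof -
  have r: "0 < sqrt (1 / 4 + z\<^sup>2)" by (simp add: add_pos_nonneg)
  then have "1 < C_cube z \<longleftrightarrow> sqrt (1 / 4 + z\<^sup>2) ^ 3 < 1 ^ 3"
    unfolding C_cube_def by (simp add: field_simps)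
  also have "\<dots> \<longleftrightarrow> sqrt (1 / 4 + z\<^sup>2) < 1"
    using r by (metis power_less_imp_less_base power_strict_mono less_imp_le zero_le_one zero_less_numeral)
  also have "\<dots> \<longleftrightarrow> z\<^sup>2 < 3/4" by auto
  finally show ?thesis .
qed

lemma A_cube_less_1_iff: "0 < x \<Longrightarrow> A_cube x < 1 \<longleftrightarrow> 1/2 < x"
  unfolding A_cube_def by (subst cube_less_1_iff) auto

text \<open>The apex is farther than 1 from the base vertices and
  \<open>z * (x + 1/2) - y / 2\<close> is positive, so the second relation forces
  \<open>A_cube x < 1\<close>.\<close>

lemma convex_branch_signs:
  assumes rel: "side_relations x y w" and bal: "balanced x y (y + w) a b c"
    and pos: "b > 0" "c > 0"
  shows "1/2 < x" "C_cube (y + w) < 1"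
proof -
  note b = side_relations_bounds[OF rel]
  have "y\<^sup>2 < (y + w)\<^sup>2" using b(3,4) by (simp add: power_strict_mono)
  then show C: "C_cube (y + w) < 1" using b(8) by (simp add: C_cube_less_1_iff)
  have "(y + w) * (x + 1/2) - y / 2 = (y + w) * x + w / 2" by (simp add: field_simps)
  also have "\<dots> > 0" using b by (intro add_pos_pos mult_pos_pos) auto
  finally have "0 < c * (1 - C_cube (y + w)) * ((y + w) * (x + 1/2) - y / 2)"
    using pos C by (intro mult_pos_pos) auto
  then have "0 < b * (1 - A_cube x) * (2 * x * y)"
    using bal by (simp add: balanced_def)
  then have "A_cube x < 1" using pos mult_pos_pos[OF b(1,3)] by (simp add: zero_less_mult_iff)
  then show "1/2 < x" using b(1) by (simp add: A_cube_less_1_iff)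
qed

text \<open>Opposite to the convex branch, the apex is closer than 1 to the base vertices. The claim
  \<open>(y - w)\<^sup>2 < 3/4\<close> unfolds to \<open>(1 - x) * (1 + 2 * x) < 2 * y * w\<close>,
  which is proved by squaring.\<close>

lemma concave_branch_C_cube:
  assumes "side_relations x y w"
  shows "1 < C_cube (y - w)"
proof -
  note b = side_relations_bounds[OF assms]
  have "((1 - x) * (1 + 2 * x))\<^sup>2 < (2 * y * w)\<^sup>2"
  proof -
    have "(2 * y * w)\<^sup>2 - ((1 - x) * (1 + 2 * x))\<^sup>2 = (1 - x) * (1 + 2 * x) * 2"
      unfolding power_mult_distrib b(6,7) by (simp add: power2_eq_square algebra_simps)
    moreover have "(1 - x) * (1 + 2 * x) * 2 > 0" using b by simp
    ultimately show ?thesis by linarith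
  qed
  then have "(1 - x) * (1 + 2 * x) < 2 * y * w"
    by (rule power2_less_imp_less) (use b in auto)
  then have "(y - w)\<^sup>2 < 3/4"
    unfolding power2_diff b(6,7) by (simp add: algebra_simps power2_eq_square)
  then show ?thesis by (simp add: C_cube_greater_1_iff)
qed

text \<open>A chain of signs from \<open>C_cube z > 1\<close>: if \<open>z \<le> 0\<close>, then
  \<open>E < 0\<close> and the first relation has sides of incompatible sign. So
  \<open>z > 0\<close>, the same relation gives \<open>E < 0\<close>, and then the second gives
  \<open>A_cube x < 1\<close>. Squaring \<open>E < 0\<close> yields the quadratic bound on
  \<open>x\<close>.\<close>

lemma concave_branch_signs:
  assumes rel: "side_relations x y w" and bal: "balanced x y (y - w) a b c"
    and pos: "a > 0" "b > 0" "c > 0"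
  shows "1/2 < x" "4 * x\<^sup>2 - 2 * x - 1 < 0" "0 < y - w" "0 < w / 2 - x * (y - w)"
proof -
  note b = side_relations_bounds[OF rel]
  define z where "z = y - w"
  define E where "E = z * (x + 1/2) - y / 2"
  have E: "E = x * z - w / 2" by (simp add: E_def z_def field_simps)
  note C = concave_branch_C_cube[OF rel, folded z_def]
  note B = B_cube_less_1[OF b(1)]
  note f = bal[unfolded balanced_def, folded z_def, folded E_def]
  show z: "0 < y - w"
  proof (rule ccontr)
    assume "\<not> 0 < y - w"
    then have z: "z \<le> 0" by (simp add: z_def)
    then have "x * z \<le> 0" using b(1) by (simp add: mult_nonneg_nonpos)
    then have "E < 0" using b(4) E by simp
    then have "b * (1 - B_cube x) * E < 0" using B pos by (intro mult_pos_neg) auto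
    moreover have "a * (1 - C_cube z) * z \<ge> 0"
      using C pos z by (simp add: mult_nonpos_nonpos mult_nonneg_nonpos)
    ultimately show False using f by linarith
  qed
  have "a * (1 - C_cube z) * z < 0" using z C pos by (simp add: z_def mult_neg_pos mult_pos_neg)
  then have "b * (1 - B_cube x) * E < 0" using f by simp
  then have "E < 0" using B pos by (simp add: mult_less_0_iff)
  then show "0 < w / 2 - x * (y - w)" by (simp add: E z_def)
  have "0 < c * (1 - C_cube z) * E" using \<open>E < 0\<close> C pos by (simp add: mult_neg_neg mult_pos_neg)
  then have "0 < b * (1 - A_cube x) * (2 * x * y)" using f by simp
  then have "A_cube x < 1" using pos mult_pos_pos[OF b(1,3)] by (simp add: zero_less_mult_iff)
  then show "1/2 < x" using b(1) by (simp add: A_cube_less_1_iff)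
  have "2 * x * y < w * (1 + 2 * x)" using \<open>E < 0\<close> by (simp add: E z_def algebra_simps)
  then have "(2 * x * y)\<^sup>2 < (w * (1 + 2 * x))\<^sup>2" using b by (intro power_strict_mono) auto
  moreover have "(w * (1 + 2 * x))\<^sup>2 - (2 * x * y)\<^sup>2 = (1 + 2 * x) * (1 + 2 * x - 4 * x\<^sup>2)"
    unfolding power_mult_distrib b(6,7) by (simp add: power2_eq_square algebra_simps)
  ultimately have "0 < (1 + 2 * x) * (1 + 2 * x - 4 * x\<^sup>2)" by linarith
  then show "4 * x\<^sup>2 - 2 * x - 1 < 0" using b by (simp add: zero_less_mult_iff)
qed

section \<open>The convex branch\<close>

text \<open>The balance equation turns out to be \<open>\<kappa> (T1 - T2 - T3) = 0\<close>, where
  \<open>\<kappa> = 4 x\<^sup>2 - 2 x - 1\<close> vanishes exactly at the regular pentagon. Here \<open>s = w / z\<close>, and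
  \<open>\<beta>\<close> and \<open>\<rho>\<close> are the distances \<open>r\<^sub>1\<^sub>4\<close> and \<open>r\<^sub>1\<^sub>5\<close>.\<close>

definition T1 :: "real \<Rightarrow> real \<Rightarrow> real \<Rightarrow> real" where
  "T1 x s z = 1 + s - s\<^sup>2 + (4 * x\<^sup>2 + 2 * x - 3) * (2 * x + 1 + (2 - 2 * x) * s) / (4 * z\<^sup>2 * (1 + (2 * x - 1) * s))"

definition T2 :: "real \<Rightarrow> real \<Rightarrow> real \<Rightarrow> real \<Rightarrow> real \<Rightarrow> real \<Rightarrow> real" where
  "T2 x s y w \<beta> \<rho> = (2 * x + s)\<^sup>2 * (2 * (x + 1)) / ((2 * x - 1) * (x + 1) + 2 * y * w)
     * ((\<beta>\<^sup>2 + \<beta> * \<rho> + \<rho>\<^sup>2) / ((\<beta> + \<rho>) * \<beta> ^ 3 * (\<rho> ^ 3 - 1)))"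

definition T3 :: "real \<Rightarrow> real \<Rightarrow> real \<Rightarrow> real" where
  "T3 x s \<beta> = s * (4 * x\<^sup>2 + 2 * x * \<beta> + \<beta>\<^sup>2) / (x\<^sup>2 * (2 * x + \<beta>) * (\<beta> ^ 3 - 1))"

text \<open>The equation is first brought to \<open>4 * x\<^sup>2 - 8 * x * s - s\<^sup>2 = (2 * x +
  s)\<^sup>2 * ((C - B) / (1 - C)) + 8 * x * s * ((B - A) / (1 - B))\<close>. The three terms are
  \<kappa> times \<open>T1\<close>, \<open>T2\<close> and \<open>T3\<close>, as \<open>I1\<close>,
  \<open>I2\<close> and \<open>I3\<close> show.\<close>

lemma convex_branch_factorization:
  assumes rel: "side_relations x y w" and x: "1/2 < x"
    and eq: "(1 - B) * E * (2 * x * z * (1 - C) - (1 - B) * E) = (1 - C) * (1 - A) * (2 * x * z) * (z - y)"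
    and z: "z = y + w" and E: "E = z * (x + 1/2) - y / 2"
    and A: "A = 1 / (2 * x) ^ 3" and B: "B = 1 / \<beta> ^ 3" and C: "C = 1 / \<rho> ^ 3"
    and \<beta>: "1 < \<beta>" "\<beta>\<^sup>2 = 1 + 2 * x" and \<rho>: "1 < \<rho>" "\<rho>\<^sup>2 = 1/4 + z\<^sup>2"
  shows "(4 * x\<^sup>2 - 2 * x - 1) * (T1 x (w / z) z - T2 x (w / z) y w \<beta> \<rho> - T3 x (w / z) \<beta>) = 0"
proof -
  note b = side_relations_bounds[OF rel]
  define k where "k = 4 * x\<^sup>2 - 2 * x - 1"
  define s where "s = w / z"
  have z0: "z > 0" using b z by simp
  have s: "s * z = w" "0 < s" using z0 b by (simp_all add: s_def)
  have \<beta>3: "\<beta> ^ 3 > 1" and \<rho>3: "\<rho> ^ 3 > 1" using \<beta> \<rho> by (simp_all add: one_less_power)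
  have less: "B < 1" "C < 1" using \<beta>3 \<rho>3 \<beta> \<rho> by (auto simp: B C divide_less_eq_1)

  have "(4 * x\<^sup>2 - 8 * x * s - s\<^sup>2) * z\<^sup>2 = 4 * x\<^sup>2 * z\<^sup>2 - 8 * x * z * w - w\<^sup>2"
    unfolding s(1)[symmetric] by (simp add: power2_eq_square algebra_simps)
  \<comment> \<open>At the regular pentagon \<open>y = 2 * x * w\<close>. The remainder next to
    \<open>k\<close> is written with this difference as a factor, and the conjugate
    \<open>y + 2 * x * w\<close> turns it into a multiple of \<open>k\<close>.\<close>
  also have "\<dots> = k * (z\<^sup>2 + z * w - w\<^sup>2) + (y - 2 * x * w) * ((2 * x + 1) * y + 3 * w)"
    unfolding z k_def by (simp add: power2_eq_square algebra_simps)
  also have "y - 2 * x * w = k * (4 * x\<^sup>2 + 2 * x - 3) / (4 * (y + 2 * x * w))"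
  proof -
    have "4 * (y + 2 * x * w) * (y - 2 * x * w) = 4 * y\<^sup>2 - 16 * x\<^sup>2 * w\<^sup>2"
      by (simp add: power2_eq_square algebra_simps)
    also have "\<dots> = k * (4 * x\<^sup>2 + 2 * x - 3)"
      unfolding b(6,7) k_def by (simp add: power2_eq_square algebra_simps)
    moreover have "y + 2 * x * w > 0" using b by (simp add: add_pos_pos)
    ultimately show ?thesis by (simp add: field_simps)
  qed
  also have "k * (z\<^sup>2 + z * w - w\<^sup>2) + k * (4 * x\<^sup>2 + 2 * x - 3) / (4 * (y + 2 * x * w)) * ((2 * x + 1) * y + 3 * w)
      = k * T1 x s z * z\<^sup>2"
  proof -
    have "(1 + (2 * x - 1) * s) * z = z + (2 * x - 1) * (s * z)" by (simp add: algebra_simps)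
    then have 1: "(1 + (2 * x - 1) * s) * z = y + 2 * x * w" unfolding s(1) by (simp add: z algebra_simps)
    have "(2 * x + 1 + (2 - 2 * x) * s) * z = (2 * x + 1) * z + (2 - 2 * x) * (s * z)" by (simp add: algebra_simps)
    then have 2: "(2 * x + 1 + (2 - 2 * x) * s) * z = (2 * x + 1) * y + 3 * w"
      unfolding s(1) by (simp add: z algebra_simps)
    have 3: "(1 + s - s\<^sup>2) * z\<^sup>2 = z\<^sup>2 + z * w - w\<^sup>2"
      unfolding s(1)[symmetric] by (simp add: power2_eq_square algebra_simps)
    have "n * m / (4 * z\<^sup>2 * d) * z\<^sup>2 = n * (m * z) / (4 * (d * z))" for n m d
      using z0 by (simp add: power2_eq_square)
    note G = this[of "4 * x\<^sup>2 + 2 * x - 3" "2 * x + 1 + (2 - 2 * x) * s" "1 + (2 * x - 1) * s", unfolded 1 2]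
    have "k * T1 x s z * z\<^sup>2 = k * ((1 + s - s\<^sup>2) * z\<^sup>2 + (4 * x\<^sup>2 + 2 * x - 3) *
        (2 * x + 1 + (2 - 2 * x) * s) / (4 * z\<^sup>2 * (1 + (2 * x - 1) * s)) * z\<^sup>2)"
      unfolding T1_def by (simp only: distrib_right mult.assoc)
    then show ?thesis unfolding 3 G by (simp add: distrib_left mult.assoc add_divide_distrib)
  qed
  finally have I1: "4 * x\<^sup>2 - 8 * x * s - s\<^sup>2 = k * T1 x s z" using z0 by simp

  \<comment> \<open>The conjugate of \<open>\<beta>\<^sup>2 - \<rho>\<^sup>2 = (2 * x - 1) * (x + 1)
    - 2 * y * w\<close>: the product of the two is a polynomial in \<open>x\<close> divisible by
    \<open>k\<close>.\<close>
  define D where "D = (2 * x - 1) * (x + 1) + 2 * y * w"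
  have D: "D > 0" unfolding D_def using b x by (intro add_pos_pos) auto
  have "(\<beta>\<^sup>2 - \<rho>\<^sup>2) * D = 2 * (x + 1) * k"
  proof -
    have e: "\<beta>\<^sup>2 - \<rho>\<^sup>2 = (2 * x - 1) * (x + 1) - 2 * y * w"
      unfolding \<beta> \<rho> z power2_sum b(6,7) by (simp add: algebra_simps power2_eq_square)
    have "(\<beta>\<^sup>2 - \<rho>\<^sup>2) * D = ((2 * x - 1) * (x + 1))\<^sup>2 - 4 * y\<^sup>2 * w\<^sup>2"
      unfolding e D_def by (simp add: power2_eq_square algebra_simps)
    then show ?thesis unfolding b(6,7) k_def by (simp add: algebra_simps power2_eq_square)
  qed
  then have "(\<beta> - \<rho>) * (D * (\<beta> + \<rho>)) = k * (2 * (x + 1))"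
    by (simp add: power2_eq_square algebra_simps)
  moreover have nz: "D * (\<beta> + \<rho>) \<noteq> 0" "\<beta> ^ 3 \<noteq> 0" "\<rho> ^ 3 \<noteq> 0" "\<rho> ^ 3 - 1 \<noteq> 0" "\<beta> ^ 3 - 1 \<noteq> 0"
    using D \<beta> \<rho> by (auto simp: less_imp_neq[OF \<beta>3, symmetric] less_imp_neq[OF \<rho>3, symmetric])
  ultimately have br: "\<beta> - \<rho> = k * (2 * (x + 1)) / (D * (\<beta> + \<rho>))"
    by (intro eq_divide_imp)
  have "C - B = (\<beta> ^ 3 - \<rho> ^ 3) / (\<beta> ^ 3 * \<rho> ^ 3)" "1 - C = (\<rho> ^ 3 - 1) / \<rho> ^ 3"
    using nz by (simp_all add: B C diff_divide_distrib)
  moreover have "u / (v * r) / (p / r) = u / (v * p)" if "r \<noteq> 0" for u v r p :: real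
    using that by simp
  ultimately have "(C - B) / (1 - C) = (\<beta> ^ 3 - \<rho> ^ 3) / (\<beta> ^ 3 * (\<rho> ^ 3 - 1))" using nz by metis
  also have "\<beta> ^ 3 - \<rho> ^ 3 = (\<beta> - \<rho>) * (\<beta>\<^sup>2 + \<beta> * \<rho> + \<rho>\<^sup>2)"
    by (simp add: power2_eq_square power3_eq_cube algebra_simps)
  finally have I2: "k * T2 x s y w \<beta> \<rho> = (2 * x + s)\<^sup>2 * ((C - B) / (1 - C))"
    unfolding br T2_def D_def[symmetric] by (simp add: mult_ac)

  have "k = (2 * x - \<beta>) * (2 * x + \<beta>)" using \<beta> by (simp add: k_def algebra_simps power2_eq_square)
  then have tb: "2 * x - \<beta> = k / (2 * x + \<beta>)" using x \<beta> by simp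
  have "B - A = ((2 * x) ^ 3 - \<beta> ^ 3) / ((2 * x) ^ 3 * \<beta> ^ 3)" "1 - B = (\<beta> ^ 3 - 1) / \<beta> ^ 3"
    using nz x by (simp_all add: A B diff_divide_distrib)
  moreover have "u / (v * r) / (p / r) = u / (v * p)" if "r \<noteq> 0" for u v r p :: real
    using that by simp
  ultimately have "(B - A) / (1 - B) = ((2 * x) ^ 3 - \<beta> ^ 3) / ((2 * x) ^ 3 * (\<beta> ^ 3 - 1))"
    using nz by metis
  also have "(2 * x) ^ 3 - \<beta> ^ 3 = (2 * x - \<beta>) * (4 * x\<^sup>2 + 2 * x * \<beta> + \<beta>\<^sup>2)"
    by (simp add: power2_eq_square power3_eq_cube algebra_simps)
  finally have "8 * x * s * ((B - A) / (1 - B))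
      = 8 * x * s * (k / (2 * x + \<beta>) * (4 * x\<^sup>2 + 2 * x * \<beta> + \<beta>\<^sup>2) / ((2 * x) ^ 3 * (\<beta> ^ 3 - 1)))"
    unfolding tb by simp
  also have "\<dots> = k * T3 x s \<beta>"
  proof -
    have "8 * x * u / ((2 * x) ^ 3 * v) = u / (x\<^sup>2 * v)" for u v
      using x by (simp add: power3_eq_cube power2_eq_square)
    from this[of "s * k * (4 * x\<^sup>2 + 2 * x * \<beta> + \<beta>\<^sup>2)" "(2 * x + \<beta>) * (\<beta> ^ 3 - 1)"]
    show ?thesis by (simp add: T3_def mult_ac)
  qed
  finally have I3: "k * T3 x s \<beta> = 8 * x * s * ((B - A) / (1 - B))" by simp

  have E': "E = x * z + w / 2" by (simp add: E z field_simps)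
  have "1 - B \<noteq> 0" "1 - C \<noteq> 0" using less by auto
  \<comment> \<open>Writing the quotients \<open>(1 - B) / (1 - C)\<close> and
    \<open>(1 - A) / (1 - B)\<close> as 1 plus a deviation separates the polynomial part from the
    terms that vanish when the diagonals agree.\<close>
  then have "E * (2 * x * z - E * (1 + (C - B) / (1 - C))) = (1 + (B - A) / (1 - B)) * (2 * x * z) * w"
  proof -
    have 1: "1 + (C - B) / (1 - C) = (1 - B) / (1 - C)" "1 + (B - A) / (1 - B) = (1 - A) / (1 - B)"
      using \<open>1 - B \<noteq> 0\<close> \<open>1 - C \<noteq> 0\<close> by (simp_all add: field_simps)
    have 2: "p * q * (E * (V - E * (p / q))) = p * E * (V * q - p * E)" if "q \<noteq> 0" for p q V
      using that by (simp add: field_simps)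
    have 3: "p * q * (r / p * V * w) = q * r * V * w" if "p \<noteq> 0" for p q r V
      using that by simp
    have "(1 - B) * (1 - C) * (E * (2 * x * z - E * ((1 - B) / (1 - C))))
        = (1 - C) * (1 - A) * (2 * x * z) * (z - y)"
      unfolding 2[OF \<open>1 - C \<noteq> 0\<close>] by (rule eq)
    also have "\<dots> = (1 - B) * (1 - C) * ((1 - A) / (1 - B) * (2 * x * z) * w)"
      unfolding 3[OF \<open>1 - B \<noteq> 0\<close>] by (simp add: z)
    finally show ?thesis unfolding 1
      using \<open>1 - B \<noteq> 0\<close> \<open>1 - C \<noteq> 0\<close> by (simp only: mult_cancel_left mult_eq_0_iff simp_thms)
  qed
  moreover have "4 * E * (V - E) - 4 * V * w = (2 * E)\<^sup>2 * e1 + 4 * V * w * e2"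
    if "E * (V - E * (1 + e1)) = (1 + e2) * V * w" for V e1 e2
    using that by (simp add: algebra_simps power2_eq_square)
  ultimately have "4 * E * (2 * x * z - E) - 4 * (2 * x * z) * w
      = (2 * E)\<^sup>2 * ((C - B) / (1 - C)) + 4 * (2 * x * z) * w * ((B - A) / (1 - B))" by blast
  moreover have "2 * E = (2 * x + s) * z" "w = s * z" using s by (simp_all add: E' algebra_simps)
  moreover have "z\<^sup>2 * (4 * x\<^sup>2 - 8 * x * s - s\<^sup>2) = z\<^sup>2 * ((2 * x + s)\<^sup>2 * e1 + 8 * x * s * e2)"
    if "4 * E * (2 * x * z - E) - 4 * (2 * x * z) * w = (2 * E)\<^sup>2 * e1 + 4 * (2 * x * z) * w * e2"
      "2 * E = (2 * x + s) * z" "w = s * z" for e1 e2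
  proof -
    have "2 * (2 * E) * (2 * x * z - 2 * E / 2) - 4 * (2 * x * z) * w = (2 * E)\<^sup>2 * e1 + 4 * (2 * x * z) * w * e2"
      using that(1) by simp
    then show ?thesis unfolding that(2,3) by (simp add: field_simps power2_eq_square)
  qed
  ultimately have "z\<^sup>2 * (4 * x\<^sup>2 - 8 * x * s - s\<^sup>2)
      = z\<^sup>2 * ((2 * x + s)\<^sup>2 * ((C - B) / (1 - C)) + 8 * x * s * ((B - A) / (1 - B)))" by blast
  then have "4 * x\<^sup>2 - 8 * x * s - s\<^sup>2 = (2 * x + s)\<^sup>2 * ((C - B) / (1 - C)) + 8 * x * s * ((B - A) / (1 - B))"
    using z0 by simp
  then show ?thesis
    unfolding I1 I2[symmetric] I3[symmetric] unfolding k_def s_def by (simp add: right_diff_distrib)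
qed

text \<open>
  \<open>T1 < T2 + T3\<close> is certified on a grid. A node \<open>(x, w, y, \<beta>, r)\<close> records lower bounds for the
  values at abscissa \<open>x\<close>, with error at most \<open>1/10\<^sup>4\<close> (\<open>3/10\<^sup>4\<close> for \<open>\<rho>\<close>); between two nodes
  all quantities are monotone, and the three terms are bounded by the corresponding endpoint values.
\<close>

type_synonym node = "real \<times> real \<times> real \<times> real \<times> real"

definition step :: real where "step = 1 / 10000"

fun node_ok :: "node \<Rightarrow> bool" where
  "node_ok (a, W, Y, V, R) \<longleftrightarrow> 0 \<le> W \<and> W\<^sup>2 \<le> 1 - a\<^sup>2 \<and> 1 - a\<^sup>2 \<le> (W + step)\<^sup>2 \<and>
     0 < Y \<and> Y\<^sup>2 \<le> 3/4 + a - a\<^sup>2 \<and> 3/4 + a - a\<^sup>2 \<le> (Y + step)\<^sup>2 \<and>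
     1 < V \<and> V\<^sup>2 \<le> 1 + 2 * a \<and> 1 + 2 * a \<le> (V + step)\<^sup>2 \<and>
     0 \<le> R \<and> R\<^sup>2 \<le> 1/4 + (Y + W)\<^sup>2 \<and> 1/4 + (Y + W + 2 * step)\<^sup>2 \<le> (R + 3 * step)\<^sup>2"

text \<open>On \<open>1/2 \<le> x\<close> the quantities \<open>w\<close>, \<open>y\<close>,
  \<open>s\<close> and \<open>\<rho>\<close> decrease while \<open>\<beta>\<close> increases, so
  \<open>s\<close> and \<open>P\<close> are upper bounds from the left node, \<open>U\<close> from
  the right, and \<open>s'\<close>, \<open>R'\<close> lower bounds from the right. The
  \<open>max 0\<close> keeps the numerator bound monotone where
  \<open>4 * b\<^sup>2 + 2 * b - 3\<close> is negative.\<close>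

fun cell_ok :: "node \<Rightarrow> node \<Rightarrow> bool" where
  "cell_ok (a, W, Y, V, R) (b, W', Y', V', R') \<longleftrightarrow> 1/2 \<le> a \<and> b \<le> 1 \<and> W + step \<le> Y \<and>
   (let s = (W + step) / (W + step + Y); s' = W' / (W' + Y' + step); U = V' + step; P = R + 3 * step in
     1 + s - s\<^sup>2 + max 0 (4 * b\<^sup>2 + 2 * b - 3) * (2 * b + 1 + (2 - 2 * a) * s)
       / (4 * (Y' + W')\<^sup>2 * (1 + (2 * a - 1) * s'))
     < (2 * a + s')\<^sup>2 * (2 * (a + 1)) / ((2 * b - 1) * (b + 1) + 2 * (Y + step) * (W + step))
         * ((V\<^sup>2 + V * R' + R'\<^sup>2) / ((U + P) * U ^ 3 * (P ^ 3 - 1)))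
       + s' * (4 * a\<^sup>2 + 2 * a * V + V\<^sup>2) / (b\<^sup>2 * (2 * b + U) * (U ^ 3 - 1)))"

lemma cell:
  assumes rel: "side_relations x y w" and ab: "a \<le> x" "x \<le> b"
    and na: "node_ok (a, W, Y, V, R)" and nb: "node_ok (b, W', Y', V', R')"
    and cell: "cell_ok (a, W, Y, V, R) (b, W', Y', V', R')"
    and \<beta>: "0 < \<beta>" "\<beta>\<^sup>2 = 1 + 2 * x" and \<rho>: "1 < \<rho>" "\<rho>\<^sup>2 = 1/4 + (y + w)\<^sup>2"
  shows "T1 x (w / (y + w)) (y + w) < T2 x (w / (y + w)) y w \<beta> \<rho> + T3 x (w / (y + w)) \<beta>"
proof -
  define z where "z = y + w"
  define s where "s = w / z"
  define su where "su = (W + step) / (W + step + Y)"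
  define sl where "sl = W' / (W' + Y' + step)"
  define U where "U = V' + step"
  define P where "P = R + 3 * step"
  have st: "step > 0" by (simp add: step_def)
  note rb = side_relations_bounds[OF rel]
  have A: "0 \<le> W" "W\<^sup>2 \<le> 1 - a\<^sup>2" "1 - a\<^sup>2 \<le> (W + step)\<^sup>2" "0 < Y" "Y\<^sup>2 \<le> 3/4 + a - a\<^sup>2"
    "3/4 + a - a\<^sup>2 \<le> (Y + step)\<^sup>2" "1 < V" "V\<^sup>2 \<le> 1 + 2 * a" "1/4 + (Y + W + 2 * step)\<^sup>2 \<le> (R + 3 * step)\<^sup>2"
    "0 \<le> R"
    using na by simp_all
  have B: "0 \<le> W'" "W'\<^sup>2 \<le> 1 - b\<^sup>2" "0 < Y'" "Y'\<^sup>2 \<le> 3/4 + b - b\<^sup>2" "3/4 + b - b\<^sup>2 \<le> (Y' + step)\<^sup>2"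
    "1 - b\<^sup>2 \<le> (W' + step)\<^sup>2" "1 < V'" "1 + 2 * b \<le> (V' + step)\<^sup>2" "R'\<^sup>2 \<le> 1/4 + (Y' + W')\<^sup>2" "0 \<le> R'"
    using nb by simp_all
  have a: "1/2 \<le> a" "b \<le> 1" "W + step \<le> Y" using cell by (auto simp: Let_def)
  have sq: "u\<^sup>2 \<le> v\<^sup>2" if "0 \<le> u" "u \<le> v" for u v :: real using that by (rule power_mono[rotated])
  have x2: "a\<^sup>2 \<le> x\<^sup>2" "x\<^sup>2 \<le> b\<^sup>2" using ab a by (auto intro: sq)
  have w: "W' \<le> w" "w \<le> W + step"
  proof -
    have *: "W'\<^sup>2 \<le> w\<^sup>2" "w\<^sup>2 \<le> (W + step)\<^sup>2" using A B rb(6) x2 by linarith+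
    show "W' \<le> w" by (rule power2_le_imp_le[OF *(1)]) (use rb in simp)
    show "w \<le> W + step" by (rule power2_le_imp_le[OF *(2)]) (use A st in simp)
  qed
  have mono: "u - u\<^sup>2 \<ge> v - v\<^sup>2" if "1/2 \<le> u" "u \<le> v" for u v :: real
  proof -
    have "0 \<le> (v - u) * (u + v - 1)" using that by (intro mult_nonneg_nonneg) auto
    then show ?thesis by (simp add: algebra_simps power2_eq_square)
  qed
  have y: "Y' \<le> y" "y \<le> Y + step"
  proof -
    have *: "Y'\<^sup>2 \<le> y\<^sup>2" "y\<^sup>2 \<le> (Y + step)\<^sup>2" using A B rb(7) mono[of a x] mono[of x b] ab a by linarith+
    show "Y' \<le> y" by (rule power2_le_imp_le[OF *(1)]) (use rb in simp)
    show "y \<le> Y + step" by (rule power2_le_imp_le[OF *(2)]) (use A st in simp)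
  qed
  have be: "V \<le> \<beta>" "\<beta> \<le> U"
  proof -
    have *: "V\<^sup>2 \<le> \<beta>\<^sup>2" "\<beta>\<^sup>2 \<le> U\<^sup>2" using A B \<beta>(2) ab unfolding U_def by linarith+
    show "V \<le> \<beta>" by (rule power2_le_imp_le[OF *(1)]) (use \<beta> in simp)
    show "\<beta> \<le> U" by (rule power2_le_imp_le[OF *(2)]) (use B st in \<open>simp add: U_def\<close>)
  qed
  have z: "0 < z" "Y' + W' \<le> z" "z \<le> Y + W + 2 * step" using w y rb by (auto simp: z_def)
  have "(Y' + W')\<^sup>2 \<le> z\<^sup>2" "z\<^sup>2 \<le> (Y + W + 2 * step)\<^sup>2"
    using z B by (auto intro: sq)
  moreover have "\<rho>\<^sup>2 = 1/4 + z\<^sup>2" using \<rho>(2) by (simp add: z_def)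
  ultimately have *: "R'\<^sup>2 \<le> \<rho>\<^sup>2" "\<rho>\<^sup>2 \<le> P\<^sup>2" using A B unfolding P_def by linarith+
  have rh: "R' \<le> \<rho>" by (rule power2_le_imp_le[OF *(1)]) (use \<rho> in simp)
  have rh': "\<rho> \<le> P" by (rule power2_le_imp_le[OF *(2)]) (use A st in \<open>simp add: P_def\<close>)
  note rh = rh rh'

  have sz: "s * z = w" "0 < s" using z rb by (simp_all add: s_def)
  have lin: "0 \<le> 1 + u - (x + v) / 4" if "0 \<le> u" "v \<le> 1" for u v
    using that rb(2) by simp
  \<comment> \<open>\<open>s \<le> su\<close> amounts to monotonicity of \<open>w / y\<close>. After
    squaring, the difference has the factor \<open>x - a\<close> with a nonnegative cofactor, which
    replaces a derivative.\<close>
  have "w * Y \<le> (W + step) * y"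
  proof (rule power2_le_imp_le)
    have "(w * Y)\<^sup>2 \<le> w\<^sup>2 * (3/4 + a - a\<^sup>2)"
      using A by (simp add: power_mult_distrib mult_left_mono)
    also have "\<dots> \<le> y\<^sup>2 * (1 - a\<^sup>2)"
    proof -
      have "y\<^sup>2 * (1 - a\<^sup>2) - w\<^sup>2 * (3/4 + a - a\<^sup>2) = (x - a) * (1 + a * x - (x + a) / 4)"
        unfolding rb(6,7) by (simp add: field_simps power2_eq_square)
      moreover have "0 \<le> a * x" using ab a by simp
      then have "0 \<le> 1 + a * x - (x + a) / 4" using lin[of "a * x" a] ab a rb(2) by simp
      then have "0 \<le> (x - a) * (1 + a * x - (x + a) / 4)" using ab by simp
      ultimately show ?thesis by linarith
    qed
    also have "\<dots> \<le> y\<^sup>2 * (W + step)\<^sup>2" using A by (intro mult_left_mono) auto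
    finally show "(w * Y)\<^sup>2 \<le> ((W + step) * y)\<^sup>2" by (simp add: power_mult_distrib mult.commute)
    show "0 \<le> (W + step) * y" using A st rb by simp
  qed
  moreover have "0 < W + step + Y" using A st by simp
  ultimately have su: "s \<le> su"
    using z unfolding s_def su_def by (simp add: field_simps z_def)
  \<comment> \<open>\<open>s - s\<^sup>2\<close> increases only up to 1/2; the condition
    \<open>W + step \<le> Y\<close> of \<open>cell_ok\<close> secures this range.\<close>
  have "su \<le> 1/2" using a A st unfolding su_def by (simp add: field_simps)
  have "W' * y \<le> w * (Y' + step)"
  proof (rule power2_le_imp_le)
    have "(W' * y)\<^sup>2 \<le> (1 - b\<^sup>2) * y\<^sup>2"
      using B by (simp add: power_mult_distrib mult_right_mono)
    also have "\<dots> \<le> w\<^sup>2 * (3/4 + b - b\<^sup>2)"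
    proof -
      have "w\<^sup>2 * (3/4 + b - b\<^sup>2) - (1 - b\<^sup>2) * y\<^sup>2 = (b - x) * (1 + b * x - (x + b) / 4)"
        unfolding rb(6,7) by (simp add: field_simps power2_eq_square)
      moreover have "0 \<le> b * x" using ab a by simp
      then have "0 \<le> 1 + b * x - (x + b) / 4" using lin[of "b * x" b] ab a rb(2) by simp
      then have "0 \<le> (b - x) * (1 + b * x - (x + b) / 4)" using ab by simp
      ultimately show ?thesis by linarith
    qed
    also have "\<dots> \<le> w\<^sup>2 * (Y' + step)\<^sup>2" using B by (intro mult_left_mono) auto
    finally show "(W' * y)\<^sup>2 \<le> (w * (Y' + step))\<^sup>2" by (simp add: power_mult_distrib)
    show "0 \<le> w * (Y' + step)" using B st rb by simp
  qed
  moreover have "0 < W' + Y' + step" using B st by simp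
  ultimately have sl: "sl \<le> s" "0 \<le> sl"
    using z B st unfolding s_def sl_def by (simp_all add: field_simps z_def)

  have x: "1/2 \<le> x" "0 < b" using ab a by auto
  have U: "1 < U" "1 < V" "1 < P" "0 \<le> R'" using be \<beta> A B st rh \<rho> by (auto simp: U_def P_def)
  then have cubes: "1 < U ^ 3" "1 < P ^ 3" by (simp_all add: one_less_power)
  have \<beta>1: "1 < \<beta>" using U be by simp
  then have cubes': "1 < \<beta> ^ 3" "1 < \<rho> ^ 3" using \<rho> by (simp_all add: one_less_power)

  have "T1 x s z \<le> 1 + su - su\<^sup>2 + max 0 (4 * b\<^sup>2 + 2 * b - 3) * (2 * b + 1 + (2 - 2 * a) * su)
       / (4 * (Y' + W')\<^sup>2 * (1 + (2 * a - 1) * sl))"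
  proof -
    have "s - s\<^sup>2 \<le> su - su\<^sup>2"
    proof -
      have "0 \<le> (su - s) * (1 - su - s)" using su \<open>su \<le> 1/2\<close> by (intro mult_nonneg_nonneg) auto
      then show ?thesis by (simp add: algebra_simps power2_eq_square)
    qed
    moreover have "(4 * x\<^sup>2 + 2 * x - 3) * (2 * x + 1 + (2 - 2 * x) * s) / (4 * z\<^sup>2 * (1 + (2 * x - 1) * s))
      \<le> max 0 (4 * b\<^sup>2 + 2 * b - 3) * (2 * b + 1 + (2 - 2 * a) * su) / (4 * (Y' + W')\<^sup>2 * (1 + (2 * a - 1) * sl))"
    proof (rule frac_le)
      have "(2 - 2 * x) * s \<le> (2 - 2 * a) * su" using ab a rb su sz by (intro mult_mono) auto
      moreover have "4 * x\<^sup>2 + 2 * x - 3 \<le> max 0 (4 * b\<^sup>2 + 2 * b - 3)"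
        using x2(2) ab by (intro max.coboundedI2) linarith
      moreover have "0 \<le> (2 - 2 * x) * s" using rb sz by simp
      ultimately show "(4 * x\<^sup>2 + 2 * x - 3) * (2 * x + 1 + (2 - 2 * x) * s)
          \<le> max 0 (4 * b\<^sup>2 + 2 * b - 3) * (2 * b + 1 + (2 - 2 * a) * su)"
        using ab x by (intro mult_mono) auto
      have "(2 * a - 1) * sl \<le> (2 * x - 1) * s" "0 \<le> (2 * a - 1) * sl" using ab a sl by (auto intro: mult_mono)
      then show "4 * (Y' + W')\<^sup>2 * (1 + (2 * a - 1) * sl) \<le> 4 * z\<^sup>2 * (1 + (2 * x - 1) * s)"
        using \<open>(Y' + W')\<^sup>2 \<le> z\<^sup>2\<close> by (intro mult_mono) auto
      show "0 < 4 * (Y' + W')\<^sup>2 * (1 + (2 * a - 1) * sl)"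
        using \<open>0 \<le> (2 * a - 1) * sl\<close> B by (intro mult_pos_pos) auto
      show "0 \<le> max 0 (4 * b\<^sup>2 + 2 * b - 3) * (2 * b + 1 + (2 - 2 * a) * su)"
        using ab x a su sz rb by (intro mult_nonneg_nonneg add_nonneg_nonneg) auto
    qed
    ultimately show ?thesis unfolding T1_def by linarith
  qed
  also have "\<dots> < (2 * a + sl)\<^sup>2 * (2 * (a + 1)) / ((2 * b - 1) * (b + 1) + 2 * (Y + step) * (W + step))
         * ((V\<^sup>2 + V * R' + R'\<^sup>2) / ((U + P) * U ^ 3 * (P ^ 3 - 1)))
       + sl * (4 * a\<^sup>2 + 2 * a * V + V\<^sup>2) / (b\<^sup>2 * (2 * b + U) * (U ^ 3 - 1))"
    using cell by (simp only: cell_ok.simps Let_def su_def sl_def U_def P_def)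
  also have "\<dots> \<le> T2 x s y w \<beta> \<rho> + T3 x s \<beta>"
  proof (rule add_mono)
    have "\<beta> ^ 3 \<le> U ^ 3" "\<rho> ^ 3 \<le> P ^ 3" using be rh \<beta> \<rho> by (auto intro: power_mono)
    note pw = this
    show "(2 * a + sl)\<^sup>2 * (2 * (a + 1)) / ((2 * b - 1) * (b + 1) + 2 * (Y + step) * (W + step))
         * ((V\<^sup>2 + V * R' + R'\<^sup>2) / ((U + P) * U ^ 3 * (P ^ 3 - 1))) \<le> T2 x s y w \<beta> \<rho>"
      unfolding T2_def
    proof (intro mult_mono[OF frac_le frac_le])
      show "(2 * a + sl)\<^sup>2 * (2 * (a + 1)) \<le> (2 * x + s)\<^sup>2 * (2 * (x + 1))"
        using ab a sl by (intro mult_mono sq) auto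
      have "(2 * x - 1) * (x + 1) \<le> (2 * b - 1) * (b + 1)" using ab x by (intro mult_mono) auto
      moreover have "2 * y * w \<le> 2 * (Y + step) * (W + step)" using w y rb st A by (intro mult_mono) auto
      ultimately show "(2 * x - 1) * (x + 1) + 2 * y * w \<le> (2 * b - 1) * (b + 1) + 2 * (Y + step) * (W + step)"
        by simp
      show "0 < (2 * x - 1) * (x + 1) + 2 * y * w" using x rb by (intro add_nonneg_pos) auto
      show "V\<^sup>2 + V * R' + R'\<^sup>2 \<le> \<beta>\<^sup>2 + \<beta> * \<rho> + \<rho>\<^sup>2"
        using be rh U \<beta> by (intro add_mono mult_mono sq) auto
      show "(\<beta> + \<rho>) * \<beta> ^ 3 * (\<rho> ^ 3 - 1) \<le> (U + P) * U ^ 3 * (P ^ 3 - 1)"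
        using be rh U \<beta>1 \<rho> pw cubes cubes' by (intro mult_mono) auto
      show "0 < (\<beta> + \<rho>) * \<beta> ^ 3 * (\<rho> ^ 3 - 1)" using \<beta>1 \<rho> cubes' by (intro mult_pos_pos) auto
    qed (use U x ab a sl sz \<beta>1 \<rho> cubes' rb in \<open>auto intro!: mult_nonneg_nonneg divide_nonneg_nonneg add_nonneg_nonneg\<close>)
    show "sl * (4 * a\<^sup>2 + 2 * a * V + V\<^sup>2) / (b\<^sup>2 * (2 * b + U) * (U ^ 3 - 1)) \<le> T3 x s \<beta>"
      unfolding T3_def
    proof (rule frac_le)
      show "sl * (4 * a\<^sup>2 + 2 * a * V + V\<^sup>2) \<le> s * (4 * x\<^sup>2 + 2 * x * \<beta> + \<beta>\<^sup>2)"
        using ab a sl be U by (intro mult_mono add_mono sq) auto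
      show "x\<^sup>2 * (2 * x + \<beta>) * (\<beta> ^ 3 - 1) \<le> b\<^sup>2 * (2 * b + U) * (U ^ 3 - 1)"
        using ab x be U \<beta>1 cubes cubes' pw by (intro mult_mono sq) auto
      show "0 < x\<^sup>2 * (2 * x + \<beta>) * (\<beta> ^ 3 - 1)" using x \<beta>1 cubes' by (intro mult_pos_pos) auto
      show "0 \<le> s * (4 * x\<^sup>2 + 2 * x * \<beta> + \<beta>\<^sup>2)" using x sz \<beta> by (intro mult_nonneg_nonneg add_nonneg_nonneg) auto
    qed
  qed
  finally show ?thesis by (simp add: s_def z_def)
qed

fun grid_ok :: "node list \<Rightarrow> bool" where
  "grid_ok (n # n' # ns) \<longleftrightarrow> node_ok n \<and> cell_ok n n' \<and> grid_ok (n' # ns)"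
| "grid_ok [n] \<longleftrightarrow> node_ok n"
| "grid_ok [] \<longleftrightarrow> False"

lemma grid:
  assumes "grid_ok ns" "fst (hd ns) \<le> x" "x < fst (last ns)"
    and rel: "side_relations x y w" and \<beta>: "0 < \<beta>" "\<beta>\<^sup>2 = 1 + 2 * x" and \<rho>: "1 < \<rho>" "\<rho>\<^sup>2 = 1/4 + (y + w)\<^sup>2"
  shows "T1 x (w / (y + w)) (y + w) < T2 x (w / (y + w)) y w \<beta> \<rho> + T3 x (w / (y + w)) \<beta>"
  using assms(1-3)
proof (induction ns rule: grid_ok.induct)
  case (1 n n' ns)
  obtain a W Y V R where n: "n = (a, W, Y, V, R)" by (cases n)
  obtain b W' Y' V' R' where n': "n' = (b, W', Y', V', R')" by (cases n')
  show ?case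
  proof (cases "b \<le> x")
    case True
    then show ?thesis using 1 by (simp add: n')
  next
    case False
    have "node_ok n'" using 1(2) by (cases ns) auto
    then have "node_ok (a, W, Y, V, R)" "node_ok (b, W', Y', V', R')" "cell_ok (a, W, Y, V, R) (b, W', Y', V', R')"
      using 1(2) by (simp_all only: n n' grid_ok.simps)
    moreover have "a \<le> x" "x \<le> b" using 1(3) False by (simp_all add: n)
    ultimately show ?thesis using cell[OF rel _ _ _ _ _ \<beta> \<rho>] by blast
  qed
qed auto

definition grid_node :: "nat \<Rightarrow> nat \<Rightarrow> nat \<Rightarrow> nat \<Rightarrow> nat \<Rightarrow> node" where
  "grid_node a W Y V R = (real a / 1000, real W * step, real Y * step, real V * step, real R * step)"

text \<open>Cells are as narrow as 5/1000 around 0.8, where the margin of the inequality is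
  smallest, and widen up to about 1/10 near 1/2, where \<open>T3\<close> dominates.\<close>

definition grid_nodes :: "node list" where
  "grid_nodes = [
    grid_node 500 8660 10000 14142 19318, grid_node 601 7992 9948 14839 18623, grid_node 658 7530 9874 15218 18107,
    grid_node 692 7218 9813 15440 17749, grid_node 715 6991 9766 15588 17487, grid_node 732 6813 9727 15697 17279,
    grid_node 745 6670 9695 15779 17111, grid_node 755 6557 9669 15842 16978, grid_node 764 6452 9645 15899 16855,
    grid_node 771 6368 9625 15943 16756, grid_node 778 6282 9605 15987 16655, grid_node 784 6207 9588 16024 16567,
    grid_node 789 6143 9573 16056 16492, grid_node 794 6079 9558 16087 16416, grid_node 799 6013 9542 16118 16338,
    grid_node 804 5946 9526 16149 16259, grid_node 809 5878 9510 16180 16179, grid_node 814 5808 9494 16211 16098,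
    grid_node 819 5737 9477 16241 16014, grid_node 824 5665 9460 16272 15930, grid_node 829 5592 9443 16303 15844,
    grid_node 834 5517 9425 16334 15756, grid_node 839 5441 9407 16364 15667, grid_node 845 5347 9386 16401 15558,
    grid_node 851 5251 9363 16437 15445, grid_node 858 5136 9337 16480 15312, grid_node 865 5017 9310 16522 15174,
    grid_node 873 4877 9278 16571 15012, grid_node 882 4712 9241 16625 14821, grid_node 893 4500 9195 16691 14579,
    grid_node 906 4232 9138 16769 14274, grid_node 921 3895 9070 16858 13895, grid_node 939 3439 8984 16964 13391,
    grid_node 961 2765 8874 17093 12667, grid_node 985 1725 8745 17233 11602, grid_node 1000 0 8660 17320 9999]"

lemma grid_nodes_ok: "grid_ok grid_nodes"
  by (simp add: grid_nodes_def grid_node_def step_def power2_eq_square power3_eq_cube)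

lemma convex_branch_unique:
  assumes rel: "side_relations x y w" and bal: "balanced x y (y + w) a b c" and pos: "b > 0" "c > 0"
  shows "4 * x\<^sup>2 - 2 * x - 1 = 0"
proof -
  define z where "z = y + w"
  define \<beta> where "\<beta> = sqrt (1 + 2 * x)"
  define \<rho> where "\<rho> = sqrt (1/4 + z\<^sup>2)"
  note rb = side_relations_bounds[OF rel]
  note x = convex_branch_signs(1)[OF rel bal pos]
  have \<beta>: "1 < \<beta>" "\<beta>\<^sup>2 = 1 + 2 * x" using x by (simp_all add: \<beta>_def)
  have \<rho>: "1 < \<rho>" "\<rho>\<^sup>2 = 1/4 + z\<^sup>2"
    using convex_branch_signs(2)[OF rel bal pos] unfolding \<rho>_def z_def C_cube_less_1_iff by simp_all
  have "(4 * x\<^sup>2 - 2 * x - 1) * (T1 x (w / z) z - T2 x (w / z) y w \<beta> \<rho> - T3 x (w / z) \<beta>) = 0"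
    using convex_branch_factorization[OF rel x balanced_equation[OF bal pos(1), folded z_def] z_def refl A_cube_def
        B_cube_def[of x, folded \<beta>_def] C_cube_def[of z, folded \<rho>_def] \<beta> \<rho>] .
  moreover have "T1 x (w / z) z < T2 x (w / z) y w \<beta> \<rho> + T3 x (w / z) \<beta>"
    unfolding z_def
  proof (rule grid[OF grid_nodes_ok _ _ rel])
    show "fst (hd grid_nodes) \<le> x" "x < fst (last grid_nodes)"
      using x rb by (simp_all add: grid_nodes_def grid_node_def)
  qed (use \<beta> \<rho> in \<open>simp_all add: z_def\<close>)
  ultimately show ?thesis by simp
qed

section \<open>The concave branch\<close>

text \<open>Each premise is a polynomial inequality that rational numbers can certify;
  \<open>1/2 \<le> a\<close> makes \<open>y\<close> monotone as well.\<close>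

lemma enclosure:
  assumes rel: "side_relations x y w" and x: "1/2 \<le> a" "a \<le> x" "x \<le> b"
  shows "wl\<^sup>2 \<le> 1 - b\<^sup>2 \<Longrightarrow> wl \<le> w"
    and "1 - a\<^sup>2 \<le> wu\<^sup>2 \<Longrightarrow> 0 \<le> wu \<Longrightarrow> w \<le> wu"
    and "yl\<^sup>2 \<le> 3/4 + b - b\<^sup>2 \<Longrightarrow> yl \<le> y"
    and "3/4 + a - a\<^sup>2 \<le> yu\<^sup>2 \<Longrightarrow> 0 \<le> yu \<Longrightarrow> y \<le> yu"
    and "A_cube x \<le> 1 / (2 * a) ^ 3" "1 / (2 * b) ^ 3 \<le> A_cube x"
    and "bl\<^sup>2 \<le> 1 + 2 * a \<Longrightarrow> 0 < bl \<Longrightarrow> B_cube x \<le> 1 / bl ^ 3"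
    and "1 + 2 * b \<le> bu\<^sup>2 \<Longrightarrow> 0 < bu \<Longrightarrow> 1 / bu ^ 3 \<le> B_cube x"
proof -
  note rb = side_relations_bounds[OF rel]
  have x2: "a\<^sup>2 \<le> x\<^sup>2" "x\<^sup>2 \<le> b\<^sup>2" using x by (auto intro: power_mono)
  have "0 \<le> (x - a) * (x + a - 1)" "0 \<le> (b - x) * (b + x - 1)" using x by simp_all
  then have y2: "3/4 + b - b\<^sup>2 \<le> y\<^sup>2" "y\<^sup>2 \<le> 3/4 + a - a\<^sup>2"
    unfolding rb(7) by (simp_all add: algebra_simps power2_eq_square)
  show "wl \<le> w" if "wl\<^sup>2 \<le> 1 - b\<^sup>2"
    by (rule power2_le_imp_le) (use that rb x2 in auto)
  show "w \<le> wu" if "1 - a\<^sup>2 \<le> wu\<^sup>2" "0 \<le> wu"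
    by (rule power2_le_imp_le) (use that rb x2 in auto)
  show "yl \<le> y" if "yl\<^sup>2 \<le> 3/4 + b - b\<^sup>2"
    by (rule power2_le_imp_le) (use that rb y2 in auto)
  show "y \<le> yu" if "3/4 + a - a\<^sup>2 \<le> yu\<^sup>2" "0 \<le> yu"
    by (rule power2_le_imp_le) (use that rb y2 in auto)
  show "A_cube x \<le> 1 / (2 * a) ^ 3" "1 / (2 * b) ^ 3 \<le> A_cube x"
    unfolding A_cube_def using x by (intro divide_left_mono power_mono; simp)+
  show "B_cube x \<le> 1 / bl ^ 3" if "bl\<^sup>2 \<le> 1 + 2 * a" "0 < bl"
  proof -
    have "bl \<le> sqrt (1 + 2 * x)" using that x by (intro real_le_rsqrt) simp
    then show ?thesis unfolding B_cube_def using that x by (intro divide_left_mono power_mono) auto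
  qed
  show "1 / bu ^ 3 \<le> B_cube x" if "1 + 2 * b \<le> bu\<^sup>2" "0 < bu"
  proof -
    have "sqrt (1 + 2 * x) \<le> bu" using that x by (intro real_le_lsqrt) simp_all
    then show ?thesis unfolding B_cube_def using that x by (intro divide_left_mono power_mono) auto
  qed
qed

lemma C_cube_enclosure:
  assumes "0 \<le> zl" "zl \<le> z" "z \<le> zu"
  shows "rl\<^sup>2 \<le> 1/4 + zl\<^sup>2 \<Longrightarrow> 0 < rl \<Longrightarrow> C_cube z \<le> 1 / rl ^ 3"
    and "1/4 + zu\<^sup>2 \<le> ru\<^sup>2 \<Longrightarrow> 0 < ru \<Longrightarrow> 1 / ru ^ 3 \<le> C_cube z"
proof -
  have z2: "zl\<^sup>2 \<le> z\<^sup>2" "z\<^sup>2 \<le> zu\<^sup>2" using assms by (auto intro: power_mono)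
  have pos: "0 < sqrt (1 / 4 + z\<^sup>2)" by (simp add: add_pos_nonneg)
  show "C_cube z \<le> 1 / rl ^ 3" if "rl\<^sup>2 \<le> 1/4 + zl\<^sup>2" "0 < rl"
  proof -
    have "rl \<le> sqrt (1/4 + z\<^sup>2)" using that z2 by (intro real_le_rsqrt) simp
    then show ?thesis unfolding C_cube_def using that pos
      by (intro divide_left_mono power_mono mult_pos_pos zero_less_power) auto
  qed
  show "1 / ru ^ 3 \<le> C_cube z" if "1/4 + zu\<^sup>2 \<le> ru\<^sup>2" "0 < ru"
  proof -
    have "sqrt (1/4 + z\<^sup>2) \<le> ru" using that z2 by (intro real_le_lsqrt) simp_all
    then have "sqrt (1/4 + z\<^sup>2) ^ 3 \<le> ru ^ 3" using pos by (intro power_mono) auto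
    then show ?thesis unfolding C_cube_def
      by (rule divide_left_mono[OF _ _ mult_pos_pos[OF zero_less_power[OF that(2)] zero_less_power[OF pos]]]) simp
  qed
qed

text \<open>\<open>excess\<close> is \<open>\<Delta>\<^sub>1\<^sub>4\<^sub>5\<close> on the concave branch, and the balance equation reads
  \<open>P (1 - P / Q) = w (1 - A)\<close>.\<close>

definition excess :: "real \<Rightarrow> real \<Rightarrow> real \<Rightarrow> real" where
  "excess x y w = w / 2 - x * (y - w)"

definition P_term :: "real \<Rightarrow> real \<Rightarrow> real \<Rightarrow> real" where
  "P_term x y w = (1 - B_cube x) * excess x y w"

definition Q_term :: "real \<Rightarrow> real \<Rightarrow> real \<Rightarrow> real" where
  "Q_term x y w = 2 * x * (y - w) * (C_cube (y - w) - 1)"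

definition concave_equation :: "real \<Rightarrow> real \<Rightarrow> real \<Rightarrow> bool" where
  "concave_equation x y w \<longleftrightarrow> P_term x y w * (Q_term x y w - P_term x y w) = Q_term x y w * w * (1 - A_cube x)"

lemma concave_branch_equation:
  assumes "balanced x y (y - w) a b c" "b > 0"
  shows "concave_equation x y w"
proof -
  have E: "(y - w) * (x + 1/2) - y / 2 = - excess x y w"
    by (simp add: excess_def field_simps)
  show ?thesis
    using balanced_equation[OF assms] unfolding E concave_equation_def P_term_def Q_term_def
    by (simp add: algebra_simps)
qed

text \<open>Since \<open>P\<close> and \<open>Q\<close> are positive,
  \<open>P * (1 - P / Q) = w * (1 - A)\<close> implies \<open>w * (1 - A) < P\<close>. The premise
  \<open>le\<close> contradicts this with the upper bound of \<open>P\<close> and the lower bound of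
  \<open>w * (1 - A)\<close> over the cell.\<close>

lemma concave_branch_cell:
  assumes rel: "side_relations x y w" and x: "1/2 \<le> p" "p \<le> x" "x \<le> q"
    and pos: "0 < y - w" "0 < excess x y w" and eq: "concave_equation x y w"
    and w: "0 \<le> wl" "wl\<^sup>2 \<le> 1 - q\<^sup>2" "1 - p\<^sup>2 \<le> wu\<^sup>2" "0 \<le> wu" and y: "yl\<^sup>2 \<le> 3/4 + q - q\<^sup>2" "wu \<le> yl"
    and \<beta>: "1 + 2 * q \<le> \<beta>\<^sup>2" "0 < \<beta>"
    and le: "(1 - 1 / \<beta> ^ 3) * (wu / 2 - p * (yl - wu)) < wl * (1 - 1 / (2 * p) ^ 3)"
  shows False
proof -
  note rb = side_relations_bounds[OF rel]
  note enc = enclosure[OF rel x]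
  have B: "0 < 1 - B_cube x" "1 - B_cube x \<le> 1 - 1 / \<beta> ^ 3"
    using B_cube_less_1[OF rb(1)] enc(8)[OF \<beta>] by auto
  have P: "0 < P_term x y w" using B pos by (simp add: P_term_def)
  have Q: "0 < Q_term x y w"
    using rb pos concave_branch_C_cube[OF rel] by (simp add: Q_term_def)
  have "P_term x y w * (Q_term x y w - P_term x y w) < Q_term x y w * P_term x y w"
    using P by (simp add: algebra_simps)
  then have "Q_term x y w * (w * (1 - A_cube x)) < Q_term x y w * P_term x y w"
    using eq by (simp add: concave_equation_def mult.assoc)
  then have "w * (1 - A_cube x) < P_term x y w" using Q by simp
  also have "P_term x y w \<le> (1 - 1 / \<beta> ^ 3) * (wu / 2 - p * (yl - wu))"
  proof -
    have "p * (yl - wu) \<le> x * (y - w)"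
      using enc(2)[OF w(3,4)] enc(3)[OF y(1)] y x by (intro mult_mono) auto
    then have "excess x y w \<le> wu / 2 - p * (yl - wu)"
      using enc(2)[OF w(3,4)] by (simp add: excess_def)
    then show ?thesis unfolding P_term_def using B pos by (intro mult_mono) auto
  qed
  also have "\<dots> < wl * (1 - 1 / (2 * p) ^ 3)" by (rule le)
  also have "\<dots> \<le> w * (1 - A_cube x)"
  proof -
    have "1 \<le> (2 * p) ^ 3" using x by (intro one_le_power) simp
    then have "1 / (2 * p) ^ 3 \<le> 1" using x by (intro divide_le_eq_1[THEN iffD2]) auto
    then show ?thesis using enc(1)[OF w(2)] enc(5) rb by (intro mult_mono) auto
  qed
  finally show False by simp
qed

lemma concave_branch_x_bound:
  assumes rel: "side_relations x y w" and bal: "balanced x y (y - w) a b c" and pos: "a > 0" "b > 0" "c > 0"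
  shows "x < 14/25"
proof (rule ccontr)
  assume "\<not> x < 14/25"
  then have x: "14/25 \<le> x" by simp
  note signs = concave_branch_signs[OF rel bal pos]
  have e: "0 < excess x y w" using signs(4) by (simp add: excess_def)
  note cell = concave_branch_cell[OF rel _ _ _ signs(3) e concave_branch_equation[OF bal pos(2)]]
  \<comment> \<open>The positive zero of \<open>4 * x\<^sup>2 - 2 * x - 1\<close> is
    \<open>(1 + sqrt 5) / 4\<close>, about 0.8090.\<close>
  have "x \<le> 81/100"
  proof (rule ccontr)
    assume "\<not> x \<le> 81/100"
    then have "0 \<le> (x - 81/100) * (4 * x + 4 * (81/100) - 2)" by (intro mult_nonneg_nonneg) auto
    then have "4 * x\<^sup>2 - 2 * x - 1 \<ge> 4 * (81/100)\<^sup>2 - 2 * (81/100) - 1"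
      by (simp add: algebra_simps power2_eq_square)
    then show False using signs(2) by (simp add: power2_eq_square)
  qed
  with x consider "14/25 \<le> x" "x \<le> 3/5" | "3/5 \<le> x" "x \<le> 7/10" | "7/10 \<le> x" "x \<le> 81/100" by linarith
  then show False
  proof cases
    case 1
    \<comment> \<open>The witnesses are \<open>wl\<close>, \<open>wu\<close>, \<open>yl\<close> and
      \<open>\<beta>\<close>: bounds for \<open>w\<close> from below and above, for \<open>y\<close>
      from below, and for the square root of \<open>1 + 2 * q\<close> from above.\<close>
    show False
      by (rule cell[OF _ 1, of "4/5" "829/1000" "99/100" "1484/1000"])
        (simp_all add: power2_eq_square power3_eq_cube)
  next
    case 2
    show False
      by (rule cell[OF _ 2, of "7/10" "4/5" "97/100" "31/20"])
        (simp_all add: power2_eq_square power3_eq_cube)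
  next
    case 3
    show False
      by (rule cell[OF _ 3, of "58/100" "18/25" "95/100" "17/10"])
        (simp_all add: power2_eq_square power3_eq_cube)
  qed
qed

section \<open>Uniqueness on the concave branch\<close>

text \<open>In the factorization of \<open>s ^ 3 - r ^ 3\<close>, the bound on squares gives
  \<open>s - r \<le> d / (2 * m)\<close>, and the cofactor is at most \<open>3 * s\<^sup>2\<close>.
  Suited to \<open>B_cube\<close>, whose squared distance is linear in x.\<close>

lemma cube_diff_bound:
  fixes r s :: real
  assumes "0 < m" "m \<le> r" "r \<le> s" "s\<^sup>2 - r\<^sup>2 \<le> d"
  shows "1 / r ^ 3 - 1 / s ^ 3 \<le> 3 * d * s\<^sup>2 / (2 * m ^ 7)"
proof -
  have rs: "0 < r" "0 < s" using assms by auto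
  have d: "0 \<le> d" using assms(4) power_mono[OF assms(3) less_imp_le[OF rs(1)], of 2] by linarith
  have 1: "1 / r ^ 3 - 1 / s ^ 3 = (s - r) * (s\<^sup>2 + s * r + r\<^sup>2) / (r ^ 3 * s ^ 3)"
    using rs by (simp add: field_simps power2_eq_square power3_eq_cube)
  have "(s - r) * (2 * m) \<le> (s - r) * (s + r)" using assms by (intro mult_left_mono) auto
  also have "\<dots> \<le> d" using assms(4) by (simp add: algebra_simps power2_eq_square)
  finally have 2: "s - r \<le> d / (2 * m)" using assms(1) by (simp add: field_simps)
  have 3: "s\<^sup>2 + s * r + r\<^sup>2 \<le> 3 * s\<^sup>2"
  proof -
    have "s * r \<le> s * s" "r * r \<le> s * s" using assms(3) rs by (auto intro: mult_mono)
    then show ?thesis unfolding power2_eq_square by linarith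
  qed
  have "1 / r ^ 3 - 1 / s ^ 3 \<le> d / (2 * m) * (3 * s\<^sup>2) / (m ^ 3 * m ^ 3)"
    unfolding 1 using 2 3 assms rs d by (intro frac_le mult_mono power_mono) auto
  also have "\<dots> = 3 * d * s\<^sup>2 / (2 * m ^ 7)" by (simp add: eval_nat_numeral mult_ac)
  finally show ?thesis .
qed

text \<open>For two solutions at distance \<open>\<delta>\<close>, the right side of
  \<open>P * (1 - P / Q) = w * (1 - A)\<close> grows by at least \<open>29/10 * \<delta>\<close>,
  mainly through \<open>A\<close>, while the left side grows by at most
  \<open>123/100 * \<delta>\<close>.\<close>

lemma concave_branch_injective:
  assumes rel1: "side_relations x1 y1 w1" and rel2: "side_relations x2 y2 w2"
    and x: "1/2 < x1" "x1 < x2" "x2 \<le> 14/25"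
    and eq1: "concave_equation x1 y1 w1" and eq2: "concave_equation x2 y2 w2"
    and pos: "0 < excess x1 y1 w1" "0 < excess x2 y2 w2"
  shows False
proof -
  define \<delta> where "\<delta> = x2 - x1"
  have \<delta>: "0 < \<delta>" using x by (simp add: \<delta>_def)
  note r1 = side_relations_bounds[OF rel1] and r2 = side_relations_bounds[OF rel2]
  have x': "1/2 \<le> x1" "x1 \<le> 14/25" "1/2 \<le> x2" using x by auto
  note e1 = enclosure[OF rel1 order_refl x'(1,2)] and e2 = enclosure[OF rel2 order_refl x'(3) x(3)]
  have w: "828/1000 \<le> w1" "w1 \<le> 8661/10000" "828/1000 \<le> w2" "w2 \<le> 8661/10000"
    using e1(1)[of "828/1000"] e2(1)[of "828/1000"] e1(2)[of "8661/10000"] e2(2)[of "8661/10000"]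
    by (simp_all add: power2_eq_square)
  have y: "998/1000 \<le> y1" "y1 \<le> 1" "998/1000 \<le> y2" "y2 \<le> 1"
    using e1(3)[of "998/1000"] e2(3)[of "998/1000"] e1(4)[of 1] e2(4)[of 1]
    by (simp_all add: power2_eq_square)
  define z1 z2 where "z1 = y1 - w1" and "z2 = y2 - w2"
  have z: "1319/10000 \<le> z1" "z1 \<le> 172/1000" "1319/10000 \<le> z2" "z2 \<le> 172/1000"
    using w y by (simp_all add: z1_def z2_def)
  define A1 A2 B1 B2 C1 C2 where "A1 = A_cube x1" and "A2 = A_cube x2" and "B1 = B_cube x1" and "B2 = B_cube x2"
    and "C1 = C_cube z1" and "C2 = C_cube z2"
  have A: "71/100 \<le> A1" "A1 < 1" "A2 < 1"
    using e1(6) x A_cube_less_1_iff[of x1] A_cube_less_1_iff[of x2] by (simp_all add: A1_def A2_def power3_eq_cube)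
  have B: "32/100 \<le> B1" "32/100 \<le> B2" "B1 < 1" "B2 < 1"
    using e1(8)[of "1457/1000"] e2(8)[of "1457/1000"] B_cube_less_1 r1(1) r2(1)
    by (simp_all add: B1_def B2_def power2_eq_square power3_eq_cube)
  have C: "67/10 \<le> C1" "67/10 \<le> C2"
    using C_cube_enclosure(2)[OF _ z(1,2), of "5288/10000"] C_cube_enclosure(2)[OF _ z(3,4), of "5288/10000"]
    by (simp_all add: C1_def C2_def power2_eq_square power3_eq_cube)

  \<comment> \<open>From \<open>(w1 - w2) * (w1 + w2) = \<delta> * (x1 + x2)\<close> with crude
    bounds for both sums; \<open>dy\<close> is obtained in the same way.\<close>
  have dw: "\<delta> / 2 \<le> w1 - w2" "w1 - w2 \<le> 68/100 * \<delta>"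
  proof -
    have *: "(w1 - w2) * (w1 + w2) = \<delta> * (x1 + x2)"
      using r1(6) r2(6) by (simp add: \<delta>_def algebra_simps power2_eq_square)
    have "\<delta> * (x1 + x2) \<le> \<delta> * (68/100 * (w1 + w2))" using \<delta> x w by (intro mult_left_mono) auto
    then have "(w1 - w2) * (w1 + w2) \<le> (68/100 * \<delta>) * (w1 + w2)" unfolding * by (simp add: algebra_simps)
    then show "w1 - w2 \<le> 68/100 * \<delta>" by (rule mult_right_le_imp_le) (use w in simp)
    have "\<delta> * (1/2 * (w1 + w2)) \<le> \<delta> * (x1 + x2)" using \<delta> x w by (intro mult_left_mono) auto
    then have "(\<delta> / 2) * (w1 + w2) \<le> (w1 - w2) * (w1 + w2)" unfolding * by (simp add: algebra_simps)
    then show "\<delta> / 2 \<le> w1 - w2" by (rule mult_right_le_imp_le) (use w in simp)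
  qed
  have dy: "0 \<le> y1 - y2" "y1 - y2 \<le> 7/100 * \<delta>"
  proof -
    have *: "(y1 - y2) * (y1 + y2) = \<delta> * (x1 + x2 - 1)"
      using r1(7) r2(7) by (simp add: \<delta>_def algebra_simps power2_eq_square)
    have "\<delta> * (x1 + x2 - 1) \<le> \<delta> * (7/100 * (y1 + y2))" using \<delta> x y by (intro mult_left_mono) auto
    then have "(y1 - y2) * (y1 + y2) \<le> (7/100 * \<delta>) * (y1 + y2)" unfolding * by (simp add: algebra_simps)
    then show "y1 - y2 \<le> 7/100 * \<delta>" by (rule mult_right_le_imp_le) (use y in simp)
    have "0 \<le> (y1 - y2) * (y1 + y2)" unfolding * using \<delta> x by simp
    then show "0 \<le> y1 - y2" using y by (simp add: zero_le_mult_iff)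
  qed
  have dz: "0 \<le> z2 - z1" "z2 - z1 \<le> 68/100 * \<delta>"
    using dw dy \<delta> by (simp_all add: z1_def z2_def)
  \<comment> \<open>The dominant change: the quotient is at least
    \<open>3 / (8 * (14/25) ^ 4)\<close>, about 3.81.\<close>
  have dA: "38/10 * \<delta> \<le> A1 - A2"
  proof -
    have "3 * x1 * x2 \<le> x1\<^sup>2 + x1 * x2 + x2\<^sup>2"
      using zero_le_power2[of "x1 - x2"] by (simp add: power2_eq_square algebra_simps)
    moreover have "0 < 8 * x1 ^ 3 * x2 ^ 3" using x by simp
    ultimately have "\<delta> * (3 * x1 * x2) / (8 * x1 ^ 3 * x2 ^ 3) \<le> \<delta> * (x1\<^sup>2 + x1 * x2 + x2\<^sup>2) / (8 * x1 ^ 3 * x2 ^ 3)"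
      using \<delta> by (intro divide_right_mono mult_left_mono) auto
    also have "\<dots> = A1 - A2"
      using x unfolding A1_def A2_def A_cube_def \<delta>_def by (simp add: field_simps power2_eq_square power3_eq_cube)
    also have "\<delta> * (3 * x1 * x2) / (8 * x1 ^ 3 * x2 ^ 3) = \<delta> * 3 / (8 * (x1 * x2)\<^sup>2)"
      using x by (simp add: field_simps power2_eq_square power3_eq_cube)
    finally have "\<delta> * 3 / (8 * (x1 * x2)\<^sup>2) \<le> A1 - A2" .
    moreover have "\<delta> * 3 / (8 * (14/25 * (14/25))\<^sup>2) \<le> \<delta> * 3 / (8 * (x1 * x2)\<^sup>2)"
      using x \<delta> by (intro divide_left_mono mult_left_mono power_mono mult_mono mult_pos_pos) auto
    moreover have "38/10 * \<delta> \<le> \<delta> * 3 / (8 * (14/25 * (14/25))\<^sup>2)"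
      using \<delta> by (simp add: power2_eq_square)
    ultimately show ?thesis by linarith
  qed
  have dB: "0 \<le> B1 - B2" "B1 - B2 \<le> 6/10 * \<delta>"
  proof -
    let ?r = "sqrt (1 + 2 * x1)" and ?s = "sqrt (1 + 2 * x2)"
    have "1414/1000 \<le> ?r" by (rule real_le_rsqrt) (use x in \<open>simp add: power2_eq_square\<close>)
    moreover have "?r \<le> ?s" using x by simp
    ultimately have rs: "1414/1000 \<le> ?r" "?r \<le> ?s" .
    have sq: "?s\<^sup>2 - ?r\<^sup>2 = 2 * \<delta>" "?s\<^sup>2 = 1 + 2 * x2" using x by (simp_all add: \<delta>_def)
    have "B1 - B2 \<le> 3 * (2 * \<delta>) * ?s\<^sup>2 / (2 * (1414/1000) ^ 7)"
      unfolding B1_def B2_def B_cube_def using rs sq(1) by (intro cube_diff_bound) auto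
    also have "\<dots> \<le> 3 * (2 * \<delta>) * (53/25) / (2 * (1414/1000) ^ 7)"
      unfolding sq(2) using \<delta> x by (intro divide_right_mono mult_left_mono) auto
    also have "\<dots> \<le> 6/10 * \<delta>" using \<delta> by (simp add: power_numeral_reduce)
    finally show "B1 - B2 \<le> 6/10 * \<delta>" .
    show "0 \<le> B1 - B2"
      unfolding B1_def B2_def B_cube_def using x by (simp add: frac_le)
  qed
  have dC: "C2 \<le> C1"
    using C_cube_enclosure(1)[of z1 z2 z2 "sqrt (1/4 + z1\<^sup>2)"] z dz
    by (simp add: C1_def C2_def C_cube_def add_pos_nonneg)

  define E1 E2 where "E1 = excess x1 y1 w1" and "E2 = excess x2 y2 w2"
  define P1 P2 where "P1 = (1 - B1) * E1" and "P2 = (1 - B2) * E2"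
  have E: "E1 = w1 / 2 - x1 * z1" "E2 = w2 / 2 - x2 * z2" "0 < E1" "0 < E2"
    using pos by (simp_all add: E1_def E2_def excess_def z1_def z2_def)
  have xz: "x2 * z2 - x1 * z1 \<le> 56/100 * \<delta>" "0 \<le> x2 * z2 - x1 * z1"
  proof -
    have *: "x2 * z2 - x1 * z1 = x2 * (z2 - z1) + \<delta> * z1" by (simp add: \<delta>_def algebra_simps)
    have "x2 * (z2 - z1) \<le> 14/25 * (68/100 * \<delta>)" using dz x by (intro mult_mono) auto
    moreover have "\<delta> * z1 \<le> \<delta> * (172/1000)" using \<delta> z by (intro mult_left_mono) auto
    ultimately show "x2 * z2 - x1 * z1 \<le> 56/100 * \<delta>" unfolding * using \<delta> by linarith
    show "0 \<le> x2 * z2 - x1 * z1" unfolding * using dz x \<delta> z by simp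
  qed
  have dE: "E2 \<le> E1" using xz dw \<delta> unfolding E by linarith
  have E1: "E1 \<le> 37/100"
    using mult_mono[of "1/2" x1 "1319/10000" z1] x z w unfolding E by simp
  \<comment> \<open>\<open>P / Q\<close> is split as \<open>q * V\<close>. The geometric factor
    \<open>V\<close> may change by as much as \<open>32 * \<delta>\<close> because \<open>z\<close>
    is small, but it is damped by \<open>q \<le> 12/100\<close>, which collects the inverse
    cubes.\<close>
  define V1 V2 where "V1 = E1 / (2 * x1 * z1)" and "V2 = E2 / (2 * x2 * z2)"
  have xz0: "0 < x1 * z1" "0 < x2 * z2" using x z by simp_all
  have xz1: "1/2 * (1319/10000) \<le> x1 * z1" "1/2 * (1319/10000) \<le> x2 * z2"
    "x2 * z2 \<le> 14/25 * (172/1000)"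
    using x z by (intro mult_mono; simp)+
  note xz0 = xz0 xz1
  have V: "0 < V1" "0 < V2" using E xz0 by (simp_all add: V1_def V2_def mult.assoc)
  have dV: "V1 - V2 \<le> 32 * \<delta>"
  proof -
    have "V1 - V2 = (w1 * (x2 * z2) - w2 * (x1 * z1)) / (4 * (x1 * z1) * (x2 * z2))"
    proof -
      have "(w1 / 2 - p) / (2 * p) - (w2 / 2 - r) / (2 * r) = (w1 * r - w2 * p) / (4 * p * r)"
        if "0 < p" "0 < r" for p r
        using that by (simp add: field_simps)
      from this[of "x1 * z1" "x2 * z2"] xz0(1,2) show ?thesis
        unfolding V1_def V2_def E mult.assoc[of 2] by blast
    qed
    also have "w1 * (x2 * z2) - w2 * (x1 * z1) = (w1 - w2) * (x2 * z2) + w2 * (x2 * z2 - x1 * z1)"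
      by (simp add: algebra_simps)
    also have "\<dots> / (4 * (x1 * z1) * (x2 * z2)) \<le>
        (68/100 * \<delta> * (14/25 * (172/1000)) + 8661/10000 * (56/100 * \<delta>)) / (4 * (1/2 * (1319/10000)) * (1/2 * (1319/10000)))"
      using dw xz xz0 w \<delta> x z by (intro frac_le add_mono mult_mono mult_nonneg_nonneg add_nonneg_nonneg) auto
    also have "\<dots> \<le> 32 * \<delta>" using \<delta> by simp
    finally show ?thesis .
  qed
  define q1 q2 where "q1 = (1 - B1) / (C1 - 1)" and "q2 = (1 - B2) / (C2 - 1)"
  have q: "0 < q1" "q1 \<le> q2" "q2 \<le> 12/100"
  proof -
    show "0 < q1" using B C by (simp add: q1_def)
    show "q1 \<le> q2" unfolding q1_def q2_def using B C dB dC by (intro frac_le) auto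
    have "q2 \<le> (68/100) / (57/10)" unfolding q2_def using B C by (intro frac_le) auto
    then show "q2 \<le> 12/100" by simp
  qed
  define u1 u2 where "u1 = q1 * V1" and "u2 = q2 * V2"
  have PQ: "P1 = Q_term x1 y1 w1 * u1" "P2 = Q_term x2 y2 w2 * u2"
    using x z C unfolding P1_def P2_def Q_term_def u1_def u2_def q1_def q2_def V1_def V2_def
    by (simp_all add: C1_def[symmetric] C2_def[symmetric] z1_def[symmetric] z2_def[symmetric])
  have Q: "0 < Q_term x1 y1 w1" "0 < Q_term x2 y2 w2"
    unfolding Q_term_def using x z C
    by (simp_all add: C1_def[symmetric] C2_def[symmetric] z1_def[symmetric] z2_def[symmetric] mult.assoc)
  \<comment> \<open>Division by the positive \<open>Q\<close> gives the equation the form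
    \<open>P * (1 - u) = w * (1 - A)\<close> with \<open>u = P / Q\<close>.\<close>
  have "Q_term x1 y1 w1 * (P1 * (1 - u1)) = P1 * (Q_term x1 y1 w1 - Q_term x1 y1 w1 * u1)"
    by (simp add: algebra_simps)
  also have "\<dots> = P1 * (Q_term x1 y1 w1 - P1)" by (simp only: PQ)
  also have "\<dots> = Q_term x1 y1 w1 * (w1 * (1 - A1))"
    using eq1 unfolding concave_equation_def P_term_def
    by (simp add: A1_def B1_def E1_def P1_def mult.assoc)
  finally have "Q_term x1 y1 w1 * (P1 * (1 - u1)) = Q_term x1 y1 w1 * (w1 * (1 - A1))" .
  then have f1: "P1 * (1 - u1) = w1 * (1 - A1)" using Q by simp
  have "Q_term x2 y2 w2 * (P2 * (1 - u2)) = P2 * (Q_term x2 y2 w2 - Q_term x2 y2 w2 * u2)"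
    by (simp add: algebra_simps)
  also have "\<dots> = P2 * (Q_term x2 y2 w2 - P2)" by (simp only: PQ)
  also have "\<dots> = Q_term x2 y2 w2 * (w2 * (1 - A2))"
    using eq2 unfolding concave_equation_def P_term_def
    by (simp add: A2_def B2_def E2_def P2_def mult.assoc)
  finally have "Q_term x2 y2 w2 * (P2 * (1 - u2)) = Q_term x2 y2 w2 * (w2 * (1 - A2))" .
  then have f2: "P2 * (1 - u2) = w2 * (1 - A2)" using Q by simp
  have P: "0 < P1" "0 < P2" using B E(3,4) unfolding P1_def P2_def by simp_all
  have P1: "P1 \<le> 68/100 * (37/100)" using B E(3) E1 unfolding P1_def by (intro mult_mono) auto
  have "0 < P2 * (1 - u2)" unfolding f2 using w A by simp
  then have u2: "0 < u2" "0 < 1 - u2" using P q V by (simp_all add: u2_def zero_less_mult_iff)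

  have "w2 * (1 - A2) - w1 * (1 - A1) = w2 * (A1 - A2) - (w1 - w2) * (1 - A1)" by (simp add: algebra_simps)
  moreover have "828/1000 * (38/10 * \<delta>) \<le> w2 * (A1 - A2)" using w dA \<delta> by (intro mult_mono) auto
  moreover have "(w1 - w2) * (1 - A1) \<le> (68/100 * \<delta>) * (29/100)"
    using dw A \<delta> by (intro mult_mono) auto
  ultimately have lower: "29/10 * \<delta> \<le> w2 * (1 - A2) - w1 * (1 - A1)" using \<delta> by linarith

  have "P2 * (1 - u2) - P1 * (1 - u1) = (P2 - P1) * (1 - u2) + P1 * (u1 - u2)" by (simp add: algebra_simps)
  moreover have "(P2 - P1) * (1 - u2) \<le> 23/100 * \<delta>"
  proof -
    have "P2 - P1 = E1 * (B1 - B2) - (1 - B2) * (E1 - E2)" by (simp add: P1_def P2_def algebra_simps)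
    moreover have "E1 * (B1 - B2) \<le> 37/100 * (6/10 * \<delta>)" using E(3) E1 dB by (intro mult_mono) auto
    moreover have "0 \<le> (1 - B2) * (E1 - E2)" using B dE by simp
    ultimately have "P2 - P1 \<le> 23/100 * \<delta>" using \<delta> by linarith
    then have "(P2 - P1) * (1 - u2) \<le> (23/100 * \<delta>) * (1 - u2)" using u2 by (intro mult_right_mono) auto
    also have "\<dots> \<le> (23/100 * \<delta>) * 1" using u2 \<delta> by (intro mult_left_mono) auto
    finally show ?thesis by simp
  qed
  moreover have "P1 * (u1 - u2) \<le> \<delta>"
  proof -
    have "u1 - u2 = q2 * (V1 - V2) - (q2 - q1) * V1" by (simp add: u1_def u2_def algebra_simps)
    also have "\<dots> \<le> q2 * (V1 - V2)" using q V by simp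
    also have "\<dots> \<le> q2 * (32 * \<delta>)" using q dV by (intro mult_left_mono) auto
    also have "\<dots> \<le> 12/100 * (32 * \<delta>)" using q \<delta> by (intro mult_right_mono) auto
    finally have "P1 * (u1 - u2) \<le> P1 * (12/100 * (32 * \<delta>))" using P by (intro mult_left_mono) auto
    also have "\<dots> \<le> 68/100 * (37/100) * (12/100 * (32 * \<delta>))" using P1 \<delta> by (intro mult_right_mono) auto
    also have "\<dots> \<le> \<delta>" using \<delta> by simp
    finally show ?thesis .
  qed
  ultimately have "P2 * (1 - u2) - P1 * (1 - u1) \<le> 123/100 * \<delta>" by linarith
  then show False using lower f1 f2 \<delta> by linarith
qed

section \<open>Existence and location of the concave solution\<close>

text \<open>Rational certificates on the interval from \<open>a\<close> to \<open>b\<close> for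
  \<open>w\<close>, \<open>y\<close>, \<open>sqrt (1 + 2 * x)\<close> and
  \<open>sqrt (1/4 + (y - w)\<^sup>2)\<close>. The conditions \<open>\<rho>u < 1\<close> and the
  last one keep \<open>C_cube (y - w) - 1\<close> and \<open>excess\<close> positive, so products
  can be bounded factor by factor.\<close>

definition box :: "real \<Rightarrow> real \<Rightarrow> real \<Rightarrow> real \<Rightarrow> real \<Rightarrow> real \<Rightarrow> real \<Rightarrow> real \<Rightarrow> real \<Rightarrow> real \<Rightarrow> bool" where
  "box a b wl wu yl yu \<beta>l \<beta>u \<rho>l \<rho>u \<longleftrightarrow> 1/2 \<le> a \<and> a \<le> b \<and>
    0 \<le> wl \<and> wl\<^sup>2 \<le> 1 - b\<^sup>2 \<and> 1 - a\<^sup>2 \<le> wu\<^sup>2 \<and> 0 \<le> wu \<and>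
    0 \<le> yl \<and> yl\<^sup>2 \<le> 3/4 + b - b\<^sup>2 \<and> 3/4 + a - a\<^sup>2 \<le> yu\<^sup>2 \<and> 0 \<le> yu \<and>
    1 < \<beta>l \<and> \<beta>l\<^sup>2 \<le> 1 + 2 * a \<and> 1 + 2 * b \<le> \<beta>u\<^sup>2 \<and> 1 < \<beta>u \<and>
    0 < yl - wu \<and> 0 < \<rho>l \<and> \<rho>l\<^sup>2 \<le> 1/4 + (yl - wu)\<^sup>2 \<and> 1/4 + (yu - wl)\<^sup>2 \<le> \<rho>u\<^sup>2 \<and> 0 < \<rho>u \<and> \<rho>u < 1 \<and>
    0 < wl / 2 - b * (yu - wl)"

lemma box_enclosure:
  assumes box: "box a b wl wu yl yu \<beta>l \<beta>u \<rho>l \<rho>u"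
    and rel: "side_relations x y w" and x: "a \<le> x" "x \<le> b"
  defines "zl \<equiv> yl - wu" and "zu \<equiv> yu - wl" and "Cl \<equiv> 1 / \<rho>u ^ 3 - 1" and "Cu \<equiv> 1 / \<rho>l ^ 3 - 1"
    and "el \<equiv> wl / 2 - b * (yu - wl)" and "eu \<equiv> wu / 2 - a * (yl - wu)"
  shows "wl \<le> w" "w \<le> wu" "yl \<le> y" "y \<le> yu" "0 < zl" "zl \<le> y - w" "y - w \<le> zu"
    "1 / (2 * b) ^ 3 \<le> A_cube x" "A_cube x \<le> 1 / (2 * a) ^ 3"
    "0 < Cl" "Cl \<le> C_cube (y - w) - 1" "C_cube (y - w) - 1 \<le> Cu"
    "0 < el" "el \<le> excess x y w" "excess x y w \<le> eu"
    "(1 - 1 / \<beta>l ^ 3) * el \<le> P_term x y w" "P_term x y w \<le> (1 - 1 / \<beta>u ^ 3) * eu" "0 < (1 - 1 / \<beta>l ^ 3) * el"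
    "2 * a * zl * Cl \<le> Q_term x y w" "Q_term x y w \<le> 2 * b * zu * Cu" "0 < 2 * a * zl * Cl"
proof -
  note h = box[unfolded box_def]
  have a: "1/2 \<le> a" using h by simp
  note enc = enclosure[OF rel a x]
  show w: "wl \<le> w" "w \<le> wu" and y: "yl \<le> y" "y \<le> yu" using h by (auto intro: enc)
  show zl: "0 < zl" using h by (simp add: zl_def)
  show z: "zl \<le> y - w" "y - w \<le> zu" using w y by (simp_all add: zl_def zu_def)
  show "1 / (2 * b) ^ 3 \<le> A_cube x" "A_cube x \<le> 1 / (2 * a) ^ 3" by (fact enc)+
  have B: "1 / \<beta>u ^ 3 \<le> B_cube x" "B_cube x \<le> 1 / \<beta>l ^ 3" using h by (auto intro: enc)
  have \<beta>: "0 < 1 - 1 / \<beta>l ^ 3" using h cube_less_1_iff[of \<beta>l] by simp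
  have "\<rho>u ^ 3 < 1 ^ 3" using h by (intro power_strict_mono) auto
  moreover have "0 < \<rho>u ^ 3" using h by simp
  ultimately show Cl: "0 < Cl" by (simp only: Cl_def diff_gt_0_iff_gt less_divide_eq_1_pos power_one)
  show C: "Cl \<le> C_cube (y - w) - 1" "C_cube (y - w) - 1 \<le> Cu"
    using C_cube_enclosure[OF less_imp_le[OF zl] z] h by (simp_all add: Cl_def Cu_def zl_def zu_def)
  show el: "0 < el" using h by (simp add: el_def)
  have "x * (y - w) \<le> b * zu" "a * zl \<le> x * (y - w)"
    using a x z zl by (auto intro!: mult_mono)
  then show e: "el \<le> excess x y w" "excess x y w \<le> eu"
    using w by (simp_all add: excess_def el_def eu_def zl_def zu_def)
  show "(1 - 1 / \<beta>l ^ 3) * el \<le> P_term x y w" "P_term x y w \<le> (1 - 1 / \<beta>u ^ 3) * eu"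
    unfolding P_term_def using B \<beta> el e by (auto intro!: mult_mono)
  show "0 < (1 - 1 / \<beta>l ^ 3) * el" using \<beta> el by simp
  show "2 * a * zl * Cl \<le> Q_term x y w" "Q_term x y w \<le> 2 * b * zu * Cu"
    unfolding Q_term_def using a x zl z Cl C by (auto intro!: mult_mono)
  show "0 < 2 * a * zl * Cl" using a zl Cl by simp
qed

text \<open>Neighbouring multiples of \<open>1 / 10^8\<close> around the root; over this bracket the
  enclosures of the mass ratios have width about \<open>3 / 10^8\<close>.\<close>

definition root_left :: real where "root_left = 54020915 / 10^8"
definition root_right :: real where "root_right = 54020916 / 10^8"

text \<open>A one-point box: a box over the whole bracket could not show different signs at its two
  ends.\<close>

lemma box_left: "box root_left root_left
    (841530792221 / 10^12) (841530792222 / 10^12) (999191285118 / 10^12) (999191285119 / 10^12)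
    (1442365522327 / 10^12) (1442365522328 / 10^12) (524267900047 / 10^12) (524267900049 / 10^12)"
  by (simp add: box_def root_left_def power2_eq_square)

lemma box_right: "box root_right root_right
    (841530785801 / 10^12) (841530785802 / 10^12) (999191284715 / 10^12) (999191284716 / 10^12)
    (1442365529260 / 10^12) (1442365529261 / 10^12) (524267901856 / 10^12) (524267901858 / 10^12)"
  by (simp add: box_def root_right_def power2_eq_square)

lemma box_root: "box root_left root_right
    (841530785801 / 10^12) (841530792222 / 10^12) (999191284715 / 10^12) (999191285119 / 10^12)
    (1442365522327 / 10^12) (1442365529261 / 10^12) (524267899926 / 10^12) (524267901979 / 10^12)"
  by (simp add: box_def root_left_def root_right_def power2_eq_square)

lemma side_relations_sqrt:
  assumes "0 < x" "x < 1"
  shows "side_relations x (sqrt (3/4 + x - x\<^sup>2)) (sqrt (1 - x\<^sup>2))"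
proof -
  have "x\<^sup>2 < x" using assms by (simp add: power2_eq_square)
  then have "0 < 1 - x\<^sup>2" "0 < 3/4 + x - x\<^sup>2" using assms by linarith+
  then show ?thesis using assms
    by (simp add: side_relations_def) (simp add: power2_eq_square algebra_simps)
qed

lemma concave_solution:
  obtains x y w where "side_relations x y w" "root_left \<le> x" "x \<le> root_right" "concave_equation x y w"
proof -
  define Y where "Y x = sqrt (3/4 + x - x\<^sup>2)" for x :: real
  define W where "W x = sqrt (1 - x\<^sup>2)" for x :: real
  define F where "F x = P_term x (Y x) (W x) * (Q_term x (Y x) (W x) - P_term x (Y x) (W x))
    - Q_term x (Y x) (W x) * W x * (1 - A_cube x)" for x
  have rel: "side_relations x (Y x) (W x)" if "root_left \<le> x" "x \<le> root_right" for x
    using that side_relations_sqrt[of x] by (simp add: Y_def W_def root_left_def root_right_def)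
  have lr: "root_left \<le> root_right" by (simp add: root_left_def root_right_def)
  \<comment> \<open>For positive \<open>Q\<close> the sign is that of
    \<open>P - P\<^sup>2 / Q - w * v\<close>, estimated term by term.\<close>
  have sign: "0 < P * (Q - P) - Q * w * v" if "0 < Q" "0 \<le> Pl" "Pl \<le> P" "P \<le> Pu" "0 < Ql" "Ql \<le> Q" "w * v \<le> m" "m < Pl - Pu\<^sup>2 / Ql"
    for P Q w v Pl Pu Ql m :: real
  proof -
    have "P\<^sup>2 / Q \<le> Pu\<^sup>2 / Ql" using that by (intro frac_le power_mono) auto
    then have "w * v < P - P\<^sup>2 / Q" using that by linarith
    then have "Q * (w * v) < Q * (P - P\<^sup>2 / Q)" using that by simp
    also have "\<dots> = P * (Q - P)" using that by (simp add: right_diff_distrib power2_eq_square)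
    finally show ?thesis by simp
  qed
  have sign': "P * (Q - P) - Q * w * v < 0" if "0 < Q" "0 \<le> Pl" "Pl \<le> P" "P \<le> Pu" "Q \<le> Qu" "m \<le> w * v" "Pu - Pl\<^sup>2 / Qu < m"
    for P Q w v Pl Pu Qu m :: real
  proof -
    have "Pl\<^sup>2 / Qu \<le> P\<^sup>2 / Q" using that by (intro frac_le power_mono) auto
    then have "P - P\<^sup>2 / Q < w * v" using that by linarith
    then have "Q * (P - P\<^sup>2 / Q) < Q * (w * v)" using that by simp
    also have "Q * (P - P\<^sup>2 / Q) = P * (Q - P)" using that by (simp add: right_diff_distrib power2_eq_square)
    finally show ?thesis by simp
  qed
  have "0 \<le> F root_left"
  proof -
    note e = box_enclosure[OF box_left rel[OF order_refl lr] order_refl order_refl]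
    have q: "0 < Q_term root_left (Y root_left) (W root_left)" using e(19,21) by linarith
    have m: "W root_left * (1 - A_cube root_left) \<le> 841530792222 / 10^12 * (1 - 1 / (2 * root_left) ^ 3)"
      using e(2,8) by (intro mult_mono) (simp_all add: root_left_def power3_eq_cube A_cube_def)
    show ?thesis unfolding F_def
      by (rule less_imp_le[OF sign[OF q less_imp_le[OF e(18)] e(16,17,21,19) m]])
        (simp add: root_left_def power3_eq_cube power2_eq_square)
  qed
  moreover have "F root_right \<le> 0"
  proof -
    note e = box_enclosure[OF box_right rel[OF lr order_refl] order_refl order_refl]
    have q: "0 < Q_term root_right (Y root_right) (W root_right)" using e(19,21) by linarith
    have m: "841530785801 / 10^12 * (1 - 1 / (2 * root_right) ^ 3) \<le> W root_right * (1 - A_cube root_right)"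
      using e(1,9) by (intro mult_mono) (simp_all add: root_right_def power3_eq_cube A_cube_def)
    show ?thesis unfolding F_def
      by (rule less_imp_le[OF sign'[OF q less_imp_le[OF e(18)] e(16,17,20) m]])
        (simp add: root_right_def power3_eq_cube power2_eq_square)
  qed
  moreover have "continuous_on {root_left..root_right} F"
  proof -
    have "1 + 2 * x > 0" "x \<noteq> 0" if "x \<in> {root_left..root_right}" for x
      using that by (auto simp: root_left_def)
    moreover have "1 / 4 + v\<^sup>2 > 0" for v :: real by (simp add: add_pos_nonneg)
    ultimately show ?thesis
      unfolding F_def P_term_def Q_term_def excess_def A_cube_def B_cube_def C_cube_def Y_def W_def
      by (intro continuous_intros) (auto simp: less_imp_neq[symmetric])
  qed
  ultimately obtain x where x: "root_left \<le> x" "x \<le> root_right" "F x = 0"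
    using IVT2'[of F root_right 0 root_left] lr by auto
  then have "concave_equation x (Y x) (W x)" by (simp add: concave_equation_def F_def)
  with x rel that show ?thesis by blast
qed

text \<open>The masses are determined by \<open>a : b : c = mass_ratio_1 : 1 : mass_ratio_5\<close>.\<close>

definition mass_ratio_1 :: "real \<Rightarrow> real \<Rightarrow> real \<Rightarrow> real" where
  "mass_ratio_1 x y w = 2 * x * P_term x y w / Q_term x y w"

definition mass_ratio_5 :: "real \<Rightarrow> real \<Rightarrow> real \<Rightarrow> real" where
  "mass_ratio_5 x y w = (1 - A_cube x) * (2 * x * y) / ((C_cube (y - w) - 1) * excess x y w)"

text \<open>Converse of the elimination: the two ratios are those demanded by the first and second
  relations, and with them the third becomes the concave equation.\<close>

lemma balanced_concave:
  assumes rel: "side_relations x y w" and pos: "0 < y - w" "0 < excess x y w"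
    and eq: "concave_equation x y w"
  shows "balanced x y (y - w) (mass_ratio_1 x y w * b) b (mass_ratio_5 x y w * b)"
proof -
  define z A B C e P Q where "z = y - w" and "A = A_cube x" and "B = B_cube x" and "C = C_cube z"
    and "e = excess x y w" and "P = P_term x y w" and "Q = Q_term x y w"
  note rb = side_relations_bounds[OF rel]
  have C: "1 < C" using concave_branch_C_cube[OF rel] by (simp add: C_def z_def)
  have z: "0 < z" using pos by (simp add: z_def)
  have e: "0 < e" using pos by (simp add: e_def)
  have P: "P = (1 - B) * e" by (simp add: P_def P_term_def B_def e_def)
  have Q: "Q = 2 * x * z * (C - 1)" by (simp add: Q_def Q_term_def C_def z_def)
  have PQ: "P * (Q - P) = Q * w * (1 - A)" using eq by (simp add: concave_equation_def P_def Q_def A_def)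
  have E: "z * (x + 1/2) - y / 2 = - e" "z * (x - 1/2) + y / 2 = 2 * x * z + e"
    by (simp_all add: e_def z_def excess_def field_simps)
  have a: "mass_ratio_1 x y w * (C - 1) * z = P" "mass_ratio_1 x y w * Q = 2 * x * P"
    using rb(1) z C unfolding mass_ratio_1_def P_def[symmetric] Q_def[symmetric] Q by simp_all
  have c: "mass_ratio_5 x y w * (C - 1) * e = (1 - A) * (2 * x * y)"
    using C e unfolding mass_ratio_5_def by (simp add: A_def C_def z_def e_def)
  define r where "r = mass_ratio_1 x y w"
  have "r * (Q - P) * Q = 2 * x * w * (1 - A) * Q"
  proof -
    have "r * (Q - P) * Q = r * Q * (Q - P)" by simp
    also have "\<dots> = 2 * x * (P * (Q - P))" unfolding a(2)[folded r_def] by simp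
    finally show ?thesis unfolding PQ by (simp add: mult_ac)
  qed
  then have d: "r * (Q - P) = 2 * x * w * (1 - A)"
    by (rule mult_right_cancel[THEN iffD1, rotated]) (use rb(1) z C in \<open>simp add: Q\<close>)
  have "r * (1 - C) * (2 * x * z + e) + r * (B - C) * (- e) = - (r * (Q - P))"
    by (simp add: P Q algebra_simps)
  then have "r * b * (1 - C) * (2 * x * z + e) + r * b * (B - C) * (- e) = b * (1 - A) * (2 * x * (z - y))"
  proof -
    have "r * b * (1 - C) * (2 * x * z + e) + r * b * (B - C) * (- e)
        = b * (r * (1 - C) * (2 * x * z + e) + r * (B - C) * (- e))" by (simp add: algebra_simps)
    also have "\<dots> = b * (- (2 * x * w * (1 - A)))"
      using \<open>r * (1 - C) * (2 * x * z + e) + r * (B - C) * (- e) = - (r * (Q - P))\<close> d by simp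
    finally show ?thesis by (simp add: z_def algebra_simps)
  qed
  moreover have "r * b * (1 - C) * z = b * (1 - B) * (- e)"
  proof -
    have "r * b * (1 - C) * z = - b * (r * (C - 1) * z)" by (simp add: algebra_simps)
    then show ?thesis unfolding a(1)[folded r_def] P by simp
  qed
  moreover have "b * (1 - A) * (2 * x * y) = mass_ratio_5 x y w * b * (1 - C) * (- e)"
  proof -
    have "mass_ratio_5 x y w * b * (1 - C) * (- e) = b * (mass_ratio_5 x y w * (C - 1) * e)" by (simp add: algebra_simps)
    then show ?thesis unfolding c by simp
  qed
  ultimately show ?thesis
    unfolding balanced_def z_def[symmetric] A_def[symmetric] B_def[symmetric] C_def[symmetric] E r_def by simp
qed

lemma mass_ratio_enclosure:
  assumes box: "box a b wl wu yl yu \<beta>l \<beta>u \<rho>l \<rho>u"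
    and rel: "side_relations x y w" and x: "a \<le> x" "x \<le> b" and A: "1/2 < a"
  defines "zl \<equiv> yl - wu" and "zu \<equiv> yu - wl" and "Cl \<equiv> 1 / \<rho>u ^ 3 - 1" and "Cu \<equiv> 1 / \<rho>l ^ 3 - 1"
    and "el \<equiv> wl / 2 - b * (yu - wl)" and "eu \<equiv> wu / 2 - a * (yl - wu)"
  shows "2 * a * ((1 - 1 / \<beta>l ^ 3) * el) / (2 * b * zu * Cu) \<le> mass_ratio_1 x y w"
    and "mass_ratio_1 x y w \<le> 2 * b * ((1 - 1 / \<beta>u ^ 3) * eu) / (2 * a * zl * Cl)"
    and "(1 - 1 / (2 * a) ^ 3) * (2 * a * yl) / (Cu * eu) \<le> mass_ratio_5 x y w"
    and "mass_ratio_5 x y w \<le> (1 - 1 / (2 * b) ^ 3) * (2 * b * yu) / (Cl * el)"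
proof -
  note e = box_enclosure[OF box rel x, folded zl_def zu_def Cl_def Cu_def el_def eu_def]
  have pos: "0 < P_term x y w" "0 < Q_term x y w" "0 < excess x y w" "0 < C_cube (y - w) - 1" "0 < a" "0 < b"
    using e(10,11,13,14,16,18,19,21) A x by linarith+
  note P = e(16-18) and Q = e(19-21)
  show "2 * a * ((1 - 1 / \<beta>l ^ 3) * el) / (2 * b * zu * Cu) \<le> mass_ratio_1 x y w"
    unfolding mass_ratio_1_def using x pos
    by (intro frac_le mult_mono[OF _ P(1)] Q) (use P in auto)
  show "mass_ratio_1 x y w \<le> 2 * b * ((1 - 1 / \<beta>u ^ 3) * eu) / (2 * a * zl * Cl)"
    unfolding mass_ratio_1_def using x pos P
    by (intro frac_le mult_mono[OF _ P(2)] Q) auto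
  have A1: "0 \<le> 1 - 1 / (2 * a) ^ 3" using cube_less_1_iff[of "2 * a"] A by simp
  have y0: "0 < y" "0 \<le> yl" using side_relations_bounds[OF rel] box by (simp_all add: box_def)
  have "A_cube x \<le> 1" using A1 e(9) by linarith
  have b1: "0 \<le> 1 - 1 / (2 * b) ^ 3" using cube_less_1_iff[of "2 * b"] A x by simp
  show "(1 - 1 / (2 * a) ^ 3) * (2 * a * yl) / (Cu * eu) \<le> mass_ratio_5 x y w"
    unfolding mass_ratio_5_def
  proof (rule frac_le)
    show "(1 - 1 / (2 * a) ^ 3) * (2 * a * yl) \<le> (1 - A_cube x) * (2 * x * y)"
      using x A e(3,9) A1 y0 pos \<open>A_cube x \<le> 1\<close> by (intro mult_mono) auto
    show "(C_cube (y - w) - 1) * excess x y w \<le> Cu * eu"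
      using e(12,15) pos by (intro mult_mono) auto
  qed (use pos y0 \<open>A_cube x \<le> 1\<close> x in auto)
  show "mass_ratio_5 x y w \<le> (1 - 1 / (2 * b) ^ 3) * (2 * b * yu) / (Cl * el)"
    unfolding mass_ratio_5_def
  proof (rule frac_le)
    show "(1 - A_cube x) * (2 * x * y) \<le> (1 - 1 / (2 * b) ^ 3) * (2 * b * yu)"
      using x e(4,8) y0 pos b1 by (intro mult_mono) auto
    then show "0 \<le> (1 - 1 / (2 * b) ^ 3) * (2 * b * yu)"
      using pos y0 x \<open>A_cube x \<le> 1\<close> by (intro order_trans[OF _ \<open>_ \<le> (1 - 1 / (2 * b) ^ 3) * (2 * b * yu)\<close>]) auto
    show "Cl * el \<le> (C_cube (y - w) - 1) * excess x y w"
      using e(10,11,13,14) pos by (intro mult_mono) auto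
    show "0 < Cl * el" using e(10,13) by simp
  qed
qed

lemma concave_mass_bounds:
  assumes rel: "side_relations x y w" and x: "root_left \<le> x" "x \<le> root_right"
  shows "2389410220 / 10^10 \<le> mass_ratio_1 x y w" "mass_ratio_1 x y w \<le> 2389410534 / 10^10"
    and "1121548659 / 10^10 \<le> mass_ratio_5 x y w" "mass_ratio_5 x y w \<le> 1121548974 / 10^10"
proof -
  have "1/2 < root_left" by (simp add: root_left_def)
  note e = mass_ratio_enclosure[OF box_root rel x this]
  show "2389410220 / 10^10 \<le> mass_ratio_1 x y w"
    by (rule order_trans[OF _ e(1)]) (simp add: root_left_def root_right_def power3_eq_cube)
  show "mass_ratio_1 x y w \<le> 2389410534 / 10^10"
    by (rule order_trans[OF e(2)]) (simp add: root_left_def root_right_def power3_eq_cube)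
  show "1121548659 / 10^10 \<le> mass_ratio_5 x y w"
    by (rule order_trans[OF _ e(3)]) (simp add: root_left_def root_right_def power3_eq_cube)
  show "mass_ratio_5 x y w \<le> 1121548974 / 10^10"
    by (rule order_trans[OF e(4)]) (simp add: root_left_def root_right_def power3_eq_cube)
qed

lemma concave_branch_determined:
  assumes rel: "side_relations x y w" "side_relations x' y' w'"
    and x: "1/2 < x" "x \<le> 14/25" "1/2 < x'" "x' \<le> 14/25"
    and eq: "concave_equation x y w" "concave_equation x' y' w'"
    and pos: "0 < excess x y w" "0 < excess x' y' w'"
  shows "x = x'" "y = y'" "w = w'"
proof -
  show "x = x'"
  proof (rule linorder_cases[of x x'])
    assume "x < x'"
    then show ?thesis using concave_branch_injective[OF rel x(1) _ x(4) eq pos] by blast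
  next
    assume "x' < x"
    then show ?thesis using concave_branch_injective[OF rel(2,1) x(3) _ x(2) eq(2,1) pos(2,1)] by blast
  qed
  then show "y = y'" "w = w'"
    using side_relations_bounds[OF rel(1)] side_relations_bounds[OF rel(2)]
    by (auto intro: power2_eq_imp_eq)
qed

text \<open>The first two relations are linear in the masses, and the coefficients
  \<open>(C - 1) * z\<close> of \<open>a\<close> and \<open>(C - 1) * e\<close> of \<open>c\<close>
  are positive on this branch.\<close>

lemma concave_branch_mass_ratios:
  assumes rel: "side_relations x y w" and pos: "0 < y - w" "0 < excess x y w"
    and bal: "balanced x y (y - w) a b c"
  shows "a = mass_ratio_1 x y w * b" "c = mass_ratio_5 x y w * b"
proof -
  define z C e where "z = y - w" and "C = C_cube z" and "e = excess x y w"
  note rb = side_relations_bounds[OF rel]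
  have C: "1 < C" using concave_branch_C_cube[OF rel] by (simp add: C_def z_def)
  have ze: "0 < z" "0 < e" using pos by (simp_all add: z_def e_def)
  have E: "z * (x + 1/2) - y / 2 = - e" by (simp add: e_def z_def excess_def field_simps)
  note f = bal[unfolded balanced_def, folded z_def, folded C_def, unfolded E]
  have cancel: "u = n / k * v" if "u * k = n * v" "0 < k" for u k n v :: real
    using that by (simp add: field_simps)
  have "mass_ratio_1 x y w = (1 - B_cube x) * e / ((C - 1) * z)"
    using rb(1) unfolding mass_ratio_1_def P_term_def Q_term_def by (simp add: z_def C_def e_def)
  moreover have "a * ((C - 1) * z) = (1 - B_cube x) * e * b" using f by (simp add: algebra_simps)
  ultimately show "a = mass_ratio_1 x y w * b"
    using C ze by (simp only: cancel mult_pos_pos diff_gt_0_iff_gt)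
  have "mass_ratio_5 x y w = (1 - A_cube x) * (2 * x * y) / ((C - 1) * e)"
    unfolding mass_ratio_5_def by (simp add: z_def C_def e_def)
  moreover have "c * ((C - 1) * e) = (1 - A_cube x) * (2 * x * y) * b" using f by (simp add: algebra_simps)
  ultimately show "c = mass_ratio_5 x y w * b"
    using C ze by (simp only: cancel mult_pos_pos diff_gt_0_iff_gt)
qed

section \<open>The pentagons of the two solutions\<close>

text \<open>Two distinct sides are adjacent or two steps apart. Adjacent ones meet only in their
  common vertex by noncollinearity, so five disjointness conditions remain.\<close>

lemma pentagonI:
  assumes nc: "\<And>i. \<not> collinear {p $ i, p $ (i + 1), p $ (i + 2)}"
    and disj: "\<And>i. side p i \<inter> side p (i + 2) = {}"
  shows "pentagon p"
  unfolding pentagon_def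
proof (intro conjI allI impI)
  have ne: "p $ i \<noteq> p $ (i + 1)" "p $ i \<noteq> p $ (i + 2)" for i
    using nc[of i] by (auto simp: insert_commute)
  have apart: "j = i + 1 \<or> i = j + 1 \<or> j = i + 2 \<or> i = j + 2" if "i \<noteq> j" for i j :: 5
  proof -
    have "\<forall>i j::5. i \<noteq> j \<longrightarrow> j = i + 1 \<or> i = j + 1 \<or> j = i + 2 \<or> i = j + 2"
      unfolding forall_5 by (simp add: mod_5)
    then show ?thesis using that by blast
  qed
  fix i j :: 5
  assume "i \<noteq> j"
  show "p $ i \<noteq> p $ j" using apart[OF \<open>i \<noteq> j\<close>] ne by metis
  have adj: "side p i \<inter> side p (i + 1) = {p $ (i + 1)}" for i
    using Int_closed_segment[of "p $ (i + 1)" "p $ i" "p $ (i + 2)"] nc[of i]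
    by (simp add: side_def add.assoc)
  have "side p i \<inter> side p j \<subseteq> {p $ i, p $ (i + 1)} \<inter> {p $ j, p $ (j + 1)}" if "j = i + 1 \<or> j = i + 2" for i j
    using that adj[of i] disj[of i] by auto
  then show "side p i \<inter> side p j \<subseteq> {p $ i, p $ (i + 1)} \<inter> {p $ j, p $ (j + 1)}"
    using apart[OF \<open>i \<noteq> j\<close>] by (metis inf.commute)
next
  fix i show "\<not> collinear {p $ i, p $ (i + 1), p $ (i + 2)}" by (rule nc)
qed

lemma collinear_2_cross:
  fixes a b c :: "real^2"
  assumes "collinear {a, b, c}"
  shows "(b $ 1 - a $ 1) * (c $ 2 - a $ 2) = (b $ 2 - a $ 2) * (c $ 1 - a $ 1)"
proof -
  obtain u where "\<forall>x\<in>{a, b, c}. \<forall>y\<in>{a, b, c}. \<exists>k. x - y = k *\<^sub>R u"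
    using assms unfolding collinear_def by blast
  then obtain k l where "b - a = k *\<^sub>R u" "c - a = l *\<^sub>R u" by blast
  then have "b $ n - a $ n = k * u $ n" "c $ n - a $ n = l * u $ n" for n
    by (simp_all add: vec_eq_iff)
  then show ?thesis by simp
qed

lemma segment_component_le:
  fixes a b v :: "real^2"
  assumes "v \<in> closed_segment a b" "a $ k \<le> c" "b $ k \<le> c"
  shows "v $ k \<le> c"
proof -
  obtain u where u: "0 \<le> u" "u \<le> 1" "v = (1 - u) *\<^sub>R a + u *\<^sub>R b"
    using assms(1) unfolding in_segment by blast
  have "(1 - u) * a $ k + u * b $ k \<le> c" using assms u by (intro convex_bound_le) auto
  then show ?thesis by (simp add: u)
qed

lemma segment_component_gt:
  fixes a b v :: "real^2"
  assumes "v \<in> closed_segment a b" "c < a $ k" "c < b $ k"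
  shows "c < v $ k"
proof -
  obtain u where u: "0 \<le> u" "u \<le> 1" "v = (1 - u) *\<^sub>R a + u *\<^sub>R b"
    using assms(1) unfolding in_segment by blast
  have "- ((1 - u) * a $ k) - u * b $ k < - c"
    using convex_bound_lt[of "- (a $ k)" "- c" "- (b $ k)" "1 - u" u] assms u by simp
  then show ?thesis by (simp add: u)
qed

text \<open>Separation by a line parallel to a coordinate axis, which may touch the first
  segment.\<close>

lemma disjoint_segments:
  fixes a b a' b' :: "real^2"
  assumes "a $ k \<le> c" "b $ k \<le> c" "c < a' $ k" "c < b' $ k"
  shows "closed_segment a b \<inter> closed_segment a' b' = {}"
proof -
  have "v \<notin> closed_segment a' b'" if "v \<in> closed_segment a b" for v
    using segment_component_le[OF that assms(1,2)] segment_component_gt[of v a' b' c k] assms by auto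
  then show ?thesis by blast
qed

text \<open>The base is separated from both roof sides by the line at height 0, which uses
  \<open>0 < z\<close>; the remaining nonadjacent pairs are separated by vertical lines.\<close>

lemma equilateral_house:
  assumes rel: "side_relations x y w" and z: "z = y + w \<or> z = y - w" and x: "1/2 < x" and z0: "0 < z"
  shows "equilateral_pentagon (house x y z)" "\<And>i. dist (house x y z $ i) (house x y z $ (i + 1)) = 1"
    "has_symmetry_axis (house x y z)"
proof -
  let ?p = "house x y z"
  note rb = side_relations_bounds[OF rel]
  \<comment> \<open>Up to sign, twice the area of the triangle of components 2, 3, 4, and by
    symmetry of 4, 0, 1.\<close>
  have D: "0 < z * (x - 1/2) + y / 2" using x z0 rb by (simp add: add_pos_pos)
  have zy: "z \<noteq> y" using z rb by auto
  have "\<forall>i. \<not> collinear {?p $ i, ?p $ (i + 1), ?p $ (i + 2)}"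
    unfolding forall_5
  proof (intro conjI notI)
    assume "collinear {?p $ 0, ?p $ (0 + 1), ?p $ (0 + 2)}"
    from collinear_2_cross[OF this] show False using rb by (simp add: house_nth algebra_simps)
  next
    assume "collinear {?p $ 1, ?p $ (1 + 1), ?p $ (1 + 2)}"
    from collinear_2_cross[OF this] show False using rb by (simp add: house_nth)
  next
    assume "collinear {?p $ 2, ?p $ (2 + 1), ?p $ (2 + 2)}"
    from collinear_2_cross[OF this] show False using D by (simp add: house_nth algebra_simps)
  next
    assume "collinear {?p $ 3, ?p $ (3 + 1), ?p $ (3 + 2)}"
    from collinear_2_cross[OF this] show False using rb zy by (simp add: house_nth mod_5)
  next
    assume "collinear {?p $ 4, ?p $ (4 + 1), ?p $ (4 + 2)}"
    from collinear_2_cross[OF this] show False using D by (simp add: house_nth mod_5 algebra_simps)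
  qed
  moreover have "\<forall>i. side ?p i \<inter> side ?p (i + 2) = {}"
    unfolding forall_5
  proof (intro conjI)
    \<comment> \<open>The separating abscissa is that of the rightmost end of the left wall; it is
      negative, whereas the other side has positive abscissas.\<close>
    show "side ?p 0 \<inter> side ?p (0 + 2) = {}"
      unfolding side_def Int_commute[of "closed_segment (?p $ 0) _"]
      by (rule disjoint_segments[of _ 1 "max (- 1/2) (- x)"]) (use rb in \<open>simp_all add: house_nth\<close>)
    show "side ?p 1 \<inter> side ?p (1 + 2) = {}"
      unfolding side_def by (rule disjoint_segments[of _ 2 0]) (use rb z0 in \<open>simp_all add: house_nth\<close>)
    show "side ?p 2 \<inter> side ?p (2 + 2) = {}"
      unfolding side_def
      by (rule disjoint_segments[of _ 1 "max (- 1/2) (- x)"]) (use rb in \<open>simp_all add: house_nth mod_5\<close>)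
    show "side ?p 3 \<inter> side ?p (3 + 2) = {}"
      unfolding side_def by (rule disjoint_segments[of _ 1 0]) (use rb in \<open>simp_all add: house_nth mod_5\<close>)
    show "side ?p 4 \<inter> side ?p (4 + 2) = {}"
      unfolding side_def Int_commute[of "closed_segment (?p $ 4) _"]
      by (rule disjoint_segments[of _ 2 0]) (use rb z0 in \<open>simp_all add: house_nth mod_5\<close>)
  qed
  ultimately have pent: "pentagon ?p" by (intro pentagonI) auto
  have "\<forall>i. dist (?p $ i) (?p $ (i + 1)) = 1"
    unfolding forall_5 using dist_house[OF rel z] by (simp add: mod_5)
  then show one: "dist (?p $ i) (?p $ (i + 1)) = 1" for i by blast
  show "equilateral_pentagon ?p" using pent one by (simp add: equilateral_pentagon_def)
  define u :: "real^2" where "u = vector [0, 1]"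
  have u: "norm u = 1" by (simp add: u_def norm_eq_sqrt_inner inner_2)
  have R: "reflection 0 u (?p $ 0) = ?p $ 3" "reflection 0 u (?p $ 1) = ?p $ 2" "reflection 0 u (?p $ 2) = ?p $ 1"
    "reflection 0 u (?p $ 3) = ?p $ 0" "reflection 0 u (?p $ 4) = ?p $ 4"
    by (simp_all add: vec_eq_iff forall_2 reflection_def inner_2 u_def house_nth)
  have "reflection 0 u ` (\<Union>i. side ?p i) = (\<Union>i. side ?p i)"
    unfolding image_UN UNIV_5 side_def
    by (simp add: reflection_closed_segment R mod_5 closed_segment_commute Un_ac)
  then show "has_symmetry_axis ?p" unfolding has_symmetry_axis_def using u by blast
qed

text \<open>\<open>2 * x\<close> satisfies the golden ratio equation
  \<open>t\<^sup>2 = t + 1\<close>; all diagonals equal it, and every power of \<open>x\<close>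
  reduces to a linear expression.\<close>

lemma golden_house:
  assumes rel: "side_relations x y w" and x: "4 * x\<^sup>2 - 2 * x - 1 = 0"
  shows "1/2 < x" "y = 2 * x * w" "y + w = 2 * x * y" "sqrt (1 + 2 * x) = 2 * x"
    "sqrt (1 / 4 + (y + w)\<^sup>2) = 2 * x" "(y + w) * (x + 1/2) - y / 2 = y + w" "(y + w) * (x - 1/2) + y / 2 = y"
proof -
  note rb = side_relations_bounds[OF rel]
  have x2: "4 * x\<^sup>2 = 2 * x + 1" and x2': "x\<^sup>2 = x / 2 + 1/4" using x by simp_all
  show "1/2 < x"
  proof (rule ccontr)
    assume "\<not> 1/2 < x"
    then have "x\<^sup>2 \<le> (1/2)\<^sup>2" using rb by (intro power_mono) auto
    then show False using x2 rb by (simp add: power2_eq_square)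
  qed
  have "y\<^sup>2 = (2 * x * w)\<^sup>2"
  proof -
    have "(2 * x * w)\<^sup>2 = 4 * x\<^sup>2 * (1 - x\<^sup>2)" using rb(6) by (simp add: power_mult_distrib)
    also have "\<dots> = (2 * x + 1) * (3/4 - x / 2)" unfolding x2 by (simp add: x2')
    also have "\<dots> = 3/4 + x - x\<^sup>2" by (simp add: algebra_simps power2_eq_square)
    finally show ?thesis using rb(7) by simp
  qed
  then show y: "y = 2 * x * w" by (rule power2_eq_imp_eq) (use rb(1,3,4) in auto)
  have z: "y + w = 4 * x\<^sup>2 * w" unfolding x2 y by (simp add: algebra_simps)
  then show zy: "y + w = 2 * x * y" unfolding y by (simp add: power2_eq_square)
  show "sqrt (1 + 2 * x) = 2 * x"
    using rb(1) x2 by (intro real_sqrt_unique) (simp_all add: power_mult_distrib)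
  have "(y + w)\<^sup>2 = 4 * x\<^sup>2 * y\<^sup>2" unfolding zy by (simp add: power_mult_distrib)
  also have "\<dots> = (2 * x + 1) * (1/2 + x / 2)" unfolding x2 rb(7) by (simp add: x2')
  also have "\<dots> = (2 * x)\<^sup>2 - 1/4"
    by (simp add: x2' power_mult_distrib algebra_simps flip: power2_eq_square)
  finally have "1 / 4 + (y + w)\<^sup>2 = (2 * x)\<^sup>2" by simp
  then show "sqrt (1 / 4 + (y + w)\<^sup>2) = 2 * x" using rb(1) by (intro real_sqrt_unique) simp_all
  have "(y + w) * (x - 1/2) + y / 2 = y + w * (2 * x\<^sup>2 - x - 1/2)"
    unfolding y by (simp add: field_simps power2_eq_square)
  then show D: "(y + w) * (x - 1/2) + y / 2 = y" by (simp add: x2')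
  have "(y + w) * (x + 1/2) - y / 2 = ((y + w) * (x - 1/2) + y / 2) + w"
    by (simp add: field_simps)
  then show "(y + w) * (x + 1/2) - y / 2 = y + w" unfolding D .
qed

text \<open>By the law of cosines each angle depends only on the side length and the diagonal
  opposite it.\<close>

lemma regular_pentagonI:
  assumes "equilateral_pentagon p" and one: "\<And>i. dist (p $ i) (p $ (i + 1)) = 1"
    and diag: "\<And>i. dist (p $ (i - 1)) (p $ (i + 1)) = d"
  shows "regular_pentagon p"
proof -
  have "angle (p $ (i - 1)) (p $ i) (p $ (i + 1)) = arccos ((2 - d\<^sup>2) / 2)" for i
  proof -
    let ?a = "p $ (i - 1) - p $ i" and ?c = "p $ (i + 1) - p $ i"
    have "norm ?a = 1" "norm ?c = 1" "norm (?a - ?c) = d"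
      using one[of "i - 1"] one[of i] diag[of i] by (simp_all add: dist_norm norm_minus_commute)
    note n = this
    have ac: "?a \<bullet> ?c = (2 - d\<^sup>2) / 2" using dot_norm_neg[of ?a ?c] unfolding n by simp
    show ?thesis unfolding angle_def n ac by simp
  qed
  then show ?thesis using assms(1) unfolding regular_pentagon_def by simp
qed

text \<open>The tangent at \<open>q $ i\<close> bounds an open half-plane that contains all other
  points of the circle.\<close>

lemma convex_configuration_on_circle:
  assumes r: "\<And>i. dist o' (q $ i) = r" and inj: "\<And>i j. i \<noteq> j \<Longrightarrow> q $ i \<noteq> q $ j"
  shows "convex_configuration q"
  unfolding convex_configuration_def
proof (intro allI notI)
  fix i assume hull: "q $ i \<in> convex hull ((\<lambda>j. q $ j) ` (UNIV - {i}))"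
  let ?H = "{v. (q $ i - o') \<bullet> v < (q $ i - o') \<bullet> q $ i}"
  have "q $ j \<in> ?H" if "j \<noteq> i" for j
  proof -
    let ?a = "q $ i - o'" and ?b = "q $ j - o'"
    have n: "norm ?a = r" "norm ?b = r" using r[of i] r[of j] by (simp_all add: dist_norm norm_minus_commute)
    have pos: "0 < (norm (?a - ?b))\<^sup>2" using inj[of i j] that by simp
    have ab: "?a \<bullet> ?b = (r\<^sup>2 + r\<^sup>2 - (norm (?a - ?b))\<^sup>2) / 2"
      using dot_norm_neg[of ?a ?b] unfolding n .
    have aa: "?a \<bullet> ?a = r\<^sup>2" using dot_square_norm[of ?a] unfolding n .
    have "?a \<bullet> ?b < ?a \<bullet> ?a" unfolding ab aa using pos by simp
    then show ?thesis by (simp add: inner_diff_right)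
  qed
  then have "(\<lambda>j. q $ j) ` (UNIV - {i}) \<subseteq> ?H" by auto
  then have "convex hull ((\<lambda>j. q $ j) ` (UNIV - {i})) \<subseteq> ?H"
    by (intro hull_minimal convex_halfspace_lt)
  then show False using hull by auto
qed

section \<open>Classification\<close>

lemma pentagon_pairs_normal_form:
  assumes "(q, m) \<in> pentagon_pairs"
  obtains x y z w m' where "((q, m), (house x y z, m')) \<in> same_class" "side_relations x y w"
    "z = y + w \<or> z = y - w" "\<And>i. 0 < m' $ i" "(\<Sum>i\<in>UNIV. m' $ i) = 1" "central_configuration (house x y z) m'"
proof -
  have "sym_equilateral_pentagon_vertices q" and pos: "\<And>i. 0 < m $ i" and m: "(\<Sum>i\<in>UNIV. m $ i) = 1"
    and cc: "central_configuration q m"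
    using assms by (auto simp: pentagon_pairs_def)
  then obtain \<sigma> where \<sigma>: "bij \<sigma>" "equilateral_pentagon (relabel \<sigma> q)" "has_symmetry_axis (relabel \<sigma> q)"
    unfolding sym_equilateral_pentagon_vertices_def by blast
  obtain x y z w \<rho> c t and A :: "real^2^2" where \<rho>: "bij \<rho>" "rotation_matrix A" "0 < c"
    and house: "\<And>i. house x y z $ i = c *\<^sub>R (A *v (relabel \<sigma> q $ \<rho> i)) + t"
    and rel: "side_relations x y w" and z: "z = y + w \<or> z = y - w"
    by (rule normal_form[OF \<sigma>(2,3)]) (rule that; (assumption | simp only:))
  define \<tau> where "\<tau> = \<sigma> \<circ> \<rho>"
  have \<tau>: "bij \<tau>" using \<sigma> \<rho> by (simp add: \<tau>_def bij_comp)
  have "bij id \<and> rotation_matrix A \<and> 0 < c \<and>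
      (\<forall>i. house x y z $ id i = c *\<^sub>R (A *v (relabel \<tau> q $ i)) + t) \<and> (\<forall>i. relabel \<tau> m $ id i = relabel \<tau> m $ i)"
    using \<rho> house by (simp add: relabel_def \<tau>_def)
  then have "((relabel \<tau> q, relabel \<tau> m), (house x y z, relabel \<tau> m)) \<in> same_class"
    unfolding same_class_def by blast
  then have class': "((q, m), (house x y z, relabel \<tau> m)) \<in> same_class"
    using trans_same_class[OF sym_same_class[OF relabel_same_class[OF \<tau>]]] by blast
  have "(\<Sum>i\<in>UNIV. relabel \<tau> m $ i) = 1"
    using sum.reindex_bij_betw[OF \<tau>, of "\<lambda>i. m $ i"] m by (simp add: relabel_def)
  with class' rel z pos central_configuration_same_class[OF class' m cc] that show ?thesis
    by (simp add: relabel_def)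
qed

lemma house_in_pentagon_pairs:
  assumes "side_relations x y w" "z = y + w \<or> z = y - w" "1/2 < x" "0 < z"
    and "\<And>i. 0 < m $ i" "(\<Sum>i\<in>UNIV. m $ i) = 1" "central_configuration (house x y z) m"
  shows "(house x y z, m) \<in> pentagon_pairs"
proof -
  have "relabel id (house x y z) = house x y z" by (simp add: relabel_def vec_eq_iff)
  then have "bij id \<and> equilateral_pentagon (relabel id (house x y z)) \<and> has_symmetry_axis (relabel id (house x y z))"
    using equilateral_house[OF assms(1-4)] by simp
  then show ?thesis
    using assms unfolding pentagon_pairs_def sym_equilateral_pentagon_vertices_def by blast
qed

lemma golden_cubes:
  assumes rel: "side_relations x y w" and x: "4 * x\<^sup>2 - 2 * x - 1 = 0"
  shows "B_cube x = A_cube x" "C_cube (y + w) = A_cube x" "A_cube x < 1"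
  using golden_house[OF rel x] A_cube_less_1_iff[of x] side_relations_bounds(1)[OF rel]
  by (simp_all add: A_cube_def B_cube_def C_cube_def)

lemma convex_branch_masses:
  assumes rel: "side_relations x y w" and cc: "central_configuration (house x y (y + w)) m"
    and pos: "\<And>i. 0 < m $ i" and m: "(\<Sum>i\<in>UNIV. m $ i) = 1"
  shows "4 * x\<^sup>2 - 2 * x - 1 = 0" "m $ i = 1/5"
proof -
  have z: "y + w = y + w \<or> y + w = y - w" by simp
  note b = central_configuration_imp_balanced[OF rel z cc]
  show x: "4 * x\<^sup>2 - 2 * x - 1 = 0" using convex_branch_unique[OF rel b(3)] pos by blast
  note g = golden_house[OF rel x] golden_cubes[OF rel x]
  have k: "0 < (1 - A_cube x) * (y + w)" using g(10) side_relations_bounds[OF rel] by simp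
  \<comment> \<open>With equal diagonals, and \<open>2 * x * y = y + w\<close>, all coefficients of
    the first two relations become the same positive number.\<close>
  have e: "m $ 1 * ((1 - A_cube x) * (y + w)) = m $ 3 * ((1 - A_cube x) * (y + w))"
    "m $ 3 * ((1 - A_cube x) * (y + w)) = m $ 4 * ((1 - A_cube x) * (y + w))"
    using b(3) unfolding balanced_def g(6,8,9) g(3)[symmetric] by (simp_all add: mult.assoc)
  have "m $ 1 = m $ 3" "m $ 3 = m $ 4"
    using e unfolding mult_right_cancel[OF less_imp_neq[OF k, symmetric]] .
  then have "\<forall>i. m $ i = 1/5" using b(1,2) m unfolding forall_5 sum_5 by simp
  then show "m $ i = 1/5" by blast
qed

lemma golden_central_configuration:
  assumes rel: "side_relations x y w" and x: "4 * x\<^sup>2 - 2 * x - 1 = 0"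
  shows "central_configuration (house x y (y + w)) (vector [1/5, 1/5, 1/5, 1/5, 1/5])"
proof (rule balanced_imp_central_configuration[OF rel])
  note g = golden_house[OF rel x] golden_cubes[OF rel x]
  show "(y + w) * (x + 1/2) - y / 2 \<noteq> 0" unfolding g(6) using side_relations_bounds[OF rel] by simp
  have "2 * x * (y + w - y) = y" using g(2) by simp
  then show "balanced x y (y + w) (1/5) (1/5) (1/5)"
    unfolding balanced_def g(6-9) g(3)[symmetric] by simp
qed simp_all

text \<open>\<open>h\<close> is the height of the circumcentre, solved from equal distance to the
  base vertices and to the level \<open>y\<close>; the golden relation brings the apex onto the same
  circle.\<close>

lemma golden_circle:
  assumes rel: "side_relations x y w" and x: "4 * x\<^sup>2 - 2 * x - 1 = 0"
  defines "h \<equiv> (x + 1/2) / (2 * y)"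
  shows "dist (vector [0, h]) (house x y (y + w) $ i) = sqrt (1/4 + h\<^sup>2)"
proof -
  note rb = side_relations_bounds[OF rel] and g = golden_house[OF rel x]
  have hy: "2 * h * y = x + 1/2" using rb by (simp add: h_def)
  have x2: "x\<^sup>2 = x / 2 + 1/4" using x by simp
  have "x\<^sup>2 + (h - y)\<^sup>2 = 1/4 + h\<^sup>2"
  proof -
    have "x\<^sup>2 + (h - y)\<^sup>2 = x\<^sup>2 + y\<^sup>2 + h\<^sup>2 - 2 * h * y" by (simp add: power2_diff)
    then show ?thesis unfolding hy rb(7) by simp
  qed
  moreover have "(h - (y + w))\<^sup>2 = 1/4 + h\<^sup>2"
  proof -
    have "1 / 4 + (y + w)\<^sup>2 = (sqrt (1 / 4 + (y + w)\<^sup>2))\<^sup>2" by simp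
    then have z2: "(y + w)\<^sup>2 = 4 * x\<^sup>2 - 1/4" unfolding g(5) by (simp add: power_mult_distrib)
    have "(h - (y + w))\<^sup>2 = (y + w)\<^sup>2 + h\<^sup>2 - 2 * h * (y + w)" by (simp add: power2_diff)
    also have "2 * h * (y + w) = 2 * x * (2 * h * y)" unfolding g(3) by simp
    also have "\<dots> = 2 * x\<^sup>2 + x" unfolding hy by (simp add: algebra_simps power2_eq_square)
    finally show ?thesis unfolding z2 x2 by simp
  qed
  ultimately have "\<forall>i. dist (vector [0, h]) (house x y (y + w) $ i) = sqrt (1/4 + h\<^sup>2)"
    unfolding forall_5 dist_2 house_nth by (simp add: power2_eq_square)
  then show ?thesis by blast
qed

section \<open>Assembly of the two classes\<close>

lemma approx_iff: "approx u v \<longleftrightarrow> v - 1 / 10 ^ 6 < u \<and> u < v + 1 / 10 ^ 6"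
  unfolding approx_def by (rule abs_diff_less_iff)

theorem theorem1:
  shows "\<exists>(qa :: config) (ma :: masses) (qb :: config) (mb :: masses).
    (qa, ma) \<in> pentagon_pairs \<and> (qb, mb) \<in> pentagon_pairs \<and>
    pentagon_pairs // same_class = {same_class `` {(qa, ma)}, same_class `` {(qb, mb)}} \<and>
    card (pentagon_pairs // same_class) = 2 \<and>
    (regular_pentagon qa \<and> convex_configuration qa \<and> (\<forall>i. ma $ i = 1 / 5)) \<and>
    (concave_configuration qb \<and>
     (\<exists>x3 y3 y5 :: real.
        qb = vector [vector [1 / 2, 0], vector [- 1 / 2, 0],
                     vector [x3, y3], vector [- x3, y3], vector [0, y5]] \<and>
        approx x3 0.5402091568 \<and> approx y3 0.9991912848 \<and> approx y5 0.1576604970) \<and>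
     (let p = vector [qb $ 1, qb $ 2, qb $ 4, qb $ 5, qb $ 3] :: config in
        equilateral_pentagon p \<and> has_symmetry_axis p \<and>
        (\<forall>i. dist (p $ i) (p $ (i + 1)) = 1)) \<and>
     mb $ 1 = mb $ 2 \<and> approx (mb $ 1) 0.0922539749 \<and>
     mb $ 3 = mb $ 4 \<and> approx (mb $ 3) 0.3860948766 \<and>
     approx (mb $ 5) 0.04330242730)"
proof -
  \<comment> \<open>Half the golden ratio, the positive zero of
    \<open>4 * x\<^sup>2 - 2 * x - 1\<close>.\<close>
  define xa :: real where "xa = (1 + sqrt 5) / 4"
  define ya wa where "ya = sqrt (3/4 + xa - xa\<^sup>2)" and "wa = sqrt (1 - xa\<^sup>2)"
  define qa where "qa = house xa ya (ya + wa)"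
  define ma :: masses where "ma = vector [1/5, 1/5, 1/5, 1/5, 1/5]"
  have xa: "4 * xa\<^sup>2 - 2 * xa - 1 = 0" by (simp add: xa_def power2_eq_square field_simps)
  have "sqrt 5 < 3" by (rule real_less_lsqrt) simp_all
  then have "0 < xa" "xa < 1" by (simp_all add: xa_def add_pos_pos)
  then have rela: "side_relations xa ya wa" unfolding ya_def wa_def by (rule side_relations_sqrt)
  note ga = golden_house[OF rela xa] and rba = side_relations_bounds[OF rela]
  have za: "ya + wa = ya + wa \<or> ya + wa = ya - wa" and za0: "0 < ya + wa" using rba by simp_all
  note eqa = equilateral_house[OF rela za ga(1) za0, folded qa_def]
  have ma: "ma $ i = 1/5" for i using exhaust_5[of i] by (auto simp: ma_def)
  have paira: "(qa, ma) \<in> pentagon_pairs"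
    unfolding qa_def using rela za ga(1) za0
  proof (rule house_in_pentagon_pairs)
    show "central_configuration (house xa ya (ya + wa)) ma"
      unfolding ma_def by (rule golden_central_configuration[OF rela xa])
  qed (simp_all add: ma)
  have "\<forall>i. dist (qa $ (i - 1)) (qa $ (i + 1)) = 2 * xa"
    unfolding forall_5 qa_def using dist_house[OF rela za] ga(4,5)
    by (simp add: mod_5 dist_commute)
  then have regular: "regular_pentagon qa"
    using regular_pentagonI[OF eqa(1,2)] by blast
  have "convex_configuration qa"
    using eqa(1) unfolding qa_def equilateral_pentagon_def pentagon_def
    by (intro convex_configuration_on_circle[OF golden_circle[OF rela xa]]) blast

  obtain x y w where rel: "side_relations x y w" and x: "root_left \<le> x" "x \<le> root_right"
    and eq: "concave_equation x y w"
    using concave_solution by blast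
  define z where "z = y - w"
  define r1 r5 where "r1 = mass_ratio_1 x y w" and "r5 = mass_ratio_5 x y w"
  define b where "b = 1 / (2 * r1 + 2 + r5)"
  define mh :: masses where "mh = vector [r1 * b, r1 * b, b, r5 * b, b]"
  \<comment> \<open>Passes from the cyclic order of \<open>house\<close> to the required numbering:
    bodies 3, 4, 5 are the components 0, 3, 4 of \<open>house\<close>, and 5 = 0 as an index.
    \<open>\<tau>\<close> is its inverse.\<close>
  define \<sigma> :: "5 \<Rightarrow> 5" where "\<sigma> i = (if i = 3 then 0 else if i = 4 then 3 else if i = 0 then 4 else i)" for i
  define \<tau> :: "5 \<Rightarrow> 5" where "\<tau> i = (if i = 0 then 3 else if i = 3 then 4 else if i = 4 then 0 else i)" for i
  define qb where "qb = relabel \<sigma> (house x y z)"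
  define mb where "mb = relabel \<sigma> mh"
  note e = box_enclosure[OF box_root rel x, folded z_def]
  note rb = side_relations_bounds[OF rel]
  have x': "1/2 < x" "x \<le> 14/25" using x by (simp_all add: root_left_def root_right_def)
  have ex: "0 < excess x y w" using e(13,14) by linarith
  have yb: "999191284715 / 10^12 \<le> y" "y \<le> 999191285119 / 10^12" using e(3,4) .
  \<comment> \<open>The endpoints are the differences \<open>yl - wu\<close> and
    \<open>yu - wl\<close> of the bounds in \<open>box_root\<close>.\<close>
  have zb: "157660492493 / 10^12 \<le> z" "z \<le> 157660499318 / 10^12" using e(6,7) by simp_all
  have z0: "0 < z" "z < y" using zb rb by (simp_all add: z_def)
  have z: "z = y + w \<or> z = y - w" by (simp add: z_def)
  have r1: "2389410220 / 10^10 \<le> r1" "r1 \<le> 2389410534 / 10^10"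
    and r5: "1121548659 / 10^10 \<le> r5" "r5 \<le> 1121548974 / 10^10"
    unfolding r1_def r5_def using concave_mass_bounds[OF rel x] .
  have "1 / (2 * (2389410534 / 10^10) + 2 + 1121548974 / 10^10) \<le> b"
    unfolding b_def using r1 r5 by (intro divide_left_mono) (auto intro!: mult_pos_pos add_pos_pos)
  moreover have "b \<le> 1 / (2 * (2389410220 / 10^10) + 2 + 1121548659 / 10^10)"
    unfolding b_def using r1 r5 by (intro divide_left_mono) (auto intro!: mult_pos_pos add_pos_pos)
  ultimately have b: "38609486 / 10^8 \<le> b" "b \<le> 38609489 / 10^8" by simp_all
  have a': "2389410220 / 10^10 * (38609486 / 10^8) \<le> r1 * b" "r1 * b \<le> 2389410534 / 10^10 * (38609489 / 10^8)"
    and c': "1121548659 / 10^10 * (38609486 / 10^8) \<le> r5 * b" "r5 * b \<le> 1121548974 / 10^10 * (38609489 / 10^8)"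
    using r1 r5 b by (intro mult_mono; simp)+
  have pos: "0 < r1 * b" "0 < b" "0 < r5 * b" using a' b c' by simp_all
  have sum: "2 * (r1 * b) + 2 * b + r5 * b = 1"
  proof -
    have "2 * (r1 * b) + 2 * b + r5 * b = (2 * r1 + 2 + r5) * b" by (simp add: algebra_simps)
    then show ?thesis using r1 r5 by (simp add: b_def)
  qed
  have bal: "balanced x y z (r1 * b) b (r5 * b)"
    unfolding z_def r1_def r5_def using rel z0(1)[unfolded z_def] ex eq by (rule balanced_concave)
  have E: "z * (x + 1/2) - y / 2 \<noteq> 0" using ex by (simp add: excess_def z_def field_simps)
  have cch: "central_configuration (house x y z) mh"
    unfolding mh_def by (rule balanced_imp_central_configuration[OF rel z E sum bal])
  have "\<forall>i. 0 < mh $ i" unfolding forall_5 using pos by (simp add: mh_def)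
  moreover have "(\<Sum>i\<in>UNIV. mh $ i) = 2 * (r1 * b) + 2 * b + r5 * b" by (simp add: sum_5 mh_def)
  ultimately have mh: "0 < mh $ i" "(\<Sum>i\<in>UNIV. mh $ i) = 1" for i
    unfolding sum by blast+
  note eqb = equilateral_house[OF rel z x'(1) z0(1)]
  have \<sigma>\<tau>: "\<forall>i. \<sigma> (\<tau> i) = i" "\<forall>i. \<tau> (\<sigma> i) = i"
    unfolding forall_5 by (simp_all add: \<sigma>_def \<tau>_def)
  then have bij: "bij \<sigma>" "bij \<tau>" by (auto intro!: o_bij[of \<tau> \<sigma>] o_bij[of \<sigma> \<tau>] simp: fun_eq_iff)
  have classb: "((house x y z, mh), (qb, mb)) \<in> same_class"
    unfolding qb_def mb_def by (rule sym_same_class[OF relabel_same_class[OF bij(1)]])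
  have \<tau>qb: "relabel \<tau> qb = house x y z" using \<sigma>\<tau>(1) by (simp add: qb_def relabel_def vec_eq_iff)
  have pairb: "(qb, mb) \<in> pentagon_pairs"
  proof -
    have "sym_equilateral_pentagon_vertices qb"
      unfolding sym_equilateral_pentagon_vertices_def using bij(2) \<tau>qb eqb by metis
    moreover have "(\<Sum>i\<in>UNIV. mb $ i) = 1"
      using sum.reindex_bij_betw[OF bij(1), of "\<lambda>i. mh $ i"] mh by (simp add: mb_def relabel_def)
    ultimately show ?thesis
      using mh(1) central_configuration_same_class[OF classb mh(2) cch]
      by (simp add: pentagon_pairs_def mb_def relabel_def)
  qed

  have classes: "(p, (qa, ma)) \<in> same_class \<or> (p, (qb, mb)) \<in> same_class" if "p \<in> pentagon_pairs" for p
  proof -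
    obtain q m where p: "p = (q, m)" by (cases p)
    have "(q, m) \<in> pentagon_pairs" using that p by simp
    then obtain x1 y1 z1 w1 m1 where h: "((q, m), (house x1 y1 z1, m1)) \<in> same_class" "side_relations x1 y1 w1"
      "z1 = y1 + w1 \<or> z1 = y1 - w1" "\<And>i. 0 < m1 $ i" "(\<Sum>i\<in>UNIV. m1 $ i) = 1" "central_configuration (house x1 y1 z1) m1"
      by (rule pentagon_pairs_normal_form) blast
    show ?thesis using h(3)
    proof
      assume z1: "z1 = y1 + w1"
      note u = convex_branch_masses[OF h(2) h(6)[unfolded z1] h(4,5)]
      \<comment> \<open>The difference of the two quadratic equations; the second factor is positive
        since both abscissas exceed 1/2.\<close>
      have "(x1 - xa) * (4 * (x1 + xa) - 2) = 0" using xa u(1) by (simp add: algebra_simps power2_eq_square)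
      moreover have "1/2 < x1" using golden_house(1)[OF h(2) u(1)] .
      ultimately have "x1 = xa" using ga(1) by simp
      then have "y1 = ya" "w1 = wa"
        using side_relations_bounds[OF h(2)] rba by (auto intro: power2_eq_imp_eq)
      then have "house x1 y1 z1 = qa" by (simp add: qa_def z1 \<open>x1 = xa\<close>)
      moreover have "m1 = ma" unfolding vec_eq_iff u(2) ma by simp
      ultimately show ?thesis using h(1) by (simp add: p)
    next
      assume z1: "z1 = y1 - w1"
      note u = central_configuration_imp_balanced[OF h(2,3,6)]
      note bal1 = u(3)[unfolded z1]
      note s = concave_branch_signs[OF h(2) bal1 h(4) h(4) h(4)]
      have ex1: "0 < excess x1 y1 w1" using s(4) by (simp add: excess_def)
      have same: "x1 = x" "y1 = y" "w1 = w"
        using concave_branch_determined[OF h(2) rel s(1) _ x' concave_branch_equation[OF bal1 h(4)] eq ex1 ex]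
          concave_branch_x_bound[OF h(2) bal1 h(4) h(4) h(4)] by auto
      have r: "m1 $ 1 = r1 * m1 $ 3" "m1 $ 4 = r5 * m1 $ 3"
        using concave_branch_mass_ratios[OF h(2) s(3) ex1 bal1] unfolding same r1_def r5_def .
      have "(2 * r1 + 2 + r5) * m1 $ 3 = 1"
        using h(5) u(1,2) unfolding sum_5 by (simp add: r algebra_simps)
      then have "m1 $ 3 = b" using r1 r5 by (simp add: b_def field_simps)
      then have "\<forall>i. m1 $ i = mh $ i" unfolding forall_5 using r u(1,2) by (simp add: mh_def)
      then have "m1 = mh" by (simp add: vec_eq_iff)
      then show ?thesis using trans_same_class[OF h(1)] classb by (simp add: p same z1 z_def)
    qed
  qed
  have mb: "mb $ 1 = r1 * b" "mb $ 2 = r1 * b" "mb $ 3 = b" "mb $ 4 = b" "mb $ 0 = r5 * b"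
    by (simp_all add: mb_def mh_def relabel_def \<sigma>_def)
  have distinct: "same_class `` {(qa, ma)} \<noteq> same_class `` {(qb, mb)}"
  proof
    assume "same_class `` {(qa, ma)} = same_class `` {(qb, mb)}"
    then have "((qa, ma), (qb, mb)) \<in> same_class"
      using eq_equiv_class[OF _ equiv_same_class] by blast
    \<comment> \<open>Relabelling preserves the mass values, but \<open>mb $ 1\<close>, about 0.092,
      differs from 1/5.\<close>
    then obtain \<sigma>' where \<sigma>': "bij \<sigma>'" "\<forall>i. mb $ \<sigma>' i = ma $ i" unfolding same_class_def by blast
    then obtain i where "\<sigma>' i = 1" by (metis bij_pointE)
    then have "mb $ 1 = 1/5" using \<sigma>'(2) ma by metis
    then show False using a' by (simp add: mb)
  qed
  have quotient: "pentagon_pairs // same_class = {same_class `` {(qa, ma)}, same_class `` {(qb, mb)}}"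
  proof
    show "pentagon_pairs // same_class \<subseteq> {same_class `` {(qa, ma)}, same_class `` {(qb, mb)}}"
    proof
      fix X assume "X \<in> pentagon_pairs // same_class"
      then obtain p where p: "p \<in> pentagon_pairs" "X = same_class `` {p}" by (elim quotientE)
      then show "X \<in> {same_class `` {(qa, ma)}, same_class `` {(qb, mb)}}"
        using classes[OF p(1)] equiv_class_eq[OF equiv_same_class] by (metis insertCI)
    qed
    show "{same_class `` {(qa, ma)}, same_class `` {(qb, mb)}} \<subseteq> pentagon_pairs // same_class"
      using paira pairb by (auto intro: quotientI)
  qed
  have qb: "qb = vector [vector [1 / 2, 0], vector [- 1 / 2, 0], vector [x, y], vector [- x, y], vector [0, z]]"
    unfolding vec_eq_iff[of qb] forall_5 by (simp add: qb_def relabel_def \<sigma>_def house_def)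
  have p: "(vector [qb $ 1, qb $ 2, qb $ 4, qb $ 5, qb $ 3] :: config) = house x y z"
    by (simp add: qb house_def mod_5)
  have "qb $ 0 \<in> convex hull ((\<lambda>j. qb $ j) ` (UNIV - {0}))" (is "_ \<in> ?H")
  proof -
    have in_H: "qb $ 1 \<in> ?H" "qb $ 2 \<in> ?H" "qb $ 3 \<in> ?H" "qb $ 4 \<in> ?H"
      by (auto intro!: hull_inc)
    have cvx: "(1 - t) *\<^sub>R u + t *\<^sub>R v \<in> ?H" if "u \<in> ?H" "v \<in> ?H" "0 \<le> t" "t \<le> 1" for t u v
      using that by (intro convexD_alt) auto
    \<comment> \<open>Since \<open>0 < z < y\<close>, body 5 lies on the axis between the midpoint
      of bodies 1 and 2 and the midpoint of bodies 3 and 4.\<close>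
    have "(1 - z / y) *\<^sub>R ((1 - 1/2) *\<^sub>R qb $ 1 + (1/2) *\<^sub>R qb $ 2) + (z / y) *\<^sub>R ((1 - 1/2) *\<^sub>R qb $ 3 + (1/2) *\<^sub>R qb $ 4) \<in> ?H"
      using in_H z0 rb by (intro cvx) auto
    also have "(1 - z / y) *\<^sub>R ((1 - 1/2) *\<^sub>R qb $ 1 + (1/2) *\<^sub>R qb $ 2) + (z / y) *\<^sub>R ((1 - 1/2) *\<^sub>R qb $ 3 + (1/2) *\<^sub>R qb $ 4) = qb $ 0"
      using rb(3) by (simp add: qb vec_eq_iff forall_2)
    finally show ?thesis .
  qed
  then have concave: "concave_configuration qb" unfolding convex_configuration_def by blast
  have xb: "approx x 0.5402091568" using x by (simp add: approx_iff root_left_def root_right_def)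
  have yzb: "approx y 0.9991912848" "approx z 0.1576604970" using yb zb by (simp_all add: approx_iff)
  have mass: "mb $ 1 = mb $ 2" "approx (mb $ 1) 0.0922539749" "mb $ 3 = mb $ 4" "approx (mb $ 3) 0.3860948766"
    "approx (mb $ 5) 0.04330242730"
    using a' b c' by (simp_all add: mb mod_5 approx_iff)
  show ?thesis
  proof (rule exI[of _ qa], rule exI[of _ ma], rule exI[of _ qb], rule exI[of _ mb], intro conjI)
    show "card (pentagon_pairs // same_class) = 2" unfolding quotient using distinct by simp
    show "\<exists>x3 y3 y5 :: real. qb = vector [vector [1 / 2, 0], vector [- 1 / 2, 0],
        vector [x3, y3], vector [- x3, y3], vector [0, y5]] \<and>
        approx x3 0.5402091568 \<and> approx y3 0.9991912848 \<and> approx y5 0.1576604970"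
      using qb xb yzb by blast
    show "let p = vector [qb $ 1, qb $ 2, qb $ 4, qb $ 5, qb $ 3] :: config in
        equilateral_pentagon p \<and> has_symmetry_axis p \<and> (\<forall>i. dist (p $ i) (p $ (i + 1)) = 1)"
      unfolding Let_def p using eqb by blast
  qed (use paira pairb quotient regular \<open>convex_configuration qa\<close> ma concave mass in auto)
qed

end
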